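(* Let $d\ge 1$ and let $V\in L^\infty_{\mathrm{loc}}(\mathbb{R}^d)$ be real-valued such that $H=-\Delta+V$ is self-adjoint on $L^2(\mathbb{R}^d)$. Assume $V$ is a critical potential, and that there are $\epsilon>0$ and $R_0>1$ such that for all $|x|\ge R_0$ $$V(x)\ \ge\ \frac{d(4-d)}{4|x|^2}+\frac{1+\epsilon}{|x|^2\ln|x|}+\frac{3+\epsilon}{4|x|^2(\ln|x|)^2}.$$ Then $H$ has a ground state with energy $0$, i.e. there is a nonzero $\psi\in L^2(\mathbb{R}^d)$ in the domain of $H$ with $H\psi=0$.
   Context: A potential $V$ is called critical if $H=-\Delta+V\ge 0$ (i.e. $\langle\psi,H\psi\rangle\ge0$ for all $\psi$ in the domain of $H$), but for every nonnegative function $W$ (bounded, compactly supported) which is not identically zero, the operator $H-W$ has a negative eigenvalue (a bound state with negative energy). *)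

theory Defs
  imports "HOL-Analysis.Analysis"
begin

fun pder :: "'n::finite list \<Rightarrow> (real^'n \<Rightarrow> real) \<Rightarrow> real^'n \<Rightarrow> real" where
  "pder [] f = f"
| "pder (i # is) f = (\<lambda>x. deriv (\<lambda>t. pder is f (x + t *\<^sub>R axis i 1)) 0)"

definition smooth_fun :: "(real^'n::finite \<Rightarrow> real) \<Rightarrow> bool" where
  "smooth_fun f \<longleftrightarrow>
     (\<forall>is. continuous_on UNIV (pder is f) \<and>
       (\<forall>i x. (\<lambda>t. pder is f (x + t *\<^sub>R axis i 1)) differentiable (at 0)))"

definition test_fun :: "(real^'n::finite \<Rightarrow> real) \<Rightarrow> bool" where
  "test_fun f \<longleftrightarrow> smooth_fun f \<and> (\<exists>R. \<forall>x. norm x > R \<longrightarrow> f x = 0)"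

definition laplacian :: "(real^'n::finite \<Rightarrow> real) \<Rightarrow> real^'n \<Rightarrow> real" where
  "laplacian f x = (\<Sum>i\<in>UNIV. pder [i, i] f x)"

definition L2 :: "(real^'n::finite \<Rightarrow> complex) \<Rightarrow> bool" where
  "L2 f \<longleftrightarrow> f \<in> borel_measurable lebesgue \<and> integrable lebesgue (\<lambda>x. (cmod (f x))^2)"

definition ip :: "(real^'n::finite \<Rightarrow> complex) \<Rightarrow> (real^'n \<Rightarrow> complex) \<Rightarrow> complex" where
  "ip f g = integral\<^sup>L lebesgue (\<lambda>x. cnj (f x) * g x)"

text \<open>Graph of the (maximal) Schroedinger operator H = -Laplacian + V on L^2(R^n):
  schrod V psi g means psi in L^2, g in L^2 and -Laplacian psi + V psi = g in the sense
  of distributions; i.e. psi is in the domain of H and H psi = g.\<close>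
definition schrod :: "(real^'n::finite \<Rightarrow> real) \<Rightarrow> (real^'n \<Rightarrow> complex) \<Rightarrow> (real^'n \<Rightarrow> complex) \<Rightarrow> bool" where
  "schrod V psi g \<longleftrightarrow> L2 psi \<and> L2 g \<and>
     (\<forall>\<phi>. test_fun \<phi> \<longrightarrow>
        integral\<^sup>L lebesgue (\<lambda>x. psi x * complex_of_real (V x * \<phi> x - laplacian \<phi> x))
        = integral\<^sup>L lebesgue (\<lambda>x. g x * complex_of_real (\<phi> x)))"

text \<open>H is self-adjoint: the graph of its adjoint equals its graph.\<close>
definition schrod_self_adjoint :: "(real^'n::finite \<Rightarrow> real) \<Rightarrow> bool" where
  "schrod_self_adjoint V \<longleftrightarrow>
     (\<forall>\<phi> \<eta>. (L2 \<phi> \<and> L2 \<eta> \<and> (\<forall>psi g. schrod V psi g \<longrightarrow> ip \<phi> g = ip \<eta> psi))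
              \<longleftrightarrow> schrod V \<phi> \<eta>)"

definition L_inf_loc :: "(real^'n::finite \<Rightarrow> real) \<Rightarrow> bool" where
  "L_inf_loc V \<longleftrightarrow> V \<in> borel_measurable lebesgue \<and>
     (\<forall>K. compact K \<longrightarrow> (\<exists>M. AE x in lebesgue. x \<in> K \<longrightarrow> \<bar>V x\<bar> \<le> M))"

definition schrod_nonneg :: "(real^'n::finite \<Rightarrow> real) \<Rightarrow> bool" where
  "schrod_nonneg V \<longleftrightarrow> (\<forall>psi g. schrod V psi g \<longrightarrow> ip psi g \<in> \<real> \<and> 0 \<le> Re (ip psi g))"

text \<open>H - W has a negative eigenvalue (W bounded, so dom(H - W) = dom(H)).\<close>
definition has_neg_eigenvalue_minus :: "(real^'n::finite \<Rightarrow> real) \<Rightarrow> (real^'n \<Rightarrow> real) \<Rightarrow> bool" where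
  "has_neg_eigenvalue_minus V W \<longleftrightarrow>
     (\<exists>E::real. E < 0 \<and> (\<exists>psi g. schrod V psi g \<and> \<not> (AE x in lebesgue. psi x = 0) \<and>
        (AE x in lebesgue. g x - complex_of_real (W x) * psi x = complex_of_real E * psi x)))"

definition admissible_W :: "(real^'n::finite \<Rightarrow> real) \<Rightarrow> bool" where
  "admissible_W W \<longleftrightarrow> W \<in> borel_measurable lebesgue \<and> (\<forall>x. 0 \<le> W x) \<and>
     (\<exists>M. \<forall>x. W x \<le> M) \<and> (\<exists>R. \<forall>x. norm x > R \<longrightarrow> W x = 0) \<and>
     \<not> (AE x in lebesgue. W x = 0)"

definition critical :: "(real^'n::finite \<Rightarrow> real) \<Rightarrow> bool" where
  "critical V \<longleftrightarrow> schrod_nonneg V \<and>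
     (\<forall>W. admissible_W W \<longrightarrow> has_neg_eigenvalue_minus V W)"

end

theory Submission
  imports Defs "HOL-Library.Diagonal_Subsequence" "HOL-Complex_Analysis.Great_Picard"
begin

text \<open>For \<open>W = 1\<^bsub>B\<^esub> / n\<close> with the unit ball \<open>B\<close>, criticality yields an eigenfunction of \<open>H - W\<close> with
  eigenvalue \<open>E < 0\<close>, and \<open>H \<ge> 0\<close> forces \<open>E \<ge> - 1 / n\<close>. A strong \<open>L\<^sup>2\<close> limit of normalised
  eigenfunctions is the desired zero-energy ground state, so everything rests on compactness.

  Tightness: write \<open>- \<Delta> u = f\<close> and test with \<open>|x|\<^sup>2 Y\<^sup>2 u\<close>, where \<open>Y = y (ln |x|\<^sup>2)\<close> is supported away
  from the origin. Hardy's inequality and the IMS localisation formula together amount to completing one square and give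
  \<open>\<integral> u\<^sup>2 (d (d - 4) / 4 Y\<^sup>2 - 4 Y Y' - 4 Y'\<^sup>2) \<le> \<integral> |x|\<^sup>2 Y\<^sup>2 u f\<close>. With the lower bound on \<open>V\<close> the leading
  terms cancel and, for \<open>\<tau> = ln |x|\<^sup>2\<close>, there remains \<open>\<integral> u\<^sup>2 (2 (1 + \<epsilon>) / \<tau> y\<^sup>2 - 4 y y' - 4 y'\<^sup>2) \<le> 0\<close>.
  Taking \<open>y\<close> close to a power of \<open>\<tau>\<close> slightly above \<open>1/2\<close> bounds a positive logarithmic moment of \<open>u\<^sup>2\<close>
  uniformly.

  Local compactness: two mollifications of \<open>u\<close> at different scales differ by a convolution of \<open>f\<close> with a
  kernel of small \<open>L\<^sup>1\<close> norm, so the eigenfunctions are uniformly close to their mollifications, to which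
  Arzela-Ascoli applies.\<close>

section \<open>Square-integrable functions\<close>

text \<open>The lower bound on V compares it with \<Delta>\<psi> / \<psi> for \<psi> = |x|^(-d/2)
  (ln |x|)^(-1/2), d being the dimension: at \<epsilon> = 0 its three terms are exactly this
  quotient, and \<psi> just fails to be square-integrable at infinity. The surplus \<epsilon> is
  what leaves a positive logarithmic moment.

  The obstacle is that no spectral gap at 0 is available, so normalised eigenfunctions might
  converge weakly to 0 by escaping to infinity. A uniform bound on their tails is possible because
  the wells live in the unit ball and a nonpositive eigenvalue enters the estimate with a favourable
  sign.

  No Sobolev space is set up. The weighted inequality is proved for mollifications of u and arranged
  so that all gradients vanish into the completed square; it therefore survives an L^2 limit. Local
  compactness likewise rests on the equation tested against a kernel, not on a gradient bound. The
  weights depend on ln |x|^2 rather than ln |x| because |x|^2 is a polynomial in the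
  coordinates.\<close>

definition sqint :: "('a::euclidean_space \<Rightarrow> real) \<Rightarrow> bool" where
  "sqint v \<longleftrightarrow> v \<in> borel_measurable lborel \<and> integrable lborel (\<lambda>x. (v x)\<^sup>2)"

text \<open>The squared L^2 norm. Squares avoid roots, at the price of the factors 2 in
  \<open>nsq_add_le\<close> and \<open>nsq_triangle\<close>, which explain the fractions of
  tolerances chosen later.\<close>

definition nsq :: "('a::euclidean_space \<Rightarrow> real) \<Rightarrow> real" where
  "nsq v = (LBINT x. (v x)\<^sup>2)"

lemma sqint_measurable: "sqint v \<Longrightarrow> v \<in> borel_measurable borel"
  by (simp add: sqint_def)

lemma sqint_integrable: "sqint v \<Longrightarrow> integrable lborel (\<lambda>x. (v x)\<^sup>2)"
  by (simp add: sqint_def)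

lemma nsq_nonneg: "0 \<le> nsq v"
  by (simp add: nsq_def)

lemma sqint_bound:
  assumes "sqint v" "w \<in> borel_measurable borel" "\<And>x. (w x)\<^sup>2 \<le> C * (v x)\<^sup>2"
  shows "sqint w" "nsq w \<le> C * nsq v"
proof -
  have i: "integrable lborel (\<lambda>x. C * (v x)\<^sup>2)"
    using assms(1) by (simp add: sqint_def)
  have "integrable lborel (\<lambda>x. (w x)\<^sup>2)"
    by (rule Bochner_Integration.integrable_bound[OF i])
      (use assms in \<open>auto intro: order_trans[OF _ abs_ge_self]\<close>)
  then show s: "sqint w" using assms by (simp add: sqint_def)
  have "nsq w \<le> (LBINT x. C * (v x)\<^sup>2)"
    unfolding nsq_def by (rule integral_mono) (use s i assms in \<open>auto simp: sqint_def\<close>)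
  then show "nsq w \<le> C * nsq v" by (simp add: nsq_def)
qed

lemma sqint_cmult: "sqint v \<Longrightarrow> sqint (\<lambda>x. c * v x)"
  by (auto simp: sqint_def power_mult_distrib)

lemma nsq_cmult: "nsq (\<lambda>x. c * v x) = c\<^sup>2 * nsq v"
  by (simp add: nsq_def power_mult_distrib)

lemma sqint_mult_bounded:
  assumes "sqint v" "A \<in> borel_measurable borel" "\<And>x. \<bar>A x\<bar> \<le> M"
  shows "sqint (\<lambda>x. A x * v x)" "nsq (\<lambda>x. A x * v x) \<le> M\<^sup>2 * nsq v"
proof -
  have *: "(A x * v x)\<^sup>2 \<le> M\<^sup>2 * (v x)\<^sup>2" for x
    using assms(3)[of x] abs_le_square_iff[of "A x" M]
    by (auto simp: power_mult_distrib intro!: mult_right_mono)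
  have m: "(\<lambda>x. A x * v x) \<in> borel_measurable borel"
    using assms sqint_measurable by measurable
  show "sqint (\<lambda>x. A x * v x)" "nsq (\<lambda>x. A x * v x) \<le> M\<^sup>2 * nsq v"
    using sqint_bound[OF assms(1) m *] by auto
qed

lemma sqint_mult_integrable:
  assumes "sqint u" "sqint v"
  shows "integrable lborel (\<lambda>x. u x * v x)"
proof (rule Bochner_Integration.integrable_bound[where f="\<lambda>x. (u x)\<^sup>2 + (v x)\<^sup>2"])
  show "AE x in lborel. norm (u x * v x) \<le> norm ((u x)\<^sup>2 + (v x)\<^sup>2)"
  proof (rule AE_I2)
    fix x
    have "2 * (\<bar>u x\<bar> * \<bar>v x\<bar>) \<le> (u x)\<^sup>2 + (v x)\<^sup>2"
      using sum_squares_bound[of "\<bar>u x\<bar>" "\<bar>v x\<bar>"] by simp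
    moreover have "0 \<le> \<bar>u x\<bar> * \<bar>v x\<bar>" by simp
    ultimately have "\<bar>u x\<bar> * \<bar>v x\<bar> \<le> (u x)\<^sup>2 + (v x)\<^sup>2" by linarith
    then show "norm (u x * v x) \<le> norm ((u x)\<^sup>2 + (v x)\<^sup>2)"
      by (simp add: abs_mult)
  qed
qed (use assms in \<open>auto simp: sqint_def\<close>)

lemma sqint_add:
  assumes "sqint u" "sqint v"
  shows "sqint (\<lambda>x. u x + v x)"
proof -
  have "integrable lborel (\<lambda>x. (u x)\<^sup>2 + 2 * (u x * v x) + (v x)\<^sup>2)"
    using assms sqint_mult_integrable[OF assms] by (auto simp: sqint_def)
  then show ?thesis using assms by (auto simp: sqint_def power2_sum algebra_simps)
qed

lemma sqint_diff:
  assumes "sqint u" "sqint v"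
  shows "sqint (\<lambda>x. u x - v x)"
  using sqint_add[OF assms(1) sqint_cmult[OF assms(2), of "-1"]] by simp

lemma nsq_add_le:
  assumes "sqint u" "sqint v"
  shows "nsq (\<lambda>x. u x + v x) \<le> 2 * nsq u + 2 * nsq v"
proof -
  have "nsq (\<lambda>x. u x + v x) \<le> (LBINT x. 2 * (u x)\<^sup>2 + 2 * (v x)\<^sup>2)"
    unfolding nsq_def
  proof (rule integral_mono)
    fix x show "(u x + v x)\<^sup>2 \<le> 2 * (u x)\<^sup>2 + 2 * (v x)\<^sup>2"
      using sum_squares_bound[of "u x" "v x"] by (simp add: power2_sum)
  qed (use assms sqint_add[OF assms] in \<open>auto simp: sqint_def\<close>)
  also have "\<dots> = 2 * nsq u + 2 * nsq v"
    using assms by (simp add: nsq_def sqint_def)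
  finally show ?thesis .
qed

lemma nsq_minus_commute: "nsq (\<lambda>x. u x - v x) = nsq (\<lambda>x. v x - u x)"
  by (simp add: nsq_def power2_commute)

lemma nsq_triangle:
  assumes "sqint u" "sqint v" "sqint w"
  shows "nsq (\<lambda>x. u x - w x) \<le> 2 * nsq (\<lambda>x. u x - v x) + 2 * nsq (\<lambda>x. v x - w x)"
  using nsq_add_le[OF sqint_diff[OF assms(1,2)] sqint_diff[OF assms(2,3)]] by simp

lemma Cauchy_Schwarz_sqint:
  assumes "sqint u" "sqint v"
  shows "(LBINT x. u x * v x)\<^sup>2 \<le> nsq u * nsq v"
proof -
  define I where "I = (LBINT x. u x * v x)"
  have *: "0 \<le> nsq u - 2 * t * I + t\<^sup>2 * nsq v" for t
  proof -
    have "nsq (\<lambda>x. u x - t * v x) = (LBINT x. (u x)\<^sup>2 - 2 * t * (u x * v x) + t\<^sup>2 * (v x)\<^sup>2)"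
      unfolding nsq_def by (rule Bochner_Integration.integral_cong) (auto simp: power2_diff algebra_simps power_mult_distrib)
    also have "\<dots> = nsq u - 2 * t * I + t\<^sup>2 * nsq v"
      using assms sqint_mult_integrable[OF assms] by (simp add: nsq_def I_def sqint_def)
    finally show ?thesis using nsq_nonneg[of "\<lambda>x. u x - t * v x"] by simp
  qed
  show ?thesis
  proof (cases "nsq v = 0")
    case True
    have "I = 0"
    proof (rule ccontr)
      assume "I \<noteq> 0"
      \<comment> \<open>With \<open>nsq v = 0\<close> the quadratic is affine in \<open>t\<close>,
        and this \<open>t\<close> gives it the value -1.\<close>
      then show False using *[of "(nsq u + 1) / (2 * I)"] True by simp
    qed
    then show ?thesis by (simp add: I_def[symmetric] True)
  next
    case False
    then have p: "nsq v > 0" using nsq_nonneg[of v] by linarith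
    have "0 \<le> nsq u - I\<^sup>2 / nsq v"
      using *[of "I / nsq v"] p by (simp add: power2_eq_square field_simps)
    then show ?thesis using p by (simp add: I_def[symmetric] field_simps)
  qed
qed

lemma abs_integral_mult_le:
  assumes "sqint u" "sqint v"
  shows "\<bar>LBINT x. u x * v x\<bar> \<le> sqrt (nsq u) * sqrt (nsq v)"
  by (metis Cauchy_Schwarz_sqint[OF assms] real_le_rsqrt real_sqrt_mult power2_abs)

text \<open>With d and e the errors of the two factors, the products differ by d e + d b' + a' e,
  and Cauchy-Schwarz makes each term tend to 0. Both the weighted inequality and the weak equation
  pass to L^2 limits this way.\<close>

lemma tendsto_integral_mult:
  assumes "\<And>n::nat. sqint (a n)" "\<And>n. sqint (b n)" "sqint a'" "sqint b'"
    and a: "(\<lambda>n. nsq (\<lambda>x. a n x - a' x)) \<longlonglongrightarrow> 0"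
    and b: "(\<lambda>n. nsq (\<lambda>x. b n x - b' x)) \<longlonglongrightarrow> 0"
  shows "(\<lambda>n. LBINT x. a n x * b n x) \<longlonglongrightarrow> (LBINT x. a' x * b' x)"
proof -
  have da: "sqint (\<lambda>x. a n x - a' x)" and db: "sqint (\<lambda>x. b n x - b' x)" for n
    using assms sqint_diff by auto
  let ?r = "\<lambda>n. sqrt (nsq (\<lambda>x. a n x - a' x)) * sqrt (nsq (\<lambda>x. b n x - b' x))
      + sqrt (nsq (\<lambda>x. a n x - a' x)) * sqrt (nsq b') + sqrt (nsq a') * sqrt (nsq (\<lambda>x. b n x - b' x))"
  have "?r \<longlonglongrightarrow> sqrt 0 * sqrt 0 + sqrt 0 * sqrt (nsq b') + sqrt (nsq a') * sqrt 0"
    by (intro tendsto_intros a b)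
  then have r: "?r \<longlonglongrightarrow> 0" by simp
  have "norm ((LBINT x. a n x * b n x) - (LBINT x. a' x * b' x)) \<le> ?r n" for n
  proof -
    let ?d = "\<lambda>x. a n x - a' x" and ?e = "\<lambda>x. b n x - b' x"
    have i: "integrable lborel (\<lambda>x. ?d x * ?e x)" "integrable lborel (\<lambda>x. ?d x * b' x)"
      "integrable lborel (\<lambda>x. a' x * ?e x)" "integrable lborel (\<lambda>x. a n x * b n x)" "integrable lborel (\<lambda>x. a' x * b' x)"
      by (intro sqint_mult_integrable da db assms)+
    have "(LBINT x. a n x * b n x) - (LBINT x. a' x * b' x) = (LBINT x. a n x * b n x - a' x * b' x)"
      using i by simp
    also have "\<dots> = (LBINT x. ?d x * ?e x + ?d x * b' x + a' x * ?e x)"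
      by (rule Bochner_Integration.integral_cong) (auto simp: algebra_simps)
    also have "\<dots> = (LBINT x. ?d x * ?e x) + (LBINT x. ?d x * b' x) + (LBINT x. a' x * ?e x)"
      using i by (simp only: Bochner_Integration.integral_add Bochner_Integration.integrable_add)
    finally show ?thesis
      using abs_integral_mult_le[OF da db, of n n] abs_integral_mult_le[OF da assms(4), of n]
        abs_integral_mult_le[OF assms(3) db, of n] by simp
  qed
  then have "(\<lambda>n. (LBINT x. a n x * b n x) - (LBINT x. a' x * b' x)) \<longlonglongrightarrow> 0"
    by (intro Lim_null_comparison[OF _ r]) auto
  then show ?thesis by (rule LIM_zero_cancel)
qed

section \<open>Continuous functions of compact support\<close>

definition cc :: "('a::euclidean_space \<Rightarrow> real) \<Rightarrow> bool" where
  "cc k \<longleftrightarrow> continuous_on UNIV k \<and> (\<exists>R. \<forall>x. norm x > R \<longrightarrow> k x = 0)"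

lemma cc_measurable: "cc k \<Longrightarrow> k \<in> borel_measurable borel"
  by (auto simp: cc_def intro: borel_measurable_continuous_onI)

lemma cc_support:
  assumes "cc k" obtains R where "R > 0" "\<And>x. norm x > R \<Longrightarrow> k x = 0"
proof -
  obtain R where "\<forall>x. norm x > R \<longrightarrow> k x = 0" using assms by (auto simp: cc_def)
  then show thesis by (intro that[of "max R 1"]) auto
qed

lemma cc_integrable: assumes "cc k" shows "integrable lborel k"
proof -
  obtain R where R: "R > 0" "\<And>x. norm x > R \<Longrightarrow> k x = 0" using cc_support[OF assms] by blast
  have "continuous_on (cball 0 R) k" using assms by (auto simp: cc_def intro: continuous_on_subset)
  from borel_integrable_compact[OF compact_cball this]
  have "integrable lborel (\<lambda>x. indicator (cball 0 R) x *\<^sub>R k x)" .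
  also have "(\<lambda>x. indicator (cball 0 R) x *\<^sub>R k x) = k"
    using R by (force simp: indicator_def)
  finally show ?thesis .
qed

lemma cc_bounded: assumes "cc k" obtains M where "M > 0" "\<And>x. \<bar>k x\<bar> \<le> M"
proof -
  obtain R where R: "R > 0" "\<And>x. norm x > R \<Longrightarrow> k x = 0" using cc_support[OF assms] by blast
  have "continuous_on (cball 0 R) k" using assms by (auto simp: cc_def intro: continuous_on_subset)
  then have "bounded (k ` cball 0 R)" by (intro compact_imp_bounded compact_continuous_image compact_cball)
  then obtain M where M: "M > 0" "\<And>x. x \<in> cball 0 R \<Longrightarrow> \<bar>k x\<bar> \<le> M" by (auto simp: bounded_pos)
  have "\<bar>k x\<bar> \<le> M" for x
    using M R(2)[of x] by (cases "norm x > R") auto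
  then show thesis using M that by blast
qed

lemma cc_mult: "cc k \<Longrightarrow> continuous_on UNIV f \<Longrightarrow> cc (\<lambda>x. k x * f x)"
  by (fastforce simp: cc_def intro: continuous_intros)

lemma cc_cmult: "cc k \<Longrightarrow> cc (\<lambda>x. c * k x)"
  by (fastforce simp: cc_def intro: continuous_intros)

lemma cc_add:
  assumes "cc k" "cc l" shows "cc (\<lambda>x. k x + l x)"
proof -
  obtain R S where "\<And>x. norm x > R \<Longrightarrow> k x = 0" "\<And>x. norm x > S \<Longrightarrow> l x = 0"
    using assms by (auto simp: cc_def)
  then have "\<forall>x. norm x > max R S \<longrightarrow> k x + l x = 0" by simp
  then show ?thesis using assms unfolding cc_def by (blast intro: continuous_on_add)
qed

lemma cc_power2: "cc k \<Longrightarrow> cc (\<lambda>x. (k x)\<^sup>2)"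
  using cc_mult[of k k] by (simp add: power2_eq_square cc_def)

lemma cc_abs: "cc k \<Longrightarrow> cc (\<lambda>x. \<bar>k x\<bar>)"
  by (fastforce simp: cc_def intro: continuous_intros)

lemma cc_sqint: "cc k \<Longrightarrow> sqint k"
  using cc_integrable[OF cc_power2] cc_measurable by (auto simp: sqint_def)

lemma cc_uniformly_continuous: assumes "cc k" shows "uniformly_continuous_on UNIV k"
proof -
  obtain R where R: "R > 0" "\<And>x. norm x > R \<Longrightarrow> k x = 0" using cc_support[OF assms] by blast
  have "uniformly_continuous_on (cball 0 (R + 1)) k"
    by (rule compact_uniformly_continuous) (use assms in \<open>auto simp: cc_def intro: continuous_on_subset\<close>)
  show ?thesis
    unfolding uniformly_continuous_on_def
  proof (intro allI impI)
    fix e :: real assume "e > 0"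
    obtain d where d: "d > 0" "\<And>x y. x \<in> cball 0 (R+1) \<Longrightarrow> y \<in> cball 0 (R+1) \<Longrightarrow> dist y x < d \<Longrightarrow> dist (k y) (k x) < e"
      using \<open>uniformly_continuous_on (cball 0 (R + 1)) k\<close> \<open>e > 0\<close>
      unfolding uniformly_continuous_on_def by metis
    \<comment> \<open>Capping the distance at 1 leaves two cases: both points in the larger ball, or
      both beyond the support.\<close>
    have "dist (k y) (k x) < e" if "dist y x < min d 1" for x y
    proof (cases "x \<in> cball 0 (R+1) \<and> y \<in> cball 0 (R+1)")
      case True then show ?thesis using d that by auto
    next
      case False
      have t: "norm x \<le> norm y + dist y x" "norm y \<le> norm x + dist y x"
        by (metis dist_norm norm_triangle_sub norm_minus_commute)+
      then have "norm x > R" "norm y > R" using False that by (auto simp: min_def split: if_splits)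
      then show ?thesis using R \<open>e > 0\<close> by simp
    qed
    then show "\<exists>d>0. \<forall>x\<in>UNIV. \<forall>x'\<in>UNIV. dist x' x < d \<longrightarrow> dist (k x') (k x) < e"
      using d by (intro exI[of _ "min d 1"]) auto
  qed
qed

section \<open>Reflections and translations of Lebesgue measure\<close>

lemma lborel_distr_reflect: "distr lborel borel (\<lambda>y. x - y) = (lborel :: 'a::euclidean_space measure)"
  using lborel_affine[of "-1::real" x] by (simp add: density_1)

lemma integral_reflect:
  fixes k :: "'a::euclidean_space \<Rightarrow> real"
  assumes [measurable]: "k \<in> borel_measurable borel"
  shows "(LBINT y. k (x - y)) = (LBINT y. k y)"
  by (subst (2) lborel_distr_reflect[of x, symmetric]) (simp add: integral_distr)

lemma nn_integral_reflect:
  fixes k :: "'a::euclidean_space \<Rightarrow> ennreal"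
  assumes [measurable]: "k \<in> borel_measurable borel"
  shows "(\<integral>\<^sup>+y. k (x - y) \<partial>lborel) = (\<integral>\<^sup>+y. k y \<partial>lborel)"
  by (subst (2) lborel_distr_reflect[of x, symmetric]) (simp add: nn_integral_distr)

lemma nn_integral_shift:
  fixes k :: "'a::euclidean_space \<Rightarrow> ennreal"
  assumes [measurable]: "k \<in> borel_measurable borel"
  shows "(\<integral>\<^sup>+x. k (x - y) \<partial>lborel) = (\<integral>\<^sup>+x. k x \<partial>lborel)"
proof -
  have "(\<integral>\<^sup>+x. k (x - y) \<partial>lborel) = (\<integral>\<^sup>+x. k (0 - (y - x)) \<partial>lborel)" by simp
  also have "\<dots> = (\<integral>\<^sup>+x. k (0 - x) \<partial>lborel)"
    by (rule nn_integral_reflect[of "\<lambda>x. k (0 - x)" y]) simp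
  also have "\<dots> = (\<integral>\<^sup>+x. k x \<partial>lborel)"
    by (rule nn_integral_reflect[of k 0]) simp
  finally show ?thesis .
qed

section \<open>Convolution\<close>

definition conv :: "('a::euclidean_space \<Rightarrow> real) \<Rightarrow> ('a \<Rightarrow> real) \<Rightarrow> 'a \<Rightarrow> real" where
  "conv v k x = (LBINT y. v y * k (x - y))"

text \<open>A common setting for three kinds of first factor of a convolution: the square-integrable
  u, the right-hand side f, which is square-integrable only on balls, and the constant 1 in
  \<open>integral_derivative_eq_0\<close>.\<close>

definition locint :: "('a::euclidean_space \<Rightarrow> real) \<Rightarrow> bool" where
  "locint v \<longleftrightarrow> v \<in> borel_measurable borel \<and> (\<forall>R. integrable lborel (\<lambda>x. indicator (cball 0 R) x * v x))"

lemma locint_measurable: "locint v \<Longrightarrow> v \<in> borel_measurable borel"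
  by (simp add: locint_def)

lemma sqint_indicator_cball: "sqint (indicator (cball (0::'a::euclidean_space) R) :: 'a \<Rightarrow> real)"
proof -
  have "emeasure lborel (cball (0::'a) R) < \<infinity>"
    using emeasure_lborel_cball_finite[of "0::'a" R] by simp
  then have "integrable lborel (indicator (cball (0::'a) R) :: 'a \<Rightarrow> real)"
    by (intro integrable_real_indicator) auto
  moreover have "(indicator (cball (0::'a) R) x)\<^sup>2 = (indicator (cball 0 R) x :: real)" for x
    by (auto simp: indicator_def)
  ultimately show ?thesis by (simp add: sqint_def)
qed

lemma locint_local_sqint:
  assumes "v \<in> borel_measurable borel" "\<And>R. sqint (\<lambda>x. indicator (cball 0 R) x * v x)"
  shows "locint v"
proof -
  have "integrable lborel (\<lambda>x. indicator (cball 0 R) x * v x)" for R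
  proof -
    have "integrable lborel (\<lambda>x. indicator (cball 0 R) x * (indicator (cball 0 R) x * v x))"
      by (rule sqint_mult_integrable[OF sqint_indicator_cball assms(2)])
    moreover have "indicator (cball 0 R) x * (indicator (cball 0 R) x * v x) = indicator (cball 0 R) x * v x" for x
      by (simp add: indicator_def)
    ultimately show ?thesis by simp
  qed
  then show ?thesis using assms(1) by (simp add: locint_def)
qed

lemma sqint_localize: "sqint v \<Longrightarrow> sqint (\<lambda>x. indicator (cball 0 R) x * v x)"
  by (rule sqint_mult_bounded(1)[where M=1]) (auto simp: indicator_def)

lemma sqint_locint: "sqint v \<Longrightarrow> locint v"
  by (intro locint_local_sqint sqint_localize sqint_measurable)

lemma locint_one: "locint (\<lambda>_. 1)"
  by (rule locint_local_sqint) (use sqint_indicator_cball in auto)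

text \<open>Here \<open>h\<close> will be a translate of a kernel, a difference of translates or the
  error of a difference quotient. Integrability, continuity and differentiability of convolutions
  all come from a uniform bound on \<open>h\<close> over one ball.\<close>

lemma locint_mult_bound:
  assumes v: "locint v" and h: "h \<in> borel_measurable borel"
    and b: "\<And>y. \<bar>h y\<bar> \<le> e * indicator (cball 0 R) y"
  shows "integrable lborel (\<lambda>y. v y * h y)"
    "\<bar>LBINT y. v y * h y\<bar> \<le> e * (LBINT y. indicator (cball 0 R) y * \<bar>v y\<bar>)"
proof -
  have i: "integrable lborel (\<lambda>y. indicator (cball 0 R) y * \<bar>v y\<bar>)"
  proof -
    have "integrable lborel (\<lambda>y. \<bar>indicator (cball 0 R) y * v y\<bar>)"
      using v by (intro integrable_abs) (simp add: locint_def)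
    then show ?thesis by (simp add: abs_mult)
  qed
  have le: "\<bar>v y * h y\<bar> \<le> e * (indicator (cball 0 R) y * \<bar>v y\<bar>)" for y
    using mult_right_mono[OF b[of y], of "\<bar>v y\<bar>"] by (simp add: abs_mult mult_ac)
  show int: "integrable lborel (\<lambda>y. v y * h y)"
    by (rule Bochner_Integration.integrable_bound[where f="\<lambda>y. e * (indicator (cball 0 R) y * \<bar>v y\<bar>)"])
      (use i h locint_measurable[OF v] le in \<open>auto intro: order_trans[OF _ abs_ge_self]\<close>)
  have "\<bar>LBINT y. v y * h y\<bar> \<le> (LBINT y. \<bar>v y * h y\<bar>)"
    using integral_norm_bound[of lborel "\<lambda>y. v y * h y"] by simp
  also have "\<dots> \<le> (LBINT y. e * (indicator (cball 0 R) y * \<bar>v y\<bar>))"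
    by (rule integral_mono) (use int i le in \<open>auto intro: integrable_abs\<close>)
  finally show "\<bar>LBINT y. v y * h y\<bar> \<le> e * (LBINT y. indicator (cball 0 R) y * \<bar>v y\<bar>)"
    by simp
qed

lemma cc_comp_measurable: "cc k \<Longrightarrow> (\<lambda>y. k (x - y)) \<in> borel_measurable borel"
  using cc_measurable by measurable

lemma conv_integrable:
  assumes "locint v" "cc k"
  shows "integrable lborel (\<lambda>y. v y * k (x - y))"
proof -
  obtain R where R: "R > 0" "\<And>x. norm x > R \<Longrightarrow> k x = 0" using cc_support[OF assms(2)] by blast
  obtain M where M: "M > 0" "\<And>x. \<bar>k x\<bar> \<le> M" using cc_bounded[OF assms(2)] by blast
  have "\<bar>k (x - y)\<bar> \<le> M * indicator (cball 0 (norm x + R)) y" for y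
    using M R(2)[of "x - y"] norm_triangle_sub[of y x] by (auto simp: indicator_def norm_minus_commute)
  then show ?thesis using locint_mult_bound(1)[OF assms(1) cc_comp_measurable[OF assms(2)]] by blast
qed

text \<open>\<open>d\<close> comes from the uniform continuity of \<open>k\<close> alone, and
  \<open>v\<close> is quantified after it. This uniformity in \<open>v\<close> is the equicontinuity
  needed for Arzela-Ascoli in \<open>conv_compact\<close>.\<close>

lemma conv_equicontinuous:
  assumes k: "cc k" and R': "\<And>x. norm x > R' \<Longrightarrow> k x = 0" and e: "e > 0"
  obtains d where "d > 0" "\<And>x x' v. locint v \<Longrightarrow> norm x \<le> R \<Longrightarrow> norm x' \<le> R \<Longrightarrow> norm (x - x') < d \<Longrightarrow>
    \<bar>conv v k x - conv v k x'\<bar> \<le> e * (LBINT y. indicator (cball 0 (R + R')) y * \<bar>v y\<bar>)"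
proof -
  obtain d where d: "d > 0" "\<And>x x'. dist x' x < d \<Longrightarrow> dist (k x') (k x) < e"
    using cc_uniformly_continuous[OF k] e unfolding uniformly_continuous_on_def by (metis UNIV_I)
  have "\<bar>conv v k x - conv v k x'\<bar> \<le> e * (LBINT y. indicator (cball 0 (R + R')) y * \<bar>v y\<bar>)"
    if v: "locint v" and x: "norm x \<le> R" "norm x' \<le> R" "norm (x - x') < d" for v x x'
  proof -
    have b: "\<bar>k (x - y) - k (x' - y)\<bar> \<le> e * indicator (cball 0 (R + R')) y" for y
    proof (cases "y \<in> cball 0 (R + R')")
      case True
      have "dist (x - y) (x' - y) < d" using x by (simp add: dist_norm)
      then have "dist (k (x - y)) (k (x' - y)) < e" by (rule d(2))
      then show ?thesis using True by (simp add: dist_norm)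
    next
      case False
      then have "norm (x - y) > R'" "norm (x' - y) > R'"
        using x norm_triangle_sub[of y x] norm_triangle_sub[of y x'] by (auto simp: norm_minus_commute)
      then show ?thesis using False R' by simp
    qed
    have "conv v k x - conv v k x' = (LBINT y. v y * (k (x - y) - k (x' - y)))"
      using conv_integrable[OF v k] by (simp add: conv_def right_diff_distrib)
    then show ?thesis
      using locint_mult_bound(2)[OF v _ b] cc_comp_measurable[OF k] by simp
  qed
  then show thesis using that d(1) by blast
qed

lemma conv_continuous:
  assumes v: "locint v" and k: "cc k"
  shows "continuous_on UNIV (conv v k)"
proof -
  have "\<exists>d>0. \<forall>x'. dist x' x < d \<longrightarrow> dist (conv v k x') (conv v k x) < e" if "e > 0" for x e
  proof -
    obtain R' where R': "\<And>x. norm x > R' \<Longrightarrow> k x = 0" using k by (auto simp: cc_def)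
    define S where "S = (norm x + 1) + R'"
    define I where "I = (LBINT y. indicator (cball 0 S) y * \<bar>v y\<bar>)"
    have I: "I \<ge> 0" by (simp add: I_def)
    \<comment> \<open>The denominator \<open>I + 1\<close> covers the case
      \<open>I = 0\<close>.\<close>
    have pos: "e / (I + 1) > 0" using I that by simp
    show ?thesis
    proof (rule conv_equicontinuous[where R="norm x + 1", OF k R' pos])
      fix d assume d: "d > 0" "\<And>y y' v. locint v \<Longrightarrow> norm y \<le> norm x + 1 \<Longrightarrow> norm y' \<le> norm x + 1 \<Longrightarrow> norm (y - y') < d \<Longrightarrow>
        \<bar>conv v k y - conv v k y'\<bar> \<le> e / (I + 1) * (LBINT y. indicator (cball 0 (norm x + 1 + R')) y * \<bar>v y\<bar>)"
    have "e / (I + 1) * I < e" using that I by (simp add: field_simps)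
    have "dist (conv v k x') (conv v k x) < e" if "dist x' x < min d 1" for x'
    proof -
      have "norm x' \<le> norm x + 1" using that norm_triangle_sub[of x' x] by (simp add: dist_norm)
      then have "\<bar>conv v k x' - conv v k x\<bar> \<le> e / (I + 1) * I" using d(2)[OF v, of x' x] that by (simp add: dist_norm I_def S_def)
      then show ?thesis using \<open>e / (I + 1) * I < e\<close> by (simp add: dist_norm)
    qed
      then show ?thesis using d(1) by (intro exI[of _ "min d 1"]) auto
    qed auto
  qed
  then show ?thesis unfolding continuous_on_iff by simp
qed

text \<open>The mean value theorem turns a difference quotient of the kernel into a value of
  \<open>k'\<close> at a nearby point; uniform continuity of \<open>k'\<close> makes the error small
  on one fixed ball, and \<open>locint_mult_bound\<close> does the rest.\<close>

lemma conv_derivative: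
  assumes v: "locint v" and k: "cc k" "cc k'" and e: "norm e = 1"
    and D: "\<And>x. ((\<lambda>t. k (x + t *\<^sub>R e)) has_real_derivative k' x) (at 0)"
  shows "((\<lambda>t. conv v k (x + t *\<^sub>R e)) has_real_derivative conv v k' x) (at 0)"
proof -
  have D': "((\<lambda>t. k (x + t *\<^sub>R e)) has_real_derivative k' (x + s *\<^sub>R e)) (at s)" for x s
  proof -
    have "((\<lambda>t. k ((x + s *\<^sub>R e) + t *\<^sub>R e)) has_real_derivative k' (x + s *\<^sub>R e)) (at 0)" by (rule D)
    then have "((\<lambda>t. k (x + (t + s) *\<^sub>R e)) has_real_derivative k' (x + s *\<^sub>R e)) (at 0)"
      by (simp add: algebra_simps)
    then show ?thesis using DERIV_shift[of "\<lambda>t. k (x + t *\<^sub>R e)" "k' (x + s *\<^sub>R e)" 0 s] by simp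
  qed
  obtain R1 where R1: "R1 > 0" "\<And>x. norm x > R1 \<Longrightarrow> k x = 0" using cc_support[OF k(1)] by blast
  obtain R2 where R2: "R2 > 0" "\<And>x. norm x > R2 \<Longrightarrow> k' x = 0" using cc_support[OF k(2)] by blast
  \<comment> \<open>The summand 1 allows for the shifts \<open>x + t *\<^sub>R e\<close> with |t| <
    1.\<close>
  define R where "R = norm x + max R1 R2 + 1"
  define I where "I = (LBINT y. indicator (cball 0 R) y * \<bar>v y\<bar>)"
  have I: "I \<ge> 0" by (simp add: I_def)
  have "\<exists>d>0. \<forall>t. t \<noteq> 0 \<and> \<bar>t\<bar> < d \<longrightarrow> \<bar>(conv v k (x + t *\<^sub>R e) - conv v k x) / t - conv v k' x\<bar> < r"
    if "r > 0" for r
  proof -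
    define r' where "r' = r / (I + 1)"
    have r': "r' > 0" "r' * I < r" using I that by (auto simp: r'_def field_simps)
    obtain d where d: "d > 0" "\<And>x x'. dist x' x < d \<Longrightarrow> dist (k' x') (k' x) < r'"
      using cc_uniformly_continuous[OF k(2)] r'(1) unfolding uniformly_continuous_on_def by (metis UNIV_I)
    have "\<bar>(conv v k (x + t *\<^sub>R e) - conv v k x) / t - conv v k' x\<bar> < r" if t: "t \<noteq> 0" "\<bar>t\<bar> < min d 1" for t
    proof -
      let ?h = "\<lambda>y. (k (x + t *\<^sub>R e - y) - k (x - y)) / t - k' (x - y)"
      have b: "\<bar>?h y\<bar> \<le> r' * indicator (cball 0 R) y" for y
      proof (cases "y \<in> cball 0 R")
        case True
        obtain s where s: "\<bar>s\<bar> \<le> \<bar>t\<bar>" "k (x - y + t *\<^sub>R e) - k (x - y) = t * k' (x - y + s *\<^sub>R e)"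
        proof (cases "t > 0")
          case True
          from MVT2[OF this, of "\<lambda>t. k (x - y + t *\<^sub>R e)" "\<lambda>s. k' (x - y + s *\<^sub>R e)"] D'
          obtain z where "0 < z" "z < t" "k (x - y + t *\<^sub>R e) - k (x - y + 0 *\<^sub>R e) = (t - 0) * k' (x - y + z *\<^sub>R e)"
            by blast
          then show thesis by (intro that[of z]) auto
        next
          case False
          then have "t < 0" using t by simp
          from MVT2[OF this, of "\<lambda>t. k (x - y + t *\<^sub>R e)" "\<lambda>s. k' (x - y + s *\<^sub>R e)"] D'
          obtain z where "t < z" "z < 0" "k (x - y + 0 *\<^sub>R e) - k (x - y + t *\<^sub>R e) = (0 - t) * k' (x - y + z *\<^sub>R e)"
            by blast
          then show thesis by (intro that[of z]) auto
        qed
        have "?h y = k' (x - y + s *\<^sub>R e) - k' (x - y)"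
          using s t by (simp add: algebra_simps)
        moreover have "dist (k' (x - y + s *\<^sub>R e)) (k' (x - y)) < r'"
          by (rule d(2)) (use s t e in \<open>simp add: dist_norm\<close>)
        ultimately show ?thesis using True by (simp add: dist_norm)
      next
        case False
        have "norm y \<le> norm x + norm (x - y)" using norm_triangle_sub[of y x] by (simp add: norm_minus_commute)
        moreover have "norm (x - y) \<le> norm (x + t *\<^sub>R e - y) + \<bar>t\<bar>"
          using norm_triangle_ineq4[of "x + t *\<^sub>R e - y" "t *\<^sub>R e"] e by (simp add: algebra_simps)
        ultimately have "norm (x - y) > R1" "norm (x - y) > R2" "norm (x + t *\<^sub>R e - y) > R1"
          using False t by (auto simp: R_def)
        then show ?thesis using False R1 R2 by simp
      qed
      have i: "integrable lborel (\<lambda>y. v y * k (x + t *\<^sub>R e - y))" "integrable lborel (\<lambda>y. v y * k (x - y))"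
        "integrable lborel (\<lambda>y. v y * k' (x - y))"
        using conv_integrable v k by auto
      have "(conv v k (x + t *\<^sub>R e) - conv v k x) / t - conv v k' x = (LBINT y. (v y * k (x + t *\<^sub>R e - y) - v y * k (x - y)) / t - v y * k' (x - y))"
        using i by (simp add: conv_def)
      also have "\<dots> = (LBINT y. v y * ?h y)"
        by (rule Bochner_Integration.integral_cong) (auto simp: algebra_simps diff_divide_distrib)
      moreover have m: "?h \<in> borel_measurable borel"
        using cc_comp_measurable[OF k(1)] cc_comp_measurable[OF k(2)] by (intro borel_measurable_diff borel_measurable_divide) auto
      ultimately have "\<bar>(conv v k (x + t *\<^sub>R e) - conv v k x) / t - conv v k' x\<bar> \<le> r' * I"
        using locint_mult_bound(2)[OF v _ b] m unfolding I_def by simp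
      then show ?thesis using r' by linarith
    qed
    then show ?thesis using d(1) by (intro exI[of _ "min d 1"]) auto
  qed
  then show ?thesis
    unfolding DERIV_def LIM_def by (simp add: dist_norm)
qed

text \<open>By reflection invariance, convolving \<open>H\<close> with 1 gives a constant function,
  the integral of \<open>H\<close>. Its derivative is 0, and it is also the integral of
  \<open>H'\<close>. All later integrations by parts go through this lemma.\<close>

lemma integral_derivative_eq_0:
  fixes H :: "'a::euclidean_space \<Rightarrow> real"
  assumes k: "cc H" "cc H'" and e: "norm e = 1"
    and D: "\<And>x. ((\<lambda>t. H (x + t *\<^sub>R e)) has_real_derivative H' x) (at 0)"
  shows "(LBINT x. H' x) = 0"
proof -
  have c: "conv (\<lambda>_. 1) h x = (LBINT x. h x)" if "cc h" for h :: "'a \<Rightarrow> real" and x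
    using integral_reflect[OF cc_measurable[OF that]] by (simp add: conv_def)
  have "((\<lambda>t. conv (\<lambda>_. 1) H (0 + t *\<^sub>R e)) has_real_derivative conv (\<lambda>_. 1) H' 0) (at 0)"
    by (rule conv_derivative[OF locint_one k e D])
  then have "((\<lambda>t::real. (LBINT x. H x)) has_real_derivative (LBINT x. H' x)) (at 0)"
    by (simp only: c k)
  moreover have "((\<lambda>t::real. (LBINT x. H x)) has_real_derivative 0) (at 0)" by simp
  ultimately show ?thesis by (rule DERIV_unique)
qed

text \<open>Cauchy-Schwarz for |v k| = sqrt |k| times (sqrt |k| |v|), then Tonelli. Nonnegative
  integrals are used because square-integrability of the convolution is itself part of the
  claim.\<close>

lemma Young_sqint:
  assumes v: "sqint v" and k: "cc k"
  shows "sqint (conv v k)" "nsq (conv v k) \<le> (LBINT x. \<bar>k x\<bar>)\<^sup>2 * nsq v"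
proof -
  have [measurable]: "v \<in> borel_measurable borel" "k \<in> borel_measurable borel"
    using v k sqint_measurable cc_measurable by auto
  define L where "L = (LBINT x. \<bar>k x\<bar>)"
  have L: "L \<ge> 0" by (simp add: L_def)
  have ik: "integrable lborel (\<lambda>x. \<bar>k x\<bar>)" using cc_integrable[OF cc_abs[OF k]] .
  have Ln: "(\<integral>\<^sup>+x. ennreal \<bar>k x\<bar> \<partial>lborel) = ennreal L"
    unfolding L_def by (rule nn_integral_eq_integral[OF ik]) simp
  have Vn: "(\<integral>\<^sup>+x. ennreal ((v x)\<^sup>2) \<partial>lborel) = ennreal (nsq v)"
    unfolding nsq_def by (rule nn_integral_eq_integral) (use v in \<open>auto simp: sqint_def\<close>)
  have sq: "ennreal (sqrt a) ^ 2 = ennreal a" if "a \<ge> 0" for a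
    using that by (simp add: ennreal_power)
  have pw: "ennreal ((conv v k x)\<^sup>2) \<le> ennreal L * (\<integral>\<^sup>+y. ennreal (\<bar>k (x - y)\<bar> * (v y)\<^sup>2) \<partial>lborel)" for x
  proof -
    have i: "integrable lborel (\<lambda>y. v y * k (x - y))" by (rule conv_integrable[OF sqint_locint[OF v] k])
    have "ennreal ((conv v k x)\<^sup>2) = (ennreal \<bar>conv v k x\<bar>)\<^sup>2" by (simp add: ennreal_power)
    also have "ennreal \<bar>conv v k x\<bar> \<le> (\<integral>\<^sup>+y. ennreal (norm (v y * k (x - y))) \<partial>lborel)"
      using integral_norm_bound_ennreal[OF i] by (simp add: conv_def)
    also have "\<dots> = (\<integral>\<^sup>+y. ennreal (sqrt \<bar>k (x - y)\<bar>) * ennreal (sqrt \<bar>k (x - y)\<bar> * \<bar>v y\<bar>) \<partial>lborel)"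
      by (rule nn_integral_cong) (simp add: ennreal_mult[symmetric] abs_mult flip: mult.assoc)
    finally have "ennreal ((conv v k x)\<^sup>2) \<le> (\<integral>\<^sup>+y. ennreal (sqrt \<bar>k (x - y)\<bar>) * ennreal (sqrt \<bar>k (x - y)\<bar> * \<bar>v y\<bar>) \<partial>lborel)\<^sup>2"
      by (simp add: power_mono)
    also have "\<dots> \<le> (\<integral>\<^sup>+y. ennreal (sqrt \<bar>k (x - y)\<bar>) ^ 2 \<partial>lborel) * (\<integral>\<^sup>+y. ennreal (sqrt \<bar>k (x - y)\<bar> * \<bar>v y\<bar>) ^ 2 \<partial>lborel)"
      by (rule Cauchy_Schwarz_nn_integral) measurable
    also have "(\<integral>\<^sup>+y. ennreal (sqrt \<bar>k (x - y)\<bar>) ^ 2 \<partial>lborel) = (\<integral>\<^sup>+y. ennreal \<bar>k (x - y)\<bar> \<partial>lborel)"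
      by (simp add: sq)
    also have "\<dots> = ennreal L"
      using nn_integral_reflect[of "\<lambda>y. ennreal \<bar>k y\<bar>" x] Ln by simp
    also have "(\<integral>\<^sup>+y. ennreal (sqrt \<bar>k (x - y)\<bar> * \<bar>v y\<bar>) ^ 2 \<partial>lborel) = (\<integral>\<^sup>+y. ennreal (\<bar>k (x - y)\<bar> * (v y)\<^sup>2) \<partial>lborel)"
      by (simp add: ennreal_power power_mult_distrib)
    finally show ?thesis .
  qed
  have [measurable]: "conv v k \<in> borel_measurable borel"
    by (rule borel_measurable_continuous_onI[OF conv_continuous[OF sqint_locint[OF v] k]])
  have "(\<integral>\<^sup>+x. ennreal ((conv v k x)\<^sup>2) \<partial>lborel) \<le> (\<integral>\<^sup>+x. ennreal L * (\<integral>\<^sup>+y. ennreal (\<bar>k (x - y)\<bar> * (v y)\<^sup>2) \<partial>lborel) \<partial>lborel)"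
    by (rule nn_integral_mono) (use pw in auto)
  also have "\<dots> = ennreal L * (\<integral>\<^sup>+x. (\<integral>\<^sup>+y. ennreal (\<bar>k (x - y)\<bar> * (v y)\<^sup>2) \<partial>lborel) \<partial>lborel)"
    by (rule nn_integral_cmult) measurable
  also have "(\<integral>\<^sup>+x. (\<integral>\<^sup>+y. ennreal (\<bar>k (x - y)\<bar> * (v y)\<^sup>2) \<partial>lborel) \<partial>lborel) = (\<integral>\<^sup>+y. (\<integral>\<^sup>+x. ennreal (\<bar>k (x - y)\<bar> * (v y)\<^sup>2) \<partial>lborel) \<partial>lborel)"
    by (rule lborel_pair.Fubini') measurable
  also have "\<dots> = (\<integral>\<^sup>+y. ennreal L * ennreal ((v y)\<^sup>2) \<partial>lborel)"
  proof (rule nn_integral_cong)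
    fix y :: 'a
    have "(\<integral>\<^sup>+x. ennreal (\<bar>k (x - y)\<bar> * (v y)\<^sup>2) \<partial>lborel) = (\<integral>\<^sup>+x. ennreal \<bar>k (x - y)\<bar> * ennreal ((v y)\<^sup>2) \<partial>lborel)"
      by (simp add: ennreal_mult)
    also have "\<dots> = (\<integral>\<^sup>+x. ennreal \<bar>k (x - y)\<bar> \<partial>lborel) * ennreal ((v y)\<^sup>2)"
      by (rule nn_integral_multc) measurable
    also have "(\<integral>\<^sup>+x. ennreal \<bar>k (x - y)\<bar> \<partial>lborel) = ennreal L"
      using nn_integral_shift[of "\<lambda>y. ennreal \<bar>k y\<bar>" y] Ln by simp
    finally show "(\<integral>\<^sup>+x. ennreal (\<bar>k (x - y)\<bar> * (v y)\<^sup>2) \<partial>lborel) = ennreal L * ennreal ((v y)\<^sup>2)" .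
  qed
  also have "\<dots> = ennreal L * ennreal (nsq v)"
    by (simp add: nn_integral_cmult Vn)
  finally have fin: "(\<integral>\<^sup>+x. ennreal ((conv v k x)\<^sup>2) \<partial>lborel) \<le> ennreal (L\<^sup>2 * nsq v)"
    using L nsq_nonneg[of v] by (simp add: ennreal_mult[symmetric] power2_eq_square mult.assoc)
  then have int: "integrable lborel (\<lambda>x. (conv v k x)\<^sup>2)"
    by (intro integrableI_bounded) (auto simp: order_le_less_trans[OF _ ennreal_less_top])
  then show "sqint (conv v k)" by (simp add: sqint_def)
  have "ennreal (nsq (conv v k)) = (\<integral>\<^sup>+x. ennreal ((conv v k x)\<^sup>2) \<partial>lborel)"
    unfolding nsq_def by (rule nn_integral_eq_integral[symmetric, OF int]) simp
  with fin show "nsq (conv v k) \<le> (LBINT x. \<bar>k x\<bar>)\<^sup>2 * nsq v"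
    using nsq_nonneg[of v] ennreal_le_iff[of "L\<^sup>2 * nsq v" "nsq (conv v k)"] by (simp add: L_def)
qed

section \<open>Approximate identities\<close>

lemma nsq_tendsto_0I:
  assumes "\<And>e. e > 0 \<Longrightarrow> eventually (\<lambda>n. nsq (w n) < e) sequentially"
  shows "(\<lambda>n. nsq (w n)) \<longlonglongrightarrow> 0"
proof (rule order_tendstoI)
  fix a :: real assume "a < 0"
  then have "a < nsq (w n)" for n using nsq_nonneg[of "w n"] by linarith
  then show "eventually (\<lambda>n. a < nsq (w n)) sequentially" by simp
qed (rule assms)

lemma nsq_tendsto_0:
  fixes w :: "nat \<Rightarrow> 'a::euclidean_space \<Rightarrow> real"
  assumes m: "\<And>n. w n \<in> borel_measurable borel" and v: "sqint v"
    and b: "\<And>n x. (w n x)\<^sup>2 \<le> C * (v x)\<^sup>2" and l: "AE x in lborel. (\<lambda>n. w n x) \<longlonglongrightarrow> 0"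
  shows "(\<lambda>n. nsq (w n)) \<longlonglongrightarrow> 0"
proof -
  have "(\<lambda>n. LBINT x. (w n x)\<^sup>2) \<longlonglongrightarrow> (\<integral>x. 0 \<partial>(lborel::'a measure))"
  proof (rule integral_dominated_convergence[where w="\<lambda>x. C * (v x)\<^sup>2"])
    show "AE x in lborel. (\<lambda>n. (w n x)\<^sup>2) \<longlonglongrightarrow> 0"
      using l by eventually_elim (auto intro: tendsto_power[where a=0 and n=2, simplified])
  qed (use m v b in \<open>auto simp: sqint_def\<close>)
  then show ?thesis by (simp add: nsq_def)
qed

text \<open>\<open>measurable_on\<close> supplies continuous functions converging to
  \<open>v\<close> almost everywhere, but with no control of size. Clamping their values to [-N, N]
  and multiplying by a cutoff that is 1 on the ball of radius \<open>N\<close> leaves the limit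
  intact and provides a dominating function.\<close>

lemma cc_dense_bounded:
  fixes v :: "'a::euclidean_space \<Rightarrow> real"
  assumes m: "v \<in> borel_measurable borel" and b: "\<And>x. \<bar>v x\<bar> \<le> N" and s: "\<And>x. norm x > N \<Longrightarrow> v x = 0" and e: "e > 0"
  shows "\<exists>g. cc g \<and> nsq (\<lambda>x. v x - g x) < e"
proof -
  have "N \<ge> 0" using b[of 0] by linarith
  have "v measurable_on UNIV"
    by (rule lebesgue_measurable_imp_measurable_on_real) (use m in \<open>auto intro: measurable_completion\<close>)
  then obtain Z g where Z: "negligible Z" and g: "\<And>n. continuous_on UNIV (g n)"
    "\<And>x. x \<notin> Z \<Longrightarrow> (\<lambda>n. g n x) \<longlonglongrightarrow> v x"
    unfolding measurable_on_def by auto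
  define t where "t x = max 0 (min 1 (N + 1 - norm x))" for x :: 'a
  define h where "h n x = max (-N) (min N (g n x)) * t x" for n x
  have t: "0 \<le> t x" "t x \<le> 1" "norm x \<le> N \<Longrightarrow> t x = 1" "norm x > N + 1 \<Longrightarrow> t x = 0" for x
    by (auto simp: t_def)
  have hc: "cc (h n)" for n
    unfolding cc_def
  proof (intro conjI exI allI impI)
    show "continuous_on UNIV (h n)"
      unfolding h_def t_def by (intro continuous_intros g)
    show "norm x > N + 1 \<Longrightarrow> h n x = 0" for x by (simp add: h_def t)
  qed
  have hb: "\<bar>h n x\<bar> \<le> N * indicator (cball 0 (N + 1)) x" for n x
  proof (cases "norm x > N + 1")
    case False
    have "\<bar>max (-N) (min N (g n x))\<bar> \<le> N" using \<open>N \<ge> 0\<close> by auto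
    then have "\<bar>max (-N) (min N (g n x))\<bar> * \<bar>t x\<bar> \<le> N * 1" using t \<open>N \<ge> 0\<close> by (intro mult_mono) auto
    then show ?thesis using False by (simp add: h_def abs_mult)
  qed (simp add: h_def t)
  have vb: "\<bar>v x\<bar> \<le> N * indicator (cball 0 (N + 1)) x" for x
    using b s[of x] by (auto simp: indicator_def)
  have AEZ: "AE x in lborel. x \<notin> Z"
  proof -
    have "AE x in lebesgue. x \<notin> Z" using Z by (intro AE_not_in) (simp add: negligible_iff_null_sets)
    then show ?thesis by (simp add: AE_completion_iff)
  qed
  have "(\<lambda>n. nsq (\<lambda>x. v x - h n x)) \<longlonglongrightarrow> 0"
  proof (rule nsq_tendsto_0[where C="4 * N\<^sup>2", OF _ sqint_indicator_cball[of "N + 1"]])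
    show "(\<lambda>x. v x - h n x) \<in> borel_measurable borel" for n
      using m cc_measurable[OF hc] by measurable
    show "(v x - h n x)\<^sup>2 \<le> 4 * N\<^sup>2 * (indicator (cball 0 (N + 1)) x)\<^sup>2" for n x
    proof -
      have "\<bar>v x - h n x\<bar> \<le> 2 * (N * indicator (cball 0 (N + 1)) x)" using hb[of n x] vb[of x] by linarith
      from power_mono[OF this, of 2] show ?thesis by (simp add: power_mult_distrib)
    qed
    show "AE x in lborel. (\<lambda>n. v x - h n x) \<longlonglongrightarrow> 0"
      using AEZ
    proof eventually_elim
      case (elim x)
      have "(\<lambda>n. v x - h n x) \<longlonglongrightarrow> v x - max (-N) (min N (v x)) * t x"
        unfolding h_def by (intro tendsto_intros tendsto_max tendsto_min g(2)[OF elim])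
      also have "v x - max (-N) (min N (v x)) * t x = 0"
        using b[of x] s[of x] t(3)[of x] by (cases "norm x > N") (use \<open>N \<ge> 0\<close> in \<open>auto simp: abs_le_iff min_def max_def\<close>)
      finally show ?case .
    qed
  qed
  then have "eventually (\<lambda>n. nsq (\<lambda>x. v x - h n x) < e) sequentially"
    by (rule order_tendstoD(2)) (rule e)
  then show ?thesis using hc by (auto simp: eventually_sequentially)
qed

lemma cc_dense:
  fixes v :: "'a::euclidean_space \<Rightarrow> real"
  assumes v: "sqint v" and e: "e > 0"
  shows "\<exists>g. cc g \<and> nsq (\<lambda>x. v x - g x) < e"
proof -
  have [measurable]: "v \<in> borel_measurable borel" by (rule sqint_measurable[OF v])
  \<comment> \<open>Values and domain are truncated at the same level, so that the bounded case
    applies to \<open>w n\<close>.\<close>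
  define w where "w n x = indicator (cball 0 (real n)) x * max (- real n) (min (real n) (v x))" for n and x :: 'a
  have [measurable]: "w n \<in> borel_measurable borel" for n
    unfolding w_def by (intro borel_measurable_times borel_measurable_max borel_measurable_min borel_measurable_indicator) auto
  have wb: "\<bar>w n x\<bar> \<le> real n" "\<bar>w n x\<bar> \<le> \<bar>v x\<bar>" "norm x > real n \<Longrightarrow> w n x = 0" for n x
    by (auto simp: w_def indicator_def)
  have "(\<lambda>n. nsq (\<lambda>x. v x - w n x)) \<longlonglongrightarrow> 0"
  proof (rule nsq_tendsto_0[OF _ v, where C=4])
    show "(v x - w n x)\<^sup>2 \<le> 4 * (v x)\<^sup>2" for n x
    proof -
      have "\<bar>v x - w n x\<bar> \<le> 2 * \<bar>v x\<bar>" using wb(2)[of n x] by linarith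
      from power_mono[OF this, of 2] show ?thesis by (simp add: power_mult_distrib)
    qed
    show "AE x in lborel. (\<lambda>n. v x - w n x) \<longlonglongrightarrow> 0"
    proof (rule AE_I2)
      fix x
      have "eventually (\<lambda>n. v x - w n x = 0) sequentially"
        using eventually_ge_at_top[of "nat \<lceil>max (norm x) \<bar>v x\<bar>\<rceil>"]
      proof eventually_elim
        case (elim n)
        then have "norm x \<le> real n" "\<bar>v x\<bar> \<le> real n" by linarith+
        then show ?case by (auto simp: w_def)
      qed
      then show "(\<lambda>n. v x - w n x) \<longlonglongrightarrow> 0" by (rule tendsto_eventually)
    qed
  qed measurable
  then have "eventually (\<lambda>n. nsq (\<lambda>x. v x - w n x) < e / 4) sequentially"
    by (rule order_tendstoD(2)) (use e in simp)
  then obtain n where n: "nsq (\<lambda>x. v x - w n x) < e / 4" by (auto simp: eventually_sequentially)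
  obtain g where g: "cc g" "nsq (\<lambda>x. w n x - g x) < e / 4"
    using cc_dense_bounded[of "w n" "real n" "e / 4"] wb e by auto
  have "sqint (w n)"
    by (rule sqint_bound(1)[OF v, where C=1]) (use wb(2) in \<open>auto simp: abs_le_square_iff[symmetric]\<close>)
  then have "nsq (\<lambda>x. v x - g x) \<le> 2 * nsq (\<lambda>x. v x - w n x) + 2 * nsq (\<lambda>x. w n x - g x)"
    by (rule nsq_triangle[OF v _ cc_sqint[OF g(1)]])
  then show ?thesis using n g by (intro exI[of _ g]) auto
qed

lemma conv_measurable: "locint v \<Longrightarrow> cc k \<Longrightarrow> conv v k \<in> borel_measurable borel"
  by (rule borel_measurable_continuous_onI[OF conv_continuous])

lemma conv_diff:
  assumes "locint u" "locint v" "cc k"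
  shows "conv (\<lambda>x. u x - v x) k x = conv u k x - conv v k x"
  using conv_integrable[OF assms(1,3)] conv_integrable[OF assms(2,3)]
  by (simp add: conv_def left_diff_distrib)

text \<open>For continuous functions of compact support, uniform continuity gives a small error
  inside a fixed ball. Density carries this to \<open>v\<close>, since by Young's inequality
  convolution with a kernel of mass 1 is an L^2 contraction, uniformly in \<open>n\<close>.\<close>

lemma conv_approx_identity:
  fixes v :: "'a::euclidean_space \<Rightarrow> real"
  assumes v: "sqint v" and k: "\<And>n. cc (k n)" "\<And>n x. 0 \<le> k n x" "\<And>n. (LBINT x. k n x) = 1"
    and s: "\<And>n x. norm x > r n \<Longrightarrow> k n x = 0" and r: "r \<longlonglongrightarrow> 0"
  shows "(\<lambda>n. nsq (\<lambda>x. conv v (k n) x - v x)) \<longlonglongrightarrow> 0"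
proof -
  have absk: "(LBINT x. \<bar>k n x\<bar>) = 1" for n using k by simp
  have ccase: "(\<lambda>n. nsq (\<lambda>x. conv g (k n) x - g x)) \<longlonglongrightarrow> 0" if g: "cc g" for g
  proof -
    obtain R where R: "R > 0" "\<And>x. norm x > R \<Longrightarrow> g x = 0" using cc_support[OF g] by blast
    define I where "I = nsq (indicator (cball (0::'a) (R + 1)) :: 'a \<Rightarrow> real)"
    have I: "I \<ge> 0" by (simp add: I_def nsq_nonneg)
    have "eventually (\<lambda>n. nsq (\<lambda>x. conv g (k n) x - g x) < e) sequentially" if e: "e > 0" for e
    proof -
      define c where "c = sqrt (e / (I + 1))"
      have c: "c > 0" "c\<^sup>2 * I < e" using e I by (auto simp: c_def field_simps)
      obtain d where d: "d > 0" "\<And>x x'. dist x' x < d \<Longrightarrow> dist (g x') (g x) < c"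
        using cc_uniformly_continuous[OF g] c(1) unfolding uniformly_continuous_on_def by (metis UNIV_I)
      have "eventually (\<lambda>n. r n < min d 1) sequentially"
        by (rule order_tendstoD(2)[OF r]) (use d in simp)
      then show ?thesis
      proof eventually_elim
        case (elim n)
        have b: "(conv g (k n) x - g x)\<^sup>2 \<le> c\<^sup>2 * (indicator (cball 0 (R + 1)) x)\<^sup>2" for x
        proof -
          have kc: "cc (\<lambda>y. k n (x - y))"
          proof -
            have "continuous_on UNIV (\<lambda>y. k n (x - y))"
              using k(1)[of n] by (auto simp: cc_def intro!: continuous_on_compose2[of UNIV "k n"] continuous_intros)
            moreover have "norm y > norm x + r n \<Longrightarrow> k n (x - y) = 0" for y
              using s[of n "x - y"] norm_triangle_sub[of y x] by (simp add: norm_minus_commute)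
            ultimately show ?thesis by (auto simp: cc_def)
          qed
          have i: "integrable lborel (\<lambda>y. k n (x - y))" by (rule cc_integrable[OF kc])
          have one: "(LBINT y. k n (x - y)) = 1"
            using integral_reflect[OF cc_measurable[OF k(1)]] k(3) by simp
          have ig: "integrable lborel (\<lambda>y. g y * k n (x - y))"
            by (rule conv_integrable[OF sqint_locint[OF cc_sqint[OF g]] k(1)])
          have eq: "conv g (k n) x - g x = (LBINT y. (g y - g x) * k n (x - y))"
            using i ig one by (simp add: conv_def left_diff_distrib)
          have small: "\<bar>(g y - g x) * k n (x - y)\<bar> \<le> c * k n (x - y)" for y
          proof (cases "norm (x - y) > r n")
            case False
            then have "dist y x < d" using elim by (simp add: dist_norm norm_minus_commute)
            then have "\<bar>g y - g x\<bar> \<le> c" using d(2)[of y x] by (simp add: dist_norm)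
            then show ?thesis using k(2)[of n "x - y"] by (simp add: abs_mult mult_right_mono)
          qed (simp add: s)
          have "\<bar>conv g (k n) x - g x\<bar> \<le> (LBINT y. \<bar>(g y - g x) * k n (x - y)\<bar>)"
            unfolding eq using integral_norm_bound[of lborel "\<lambda>y. (g y - g x) * k n (x - y)"] by simp
          also have "\<dots> \<le> (LBINT y. c * k n (x - y))"
            by (rule integral_mono) (use i ig small in \<open>auto simp: left_diff_distrib intro!: integrable_abs\<close>)
          finally have le: "\<bar>conv g (k n) x - g x\<bar> \<le> c" using one by simp
          show ?thesis
          proof (cases "x \<in> cball 0 (R + 1)")
            case True
            then show ?thesis using power_mono[OF le, of 2] by simp
          next
            case False
            have "(g y - g x) * k n (x - y) = 0" for y
            proof (cases "norm (x - y) > r n")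
              case f: False
              then have "norm y > R" using False elim norm_triangle_sub[of x y] by simp
              then show ?thesis using R(2) False by simp
            qed (simp add: s)
            then have z: "(\<lambda>y. (g y - g x) * k n (x - y)) = (\<lambda>_. 0)" by blast
            show ?thesis unfolding eq z by simp
          qed
        qed
        have m: "(\<lambda>x. conv g (k n) x - g x) \<in> borel_measurable borel"
          using conv_measurable[OF sqint_locint[OF cc_sqint[OF g]] k(1)[of n]] cc_measurable[OF g]
          by measurable
        show ?case using sqint_bound(2)[OF sqint_indicator_cball m b] c by (simp add: I_def)
      qed
    qed
    then show ?thesis
      by (rule nsq_tendsto_0I)
  qed
  have "eventually (\<lambda>n. nsq (\<lambda>x. conv v (k n) x - v x) < e) sequentially" if e: "e > 0" for e
  proof -
    \<comment> \<open>The three errors enter with factors 2, 4 and 4, which gives 10 / 16 of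
      \<open>e\<close> in total.\<close>
    obtain g where g: "cc g" "nsq (\<lambda>x. v x - g x) < e / 16" using cc_dense[OF v, of "e / 16"] e by auto
    have "eventually (\<lambda>n. nsq (\<lambda>x. conv g (k n) x - g x) < e / 16) sequentially"
      by (rule order_tendstoD(2)[OF ccase[OF g(1)]]) (use e in simp)
    then show ?thesis
    proof eventually_elim
      case (elim n)
      have sg: "sqint g" by (rule cc_sqint[OF g(1)])
      have "nsq (\<lambda>x. conv v (k n) x - conv g (k n) x) = nsq (conv (\<lambda>x. v x - g x) (k n))"
        by (rule arg_cong[where f=nsq]) (rule ext, rule conv_diff[symmetric, OF sqint_locint[OF v] sqint_locint[OF sg] k(1)])
      also have "\<dots> \<le> nsq (\<lambda>x. v x - g x)"
        using Young_sqint(2)[OF sqint_diff[OF v sg] k(1)] absk by simp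
      finally have 1: "nsq (\<lambda>x. conv v (k n) x - conv g (k n) x) < e / 16" using g(2) by simp
      have 2: "nsq (\<lambda>x. g x - v x) < e / 16" using g(2) nsq_minus_commute[of g v] by simp
      have "nsq (\<lambda>x. conv v (k n) x - v x) \<le> 2 * nsq (\<lambda>x. conv v (k n) x - conv g (k n) x) + 2 * nsq (\<lambda>x. conv g (k n) x - v x)"
        by (rule nsq_triangle[OF Young_sqint(1)[OF v k(1)] Young_sqint(1)[OF sg k(1)] v])
      moreover have "nsq (\<lambda>x. conv g (k n) x - v x) \<le> 2 * nsq (\<lambda>x. conv g (k n) x - g x) + 2 * nsq (\<lambda>x. g x - v x)"
        by (rule nsq_triangle[OF Young_sqint(1)[OF sg k(1)] sg v])
      ultimately show ?case using 1 2 elim e by linarith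
    qed
  qed
  then show ?thesis
    by (rule nsq_tendsto_0I)
qed

section \<open>Test functions and mollifiers\<close>

lemma smooth_fun_derivative:
  assumes "smooth_fun f"
  shows "((\<lambda>t. pder is f (x + t *\<^sub>R axis i 1)) has_real_derivative pder (i # is) f x) (at 0)"
  using assms by (simp add: smooth_fun_def flip: DERIV_deriv_iff_real_differentiable)

text \<open>The set \<open>norm x > R\<close> is open, so a derivative at one of its points involves
  only values inside it; supports do not grow under differentiation.\<close>

lemma test_fun_cc:
  assumes "test_fun f"
  shows "cc (pder is f)"
proof -
  obtain R where R: "\<And>x. norm x > R \<Longrightarrow> f x = 0" using assms by (auto simp: test_fun_def)
  have "pder is f x = 0" if "norm x > R" for x
    using that
  proof (induction "is" arbitrary: x)
    case (Cons i "is")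
    have "open {x :: real^'a. norm x > R}"
      by (intro open_Collect_less continuous_intros)
    moreover have "((\<lambda>t. x + t *\<^sub>R axis i 1) \<longlongrightarrow> x + 0 *\<^sub>R axis i 1) (at (0::real))"
      by (intro tendsto_intros)
    ultimately have "eventually (\<lambda>t. x + t *\<^sub>R axis i 1 \<in> {x. norm x > R}) (at (0::real))"
      using Cons.prems by (intro topological_tendstoD) auto
    then have "eventually (\<lambda>t. x + t *\<^sub>R axis i 1 \<in> {x. norm x > R}) (nhds (0::real))"
      using Cons.prems by (auto simp: eventually_nhds_conv_at)
    then have "eventually (\<lambda>t. pder is f (x + t *\<^sub>R axis i 1) = 0) (nhds (0::real))"
      by eventually_elim (simp add: Cons.IH)
    then have "((\<lambda>t. pder is f (x + t *\<^sub>R axis i 1)) has_real_derivative 0) (at 0)"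
      by (subst DERIV_cong_ev[OF refl _ refl, where g="\<lambda>_. 0"]) auto
    then show ?case by (simp add: DERIV_imp_deriv)
  qed (use R in auto)
  then show ?thesis using assms by (auto simp: cc_def test_fun_def smooth_fun_def)
qed

lemma pder_reflect:
  assumes "smooth_fun k"
  shows "pder is (\<lambda>y. k (x - y)) y = (-1) ^ length is * pder is k (x - y)"
    "((\<lambda>t. pder is (\<lambda>y. k (x - y)) (y + t *\<^sub>R axis i 1)) has_real_derivative
      (-1) ^ Suc (length is) * pder (i # is) k (x - y)) (at 0)"
proof -
  have D: "((\<lambda>t. pder is k (x - (y + t *\<^sub>R axis i 1))) has_real_derivative - pder (i # is) k (x - y)) (at 0)" for "is" y i
  proof -
    have "((\<lambda>t. pder is k ((x - y) + t *\<^sub>R axis i 1)) has_real_derivative pder (i # is) k (x - y)) (at (- 0))"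
      using smooth_fun_derivative[OF assms, of "is" "x - y" i] by simp
    from DERIV_chain2[where f="\<lambda>t. pder is k ((x - y) + t *\<^sub>R axis i 1)" and g=uminus and x=0 and Db="-1" and s=UNIV, OF this DERIV_minus[OF DERIV_ident]]
    show ?thesis by (simp add: algebra_simps)
  qed
  have E: "pder is (\<lambda>y. k (x - y)) y = (-1) ^ length is * pder is k (x - y)" for y "is"
  proof (induction "is" arbitrary: y)
    case (Cons i "is")
    have "((\<lambda>t. pder is (\<lambda>y. k (x - y)) (y + t *\<^sub>R axis i 1)) has_real_derivative
      (-1) ^ length is * - pder (i # is) k (x - y)) (at 0)"
      unfolding Cons.IH by (rule DERIV_cmult[OF D])
    then show ?case by (simp add: DERIV_imp_deriv)
  qed simp
  show "pder is (\<lambda>y. k (x - y)) y = (-1) ^ length is * pder is k (x - y)" by (rule E)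
  show "((\<lambda>t. pder is (\<lambda>y. k (x - y)) (y + t *\<^sub>R axis i 1)) has_real_derivative
      (-1) ^ Suc (length is) * pder (i # is) k (x - y)) (at 0)"
    unfolding E using DERIV_cmult[OF D, of "(-1) ^ length is" "is" y i] by simp
qed

text \<open>Reflected kernels are the test functions that turn the weak equation into a pointwise
  identity for convolutions.\<close>

lemma test_fun_reflect:
  assumes "test_fun k"
  shows "test_fun (\<lambda>y. k (x - y))"
proof -
  have k: "smooth_fun k" using assms by (simp add: test_fun_def)
  have "smooth_fun (\<lambda>y. k (x - y))"
    unfolding smooth_fun_def
  proof (intro allI conjI)
    fix "is" i y
    have "continuous_on UNIV (pder is k)" using k by (simp add: smooth_fun_def)
    then have "continuous_on UNIV (\<lambda>y. pder is k (x - y))"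
      by (rule continuous_on_compose2) (auto intro!: continuous_intros)
    then have "continuous_on UNIV (\<lambda>y. (-1) ^ length is * pder is k (x - y))"
      by (intro continuous_intros)
    also have "(\<lambda>y. (-1) ^ length is * pder is k (x - y)) = pder is (\<lambda>y. k (x - y))"
      using pder_reflect(1)[OF k] by fastforce
    finally show "continuous_on UNIV (pder is (\<lambda>y. k (x - y)))" .
    show "(\<lambda>t. pder is (\<lambda>y. k (x - y)) (y + t *\<^sub>R axis i 1)) differentiable (at 0)"
      using pder_reflect(2)[OF k] real_differentiable_def by blast
  qed
  moreover have "\<exists>R. \<forall>y. norm y > R \<longrightarrow> k (x - y) = 0"
  proof -
    obtain R where R: "\<And>x. norm x > R \<Longrightarrow> k x = 0" using assms by (auto simp: test_fun_def)
    have "k (x - y) = 0" if "norm y > norm x + R" for y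
      using R[of "x - y"] that norm_triangle_sub[of y x] by (simp add: norm_minus_commute)
    then show ?thesis by blast
  qed
  ultimately show ?thesis by (simp add: test_fun_def)
qed

lemma laplacian_reflect:
  assumes "test_fun k"
  shows "laplacian (\<lambda>y. k (x - y)) y = laplacian k (x - y)"
  using assms unfolding laplacian_def test_fun_def by (simp only: pder_reflect(1)) simp

section \<open>The flat function exp (-1 / t) and its derivatives\<close>

text \<open>The powers of \<open>t\<close> in the denominator make the family closed under
  differentiation, so smoothness at 0 needs no formula for derivatives of arbitrary order.\<close>

definition gexp :: "nat \<Rightarrow> real \<Rightarrow> real" where
  "gexp k t = (if t \<le> 0 then 0 else exp (- 1 / t) / t ^ k)"

lemma gexp_nonneg: "0 \<le> gexp k t"
  by (simp add: gexp_def)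

lemma gexp_pos: "t > 0 \<Longrightarrow> 0 < gexp k t"
  by (simp add: gexp_def)

lemma gexp_eq_0: "t \<le> 0 \<Longrightarrow> gexp k t = 0"
  by (simp add: gexp_def)

lemma gexp_bound: "gexp k t \<le> real (k + 2) ^ (k + 2) * t\<^sup>2"
proof (cases "t > 0")
  case True
  \<comment> \<open>Two powers more than the \<open>t ^ k\<close> in the denominator, so that the
    quadratic bound makes the difference quotient at 0 vanish in the limit. The source is s \<le>
    exp s at s = 1 / (m t), raised to the power \<open>m\<close>.\<close>
  define m where "m = k + 2"
  have m: "real m > 0" by (simp add: m_def)
  have "1 / (m * t) \<le> exp (1 / (m * t))" using exp_ge_add_one_self[of "1 / (m * t)"] by linarith
  then have "(1 / (m * t)) ^ m \<le> exp (1 / (m * t)) ^ m" using True by (intro power_mono) auto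
  also have "\<dots> = exp (1 / t)" using m by (simp add: exp_of_nat_mult[symmetric])
  finally have "1 / exp (1 / t) \<le> (m * t) ^ m"
    using True m by (simp add: power_divide field_simps)
  then have "exp (- 1 / t) \<le> m ^ m * t ^ m" by (simp add: exp_minus power_mult_distrib inverse_eq_divide)
  then have "exp (- 1 / t) / t ^ k \<le> m ^ m * t ^ m / t ^ k" using True by (intro divide_right_mono) auto
  also have "t ^ m = t ^ k * t\<^sup>2" by (simp add: m_def power_add power2_eq_square)
  also have "m ^ m * (t ^ k * t\<^sup>2) / t ^ k = m ^ m * t\<^sup>2" using True by simp
  finally have "gexp k t \<le> m ^ m * t\<^sup>2" using True by (simp add: gexp_def)
  then show ?thesis by (simp only: m_def of_nat_power)
qed (simp add: gexp_def)

lemma gexp_derivative: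
  "(gexp k has_real_derivative gexp (k + 2) t - k * gexp (k + 1) t) (at t)"
proof -
  consider "t > 0" | "t < 0" | "t = 0" by linarith
  then show ?thesis
  proof cases
    case 1
    have "((\<lambda>t. exp (- 1 / t) / t ^ k) has_real_derivative gexp (k + 2) t - k * gexp (k + 1) t) (at t)"
      using 1 by (auto intro!: derivative_eq_intros simp: gexp_def field_simps power2_eq_square)
        (cases k; simp add: field_simps)
    moreover have "eventually (\<lambda>t. gexp k t = exp (- 1 / t) / t ^ k) (nhds t)"
      using eventually_nhds_in_open[of "{0<..}" t] 1 by (auto elim!: eventually_mono simp: gexp_def)
    ultimately show ?thesis by (subst DERIV_cong_ev[OF refl _ refl])
  next
    case 2
    have "eventually (\<lambda>t. gexp k t = 0) (nhds t)"
      using eventually_nhds_in_open[of "{..<0}" t] 2 by (auto elim!: eventually_mono simp: gexp_def)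
    then show ?thesis using 2 by (subst DERIV_cong_ev[OF refl _ refl, where g="\<lambda>_. 0"]) (auto simp: gexp_def)
  next
    case 3
    have "((\<lambda>h. gexp k h / h) \<longlongrightarrow> 0) (at 0)"
    proof (rule Lim_null_comparison)
      show "eventually (\<lambda>h. norm (gexp k h / h) \<le> real (k + 2) ^ (k + 2) * \<bar>h\<bar>) (at 0)"
      proof (rule eventuallyI)
        fix h :: real
        show "norm (gexp k h / h) \<le> real (k + 2) ^ (k + 2) * \<bar>h\<bar>"
        proof (cases "h = 0")
          case False
          then show ?thesis using gexp_bound[of k h] gexp_nonneg[of k h]
            by (simp add: divide_simps power2_eq_square mult.assoc)
        qed simp
      qed
      have "((\<lambda>h::real. real (k + 2) ^ (k + 2) * \<bar>h\<bar>) \<longlongrightarrow> real (k + 2) ^ (k + 2) * \<bar>0\<bar>) (at 0)"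
        by (intro tendsto_intros)
      then show "((\<lambda>h::real. real (k + 2) ^ (k + 2) * \<bar>h\<bar>) \<longlongrightarrow> 0) (at 0)" by simp
    qed
    then show ?thesis using 3 by (simp add: DERIV_def gexp_def)
  qed
qed

lemma gexp_continuous: "continuous_on A (gexp k)"
  by (intro continuous_at_imp_continuous_on ballI DERIV_isCont[OF gexp_derivative])

lemma norm_shift_power2:
  "(norm (x + t *\<^sub>R axis i 1 :: real^'n::finite))\<^sup>2 = (norm x)\<^sup>2 + 2 * t * x $ i + t\<^sup>2"
proof -
  have "(norm (x + t *\<^sub>R axis i 1))\<^sup>2 = x \<bullet> x + 2 * t * (x \<bullet> axis i 1) + t * t * (axis i 1 \<bullet> (axis i 1 :: real^'n))"
    by (simp add: power2_norm_eq_inner inner_add_left inner_add_right inner_commute algebra_simps)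
  then show ?thesis by (simp add: power2_norm_eq_inner inner_axis inner_axis_axis power2_eq_square[of t])
qed

lemma norm_power2_derivative:
  "((\<lambda>t. (norm (x + t *\<^sub>R axis i 1 :: real^'n::finite))\<^sup>2) has_real_derivative 2 * x $ i) (at 0)"
  unfolding norm_shift_power2 by (auto intro!: derivative_eq_intros)

lemma coord_derivative:
  "((\<lambda>t. (x + t *\<^sub>R axis i 1 :: real^'n::finite) $ j) has_real_derivative (if i = j then 1 else 0)) (at 0)"
  by (auto intro!: derivative_eq_intros simp: axis_def)

section \<open>Radial bumps and their superpositions over scales\<close>

definition bump :: "nat \<Rightarrow> real \<Rightarrow> real^'n::finite \<Rightarrow> real" where
  "bump k l x = gexp k (1 - l * (norm x)\<^sup>2)"

text \<open>Bumps superposed over the scales \<open>l\<close> with a power weight. A derivative in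
  \<open>x\<close> brings down a factor \<open>l\<close>, which merely raises the exponent
  \<open>c\<close>, so derivatives stay within the family up to coordinate factors.\<close>

definition ibump :: "real \<Rightarrow> real \<Rightarrow> real \<Rightarrow> nat \<Rightarrow> real^'n::finite \<Rightarrow> real" where
  "ibump a b c k x = integral {a..b} (\<lambda>l. l powr c * bump k l x)"

lemma bump_continuous: "continuous_on A (bump k l)"
  unfolding bump_def by (rule continuous_on_compose2[OF gexp_continuous[of UNIV]]) (auto intro!: continuous_intros)

lemma bump_derivative:
  "((\<lambda>t. bump k l (x + t *\<^sub>R axis i 1)) has_real_derivative
    - 2 * l * (x $ i * (bump (k + 2) l x - k * bump (k + 1) l x))) (at 0)"
proof -
  have "((\<lambda>t. 1 - l * (norm (x + t *\<^sub>R axis i 1))\<^sup>2) has_real_derivative 0 - l * (2 * x $ i)) (at 0)"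
    by (intro DERIV_diff DERIV_const DERIV_cmult norm_power2_derivative)
  from DERIV_chain2[OF gexp_derivative this, of k] show ?thesis
    by (simp add: bump_def algebra_simps)
qed

lemma ibump_integrand_continuous:
  assumes "0 < a"
  shows "continuous_on (A \<times> {a..b}) (\<lambda>(x, l). l powr c * bump k l x)"
  unfolding bump_def split_beta
  by (intro continuous_intros continuous_on_compose2[OF gexp_continuous[of UNIV]]) (use assms in auto)

lemma ibump_integrable:
  assumes "0 < a"
  shows "(\<lambda>l. l powr c * bump k l x) integrable_on {a..b}"
proof (rule integrable_continuous_interval)
  have "continuous_on {a..b} (\<lambda>l. (\<lambda>(x, l). l powr c * bump k l x) (x, l))"
    by (rule continuous_on_compose2[OF ibump_integrand_continuous[OF assms, of UNIV b c k]]) (auto intro!: continuous_intros)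
  then show "continuous_on {a..b} (\<lambda>l. l powr c * bump k l x)" by simp
qed

lemma ibump_continuous:
  assumes "0 < a"
  shows "continuous_on UNIV (ibump a b c k)"
  unfolding ibump_def
  using integral_continuous_on_param[of UNIV a b "\<lambda>x l. l powr c * bump k l x"]
    ibump_integrand_continuous[OF assms, of UNIV b c k] by simp

lemma ibump_derivative:
  assumes "0 < a"
  shows "((\<lambda>t. ibump a b c k (x + t *\<^sub>R axis i 1)) has_real_derivative
    - 2 * (x $ i * (ibump a b (c + 1) (k + 2) x - k * ibump a b (c + 1) (k + 1) x))) (at 0)"
proof -
  define F where "F t l = l powr c * bump k l (x + t *\<^sub>R axis i 1)" for t l
  define G where "G t l = l powr c * (- 2 * l * ((x + t *\<^sub>R axis i 1) $ i * (bump (k + 2) l (x + t *\<^sub>R axis i 1) - k * bump (k + 1) l (x + t *\<^sub>R axis i 1))))" for t l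
  have "((\<lambda>t. integral (cbox a b) (F t)) has_real_derivative integral (cbox a b) (G 0)) (at 0 within UNIV)"
  proof (rule leibniz_rule_field_derivative)
    fix t l
    have "((\<lambda>s. bump k l ((x + t *\<^sub>R axis i 1) + s *\<^sub>R axis i 1)) has_real_derivative
      - 2 * l * ((x + t *\<^sub>R axis i 1) $ i * (bump (k + 2) l (x + t *\<^sub>R axis i 1) - k * bump (k + 1) l (x + t *\<^sub>R axis i 1)))) (at 0)"
      by (rule bump_derivative)
    then have "((\<lambda>s. bump k l (x + (s + t) *\<^sub>R axis i 1)) has_real_derivative
      - 2 * l * ((x + t *\<^sub>R axis i 1) $ i * (bump (k + 2) l (x + t *\<^sub>R axis i 1) - k * bump (k + 1) l (x + t *\<^sub>R axis i 1)))) (at 0)"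
      by (simp add: algebra_simps)
    then have "((\<lambda>s. bump k l (x + s *\<^sub>R axis i 1)) has_real_derivative
      - 2 * l * ((x + t *\<^sub>R axis i 1) $ i * (bump (k + 2) l (x + t *\<^sub>R axis i 1) - k * bump (k + 1) l (x + t *\<^sub>R axis i 1)))) (at t)"
      using DERIV_shift[of "\<lambda>s. bump k l (x + s *\<^sub>R axis i 1)" _ 0 t] by simp
    then show "((\<lambda>t. F t l) has_real_derivative G t l) (at t within UNIV)"
      unfolding F_def G_def by (rule DERIV_cmult)
  next
    fix t show "F t integrable_on cbox a b"
      unfolding F_def using ibump_integrable[OF assms] by simp
  next
    show "continuous_on (UNIV \<times> cbox a b) (\<lambda>(t, l). G t l)"
      unfolding G_def bump_def split_beta
      by (intro continuous_intros continuous_on_compose2[OF gexp_continuous[of UNIV]]) (use assms in auto)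
  qed auto
  moreover have "integral (cbox a b) (G 0) = - 2 * (x $ i * (ibump a b (c + 1) (k + 2) x - k * ibump a b (c + 1) (k + 1) x))"
  proof -
    have "integral (cbox a b) (G 0) = integral {a..b} (\<lambda>l. - 2 * (x $ i * (l powr (c + 1) * bump (k + 2) l x - k * (l powr (c + 1) * bump (k + 1) l x))))"
      unfolding G_def interval_cbox[symmetric]
      by (rule integral_cong) (use assms in \<open>simp add: powr_add algebra_simps\<close>)
    also have "\<dots> = - 2 * (x $ i * integral {a..b} (\<lambda>l. l powr (c + 1) * bump (k + 2) l x - k * (l powr (c + 1) * bump (k + 1) l x)))"
      by (simp only: integral_mult_right)
    also have "integral {a..b} (\<lambda>l. l powr (c + 1) * bump (k + 2) l x - k * (l powr (c + 1) * bump (k + 1) l x)) =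
      ibump a b (c + 1) (k + 2) x - k * ibump a b (c + 1) (k + 1) x"
      unfolding ibump_def
      by (subst integral_diff) (use ibump_integrable[OF assms] in \<open>auto intro!: integrable_on_mult_right\<close>)
    finally show ?thesis .
  qed
  ultimately show ?thesis by (simp add: F_def[abs_def] ibump_def)
qed

text \<open>Smoothness speaks of all iterated derivatives; a class closed under every partial
  derivative reduces it to one induction on the list of directions. The closure rules are those that
  the derivative formulas of \<open>bump\<close> and \<open>ibump\<close> call for.\<close>

inductive bump_class :: "(real^'n::finite \<Rightarrow> real) \<Rightarrow> bool" where
  "bump_class (bump k l)"
| "0 < a \<Longrightarrow> bump_class (ibump a b c k)"
| "bump_class f \<Longrightarrow> bump_class (\<lambda>x. x $ i * f x)"
| "bump_class f \<Longrightarrow> bump_class (\<lambda>x. c * f x)"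
| "bump_class f \<Longrightarrow> bump_class g \<Longrightarrow> bump_class (\<lambda>x. f x - g x)"

lemma bump_class_continuous: "bump_class f \<Longrightarrow> continuous_on UNIV f"
  by (induction rule: bump_class.induct) (auto intro!: continuous_intros bump_continuous ibump_continuous)

lemma bump_class_derivative:
  assumes "bump_class f"
  shows "\<exists>f'. bump_class f' \<and> (\<forall>x. ((\<lambda>t. f (x + t *\<^sub>R axis i 1)) has_real_derivative f' x) (at 0))"
  using assms
proof (induction rule: bump_class.induct)
  case (1 k l)
  show ?case
    by (rule exI[of _ "\<lambda>x. - 2 * l * (x $ i * (bump (k + 2) l x - k * bump (k + 1) l x))"])
      (intro conjI allI bump_derivative bump_class.intros)
next
  case (2 a b c k)
  show ?case
    by (rule exI[of _ "\<lambda>x. - 2 * (x $ i * (ibump a b (c + 1) (k + 2) x - k * ibump a b (c + 1) (k + 1) x))"])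
      (intro conjI allI ibump_derivative bump_class.intros 2)
next
  case (3 f j)
  then obtain f' where f': "bump_class f'" "\<And>x. ((\<lambda>t. f (x + t *\<^sub>R axis i 1)) has_real_derivative f' x) (at 0)" by blast
  \<comment> \<open>The sum from the product rule, written with a minus sign because the class is
    generated by multiples and differences.\<close>
  have "bump_class (\<lambda>x. (if i = j then 1 else 0) * f x - (-1) * (x $ j * f' x))"
    by (intro bump_class.intros 3 f')
  moreover have "((\<lambda>t. (x + t *\<^sub>R axis i 1) $ j * f (x + t *\<^sub>R axis i 1)) has_real_derivative
      (if i = j then 1 else 0) * f x - (-1) * (x $ j * f' x)) (at 0)" for x
    by (rule DERIV_cong[OF DERIV_mult[OF coord_derivative f'(2)]]) (simp add: mult.commute)
  ultimately show ?case by blast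
next
  case (4 f c)
  then obtain f' where f': "bump_class f'" "\<And>x. ((\<lambda>t. f (x + t *\<^sub>R axis i 1)) has_real_derivative f' x) (at 0)" by blast
  have "bump_class (\<lambda>x. c * f' x)" by (intro bump_class.intros f')
  then show ?case using DERIV_cmult[OF f'(2)] by blast
next
  case (5 f g)
  then obtain f' g' where "bump_class f'" "\<And>x. ((\<lambda>t. f (x + t *\<^sub>R axis i 1)) has_real_derivative f' x) (at 0)"
    "bump_class g'" "\<And>x. ((\<lambda>t. g (x + t *\<^sub>R axis i 1)) has_real_derivative g' x) (at 0)" by blast
  then show ?case using bump_class.intros(5)[of f' g'] DERIV_diff by blast
qed

lemma bump_class_smooth:
  assumes "bump_class f"
  shows "smooth_fun f"
proof -
  have c: "bump_class (pder is f)" for "is"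
  proof (induction "is")
    case (Cons i "is")
    obtain f' where f': "bump_class f'" "\<And>x. ((\<lambda>t. pder is f (x + t *\<^sub>R axis i 1)) has_real_derivative f' x) (at 0)"
      using bump_class_derivative[OF Cons] by blast
    have "pder (i # is) f = f'" using DERIV_imp_deriv[OF f'(2)] by fastforce
    then show ?case using f'(1) by simp
  qed (use assms in simp)
  show ?thesis
    unfolding smooth_fun_def
    using bump_class_continuous[OF c] bump_class_derivative[OF c] real_differentiable_def by metis
qed

lemma bump_support:
  assumes "0 < a" "a \<le> l" "norm x > 1 / sqrt a"
  shows "bump k l x = 0"
proof -
  have "(1 / sqrt a)\<^sup>2 \<le> (norm x)\<^sup>2" using assms by (intro power_mono) auto
  then have "1 \<le> a * (norm x)\<^sup>2" using assms(1) by (simp add: power_divide field_simps)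
  also have "\<dots> \<le> l * (norm x)\<^sup>2" using assms by (intro mult_right_mono) auto
  finally show ?thesis by (simp add: bump_def gexp_eq_0)
qed

lemma ibump_support:
  assumes "0 < a" "norm x > 1 / sqrt a"
  shows "ibump a b c k x = 0"
proof -
  have "integral {a..b} (\<lambda>l. l powr c * bump k l x) = integral {a..b} (\<lambda>l. 0)"
    by (rule integral_cong) (use assms bump_support in auto)
  then show ?thesis by (simp add: ibump_def)
qed

lemma test_fun_ibump: "0 < a \<Longrightarrow> test_fun (ibump a b c k)"
  unfolding test_fun_def using bump_class_smooth[OF bump_class.intros(2)] ibump_support by blast

lemma ibump_nonneg: "0 \<le> ibump a b c k x"
  \<comment> \<open>Nothing is assumed about \<open>a\<close>; where the integral does not exist,
    its default value is 0.\<close>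
  unfolding ibump_def by (cases "(\<lambda>l. l powr c * bump k l x) integrable_on {a..b}")
    (simp_all add: Henstock_Kurzweil_Integration.integral_nonneg not_integrable_integral bump_def gexp_nonneg)

lemma pder1_eq:
  assumes "\<And>x. ((\<lambda>t. f (x + t *\<^sub>R axis i 1)) has_real_derivative f' x) (at 0)"
  shows "pder [i] f = f'"
  using DERIV_imp_deriv[OF assms] by fastforce

lemma pder2_eq: "pder [i, i] f = pder [i] (pder [i] f)"
  by simp

section \<open>Mollifiers and the kernel that joins two scales\<close>

text \<open>The index 2 appears because \<open>gexp 2\<close> is the derivative of
  \<open>gexp 0\<close>, the profile of \<open>kern\<close>. The power of \<open>l\<close>
  compensates for the shrinking support, whose radius is \<open>1 / sqrt l\<close>, and keeps the
  integral constant.\<close>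

definition moll :: "real \<Rightarrow> real^'n::finite \<Rightarrow> real" where
  "moll l x = l powr (real CARD('n) / 2) * bump 2 l x"

text \<open>With G = \<open>gexp 0\<close> and d the dimension, the Laplacian of l^(d/2 - 2) G(1 - l
  |x|^2) is -4 times the derivative of \<open>moll l\<close> in \<open>l\<close>, and this identity
  forces the exponent. Integrating over \<open>l\<close> gives a compactly supported kernel whose
  Laplacian is a difference of two mollifiers.\<close>

definition kern :: "real \<Rightarrow> real \<Rightarrow> real^'n::finite \<Rightarrow> real" where
  "kern a b = ibump a b (real CARD('n) / 2 - 2) 0"

lemma test_fun_moll: "0 < l \<Longrightarrow> test_fun (moll l :: real^'n::finite \<Rightarrow> real)"
proof -
  assume l: "0 < l"
  have "bump_class (moll l :: real^'n \<Rightarrow> real)" unfolding moll_def by (intro bump_class.intros)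
  then have "smooth_fun (moll l :: real^'n \<Rightarrow> real)" by (rule bump_class_smooth)
  moreover have "\<exists>R. \<forall>x :: real^'n. norm x > R \<longrightarrow> moll l x = 0"
    using bump_support[OF l, of l] unfolding moll_def by fastforce
  ultimately show "test_fun (moll l :: real^'n \<Rightarrow> real)" by (simp add: test_fun_def)
qed

text \<open>The mass at scale 1 normalises all scales \<open>l \<ge> 1\<close>, by
  \<open>integral_moll_const\<close>.\<close>

definition nmoll :: "real \<Rightarrow> real^'n::finite \<Rightarrow> real" where
  "nmoll l x = moll l x / (LBINT y. moll 1 (y :: real^'n))"

lemma moll_nonneg: "0 \<le> moll l x"
  by (simp add: moll_def bump_def gexp_nonneg)

lemma moll_support: "0 < l \<Longrightarrow> norm x > 1 / sqrt l \<Longrightarrow> moll l x = 0"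
  using bump_support[of l l x] by (simp add: moll_def)

lemma test_fun_kern: "0 < a \<Longrightarrow> test_fun (kern a b)"
  unfolding kern_def by (rule test_fun_ibump)

lemma kern_support: "0 < a \<Longrightarrow> norm x > 1 / sqrt a \<Longrightarrow> kern a b x = 0"
  unfolding kern_def by (rule ibump_support)

lemma kern_nonneg: "0 \<le> kern a b x"
  unfolding kern_def by (rule ibump_nonneg)

text \<open>\<^term>\<open>moll l\<close> satisfies a heat-type equation in the scale parameter \<^term>\<open>l\<close>.\<close>
lemma laplacian_kern:
  fixes x :: "real^'n::finite"
  assumes a: "0 < a" "a \<le> b"
  shows "laplacian (kern a b) x = - 4 * (moll b x - moll a x)"
proof -
  define d where "d = real CARD('n)"
  define B where "B j k = (ibump a b (d / 2 - 2 + j) k :: real^'n \<Rightarrow> real)" for j :: real and k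
  have DB: "((\<lambda>t. B j k (x + t *\<^sub>R axis i 1)) has_real_derivative
      - 2 * (x $ i * (B (j + 1) (k + 2) x - k * B (j + 1) (k + 1) x))) (at 0)" for j k x i
    using ibump_derivative[OF a(1), of b "d / 2 - 2 + j" k x i] by (simp add: B_def add.assoc)
  have K: "kern a b = B 0 0" by (simp add: kern_def B_def d_def)
  have P1: "pder [i] (kern a b) = (\<lambda>x :: real^'n. - 2 * (x $ i * B 1 2 x))" for i
    unfolding K using DB[of 0 0 _ i] by (intro pder1_eq) (simp add: numeral_2_eq_2)
  have P2: "pder [i, i] (kern a b) = (\<lambda>x :: real^'n. - 2 * B 1 2 x + 4 * (x $ i)\<^sup>2 * (B 2 4 x - 2 * B 2 3 x))" for i
    unfolding pder2_eq P1
  proof (rule pder1_eq)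
    fix x
    have "((\<lambda>t. (x + t *\<^sub>R axis i 1) $ i * B 1 2 (x + t *\<^sub>R axis i 1)) has_real_derivative
      1 * B 1 2 x + (- 2 * (x $ i * (B 2 4 x - 2 * B 2 3 x))) * x $ i) (at 0)"
      using DERIV_mult[OF coord_derivative DB, of x i i 1 2 x i] by simp
    from DERIV_cmult[OF this, of "-2"]
    show "((\<lambda>t. - 2 * ((x + t *\<^sub>R axis i 1) $ i * B 1 2 (x + t *\<^sub>R axis i 1))) has_real_derivative
      - 2 * B 1 2 x + 4 * (x $ i)\<^sup>2 * (B 2 4 x - 2 * B 2 3 x)) (at 0)"
      by (simp add: power2_eq_square algebra_simps)
  qed
  have nx: "(\<Sum>i\<in>UNIV. (x $ i)\<^sup>2) = (norm x)\<^sup>2"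
    by (simp add: norm_vec_def L2_set_def sum_nonneg)
  have "laplacian (kern a b) x = (\<Sum>i\<in>UNIV. - 2 * B 1 2 x + 4 * (x $ i)\<^sup>2 * (B 2 4 x - 2 * B 2 3 x))"
    unfolding laplacian_def P2 ..
  also have "\<dots> = - 2 * d * B 1 2 x + 4 * (norm x)\<^sup>2 * (B 2 4 x - 2 * B 2 3 x)"
    by (simp add: sum_subtractf d_def sum_distrib_left[symmetric] sum_distrib_right[symmetric] nx)
  finally have lap: "laplacian (kern a b) x = - 2 * d * B 1 2 x + 4 * (norm x)\<^sup>2 * (B 2 4 x - 2 * B 2 3 x)" .
  \<comment> \<open>At fixed \<open>x\<close>, \<open>M\<close> is the mollifier as a function of
    the scale. Its derivative \<open>M'\<close> is written with the exponents of the integrals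
    \<open>B\<close>, so that the fundamental theorem of calculus in \<open>l\<close> produces
    them.\<close>
  define M where "M l = l powr (d / 2) * bump 2 l x" for l
  define M' where "M' l = (d / 2) * (l powr (d / 2 - 2 + 1) * bump 2 l x)
      - (norm x)\<^sup>2 * (l powr (d / 2 - 2 + 2) * bump 4 l x - 2 * (l powr (d / 2 - 2 + 2) * bump 3 l x))" for l
  have DM: "(M has_real_derivative M' l) (at l)" if "l > 0" for l
  proof -
    have "((\<lambda>l. gexp 2 (1 - l * (norm x)\<^sup>2)) has_real_derivative
        (gexp (2 + 2) (1 - l * (norm x)\<^sup>2) - real 2 * gexp (2 + 1) (1 - l * (norm x)\<^sup>2)) * (- (norm x)\<^sup>2)) (at l)"
      by (rule DERIV_chain2[OF gexp_derivative]) (auto intro!: derivative_eq_intros)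
    from DERIV_mult[OF has_real_derivative_powr[OF that, of "d / 2"] this]
    show ?thesis
      unfolding M_def[abs_def] M'_def bump_def by (rule DERIV_cong) (simp add: algebra_simps numeral_eq_Suc)
  qed
  have "(M' has_integral (M b - M a)) {a..b}"
    by (rule fundamental_theorem_of_calculus[OF a(2)])
      (use DM a in \<open>auto simp: has_real_derivative_iff_has_vector_derivative[symmetric] intro: has_field_derivative_at_within\<close>)
  then have "M b - M a = integral {a..b} M'" by (simp add: integral_unique)
  also have "\<dots> = (d / 2) * B 1 2 x - (norm x)\<^sup>2 * (B 2 4 x - 2 * B 2 3 x)"
  proof -
    have i: "(\<lambda>l. l powr c * bump k l x) integrable_on {a..b}" for c k by (rule ibump_integrable[OF a(1)])
    have "(M' has_integral ((d / 2) * B 1 2 x - (norm x)\<^sup>2 * (B 2 4 x - 2 * B 2 3 x))) {a..b}"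
      unfolding M'_def[abs_def] B_def ibump_def
      by (intro has_integral_diff has_integral_mult_right integrable_integral i)
    then show ?thesis by (rule integral_unique)
  qed
  finally have "(d / 2) * B 1 2 x - (norm x)\<^sup>2 * (B 2 4 x - 2 * B 2 3 x) = moll b x - moll a x"
    by (simp add: M_def moll_def d_def)
  then show ?thesis unfolding lap by (simp add: algebra_simps)
qed

lemma pder_integral_0:
  assumes "test_fun f"
  shows "(LBINT x. pder (i # is) f x) = 0"
proof (rule integral_derivative_eq_0[OF test_fun_cc[OF assms] test_fun_cc[OF assms]])
  show "norm (axis i 1 :: real^'a) = 1" by simp
qed (use assms smooth_fun_derivative in \<open>auto simp: test_fun_def simp del: pder.simps\<close>)

text \<open>The kernel has compact support, so its Laplacian integrates to 0;
  \<open>laplacian_kern\<close> turns this into conservation of mass across scales, without a change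
  of variables.\<close>

lemma integral_moll_const:
  assumes a: "0 < a" "a \<le> b"
  shows "(LBINT x. moll a (x :: real^'n::finite)) = (LBINT x. moll b (x :: real^'n))"
proof -
  have i: "integrable lborel (moll a :: real^'n \<Rightarrow> real)" "integrable lborel (moll b :: real^'n \<Rightarrow> real)"
    using cc_integrable[OF test_fun_cc[OF test_fun_moll, of a "[]"]] cc_integrable[OF test_fun_cc[OF test_fun_moll, of b "[]"]] a by auto
  have "(LBINT x. laplacian (kern a b) (x :: real^'n)) = (\<Sum>i\<in>UNIV. LBINT x. pder [i, i] (kern a b) (x :: real^'n))"
    unfolding laplacian_def
    by (rule Bochner_Integration.integral_sum) (rule cc_integrable[OF test_fun_cc[OF test_fun_kern[OF a(1)]]])
  also have "\<dots> = 0" by (simp only: pder_integral_0[OF test_fun_kern[OF a(1)]]) simp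
  finally show ?thesis using i by (simp add: laplacian_kern[OF a])
qed

text \<open>Green's identity against the weight \<open>|x|\<^sup>2\<close>, whose Laplacian is constant, bounds the integral of
  \<^term>\<open>kern a b\<close>.\<close>
lemma integral_kern_le:
  assumes a: "0 < a" "a \<le> b"
  shows "(LBINT x. kern a b (x :: real^'n::finite)) \<le> 2 / (real CARD('n) * a) * (LBINT x. moll a (x :: real^'n))"
proof -
  let ?K = "kern a b :: real^'n \<Rightarrow> real"
  have T: "test_fun ?K" by (rule test_fun_kern[OF a(1)])
  have cK: "cc ?K" using test_fun_cc[OF T, of "[]"] by simp
  have N: "continuous_on UNIV (\<lambda>x :: real^'n. (norm x)\<^sup>2)" by (intro continuous_intros)
  have C: "continuous_on UNIV (\<lambda>x :: real^'n. x $ i)" for i by (intro continuous_intros)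
  \<comment> \<open>The components of |x|^2 grad K - K grad |x|^2. In the i-th partial derivative
    the terms 2 x_i d_i K cancel, which leaves \<open>cH'\<close>.\<close>
  have cH: "cc (\<lambda>x. (norm x)\<^sup>2 * pder [i] ?K x - 2 * (x $ i * ?K x))" for i
    using cc_add[OF cc_mult[OF test_fun_cc[OF T] N] cc_cmult[OF cc_mult[OF cK C], of "-2"], of "[i]" i]
    by (simp add: mult.commute del: pder.simps)
  have cH': "cc (\<lambda>x. (norm x)\<^sup>2 * pder [i, i] ?K x - 2 * ?K x)" for i
    using cc_add[OF cc_mult[OF test_fun_cc[OF T] N] cc_cmult[OF cK, of "-2"], of "[i, i]"]
    by (simp add: mult.commute del: pder.simps)
  have "(LBINT x. (norm x)\<^sup>2 * pder [i, i] ?K x - 2 * ?K x) = 0" for i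
  proof (rule integral_derivative_eq_0[OF cH cH'])
    show "norm (axis i 1 :: real^'n) = 1" by simp
    fix x
    have K: "((\<lambda>t. pder is ?K (x + t *\<^sub>R axis i 1)) has_real_derivative pder (i # is) ?K x) (at 0)" for "is"
      by (rule smooth_fun_derivative) (use T in \<open>simp add: test_fun_def\<close>)
    have K0: "((\<lambda>t. ?K (x + t *\<^sub>R axis i 1)) has_real_derivative pder [i] ?K x) (at 0)"
      using K[of "[]"] by simp
    have "((\<lambda>t. (norm (x + t *\<^sub>R axis i 1))\<^sup>2 * pder [i] ?K (x + t *\<^sub>R axis i 1) - 2 * ((x + t *\<^sub>R axis i 1) $ i * ?K (x + t *\<^sub>R axis i 1)))
      has_real_derivative (2 * x $ i) * pder [i] ?K (x + 0 *\<^sub>R axis i 1) + pder [i, i] ?K x * (norm (x + 0 *\<^sub>R axis i 1))\<^sup>2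
        - 2 * ((if i = i then 1 else 0) * ?K (x + 0 *\<^sub>R axis i 1) + pder [i] ?K x * (x + 0 *\<^sub>R axis i 1) $ i)) (at 0)"
      by (intro DERIV_diff DERIV_cmult DERIV_mult norm_power2_derivative coord_derivative K K0)
    then show "((\<lambda>t. (norm (x + t *\<^sub>R axis i 1))\<^sup>2 * pder [i] ?K (x + t *\<^sub>R axis i 1) - 2 * ((x + t *\<^sub>R axis i 1) $ i * ?K (x + t *\<^sub>R axis i 1)))
      has_real_derivative (norm x)\<^sup>2 * pder [i, i] ?K x - 2 * ?K x) (at 0)"
      by (rule DERIV_cong) (simp add: mult.commute del: pder.simps)
  qed
  then have "0 = (\<Sum>i\<in>UNIV. LBINT x. (norm x)\<^sup>2 * pder [i, i] ?K x - 2 * ?K x)" by simp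
  also have "\<dots> = (LBINT x. (\<Sum>i\<in>UNIV. (norm x)\<^sup>2 * pder [i, i] ?K x - 2 * ?K x))"
    by (rule Bochner_Integration.integral_sum[symmetric]) (rule cc_integrable[OF cH'])
  also have "\<dots> = (LBINT x. (norm x)\<^sup>2 * laplacian ?K x - 2 * real CARD('n) * ?K x)"
    by (simp add: sum_subtractf laplacian_def sum_distrib_left mult_ac del: pder.simps)
  also have "\<dots> = (LBINT x. 4 * ((norm x)\<^sup>2 * moll a x) - 4 * ((norm x)\<^sup>2 * moll b x) - 2 * real CARD('n) * ?K x)"
    by (simp add: laplacian_kern[OF a] algebra_simps)
  also have "\<dots> = 4 * (LBINT x. (norm x)\<^sup>2 * moll a (x :: real^'n)) - 4 * (LBINT x. (norm x)\<^sup>2 * moll b (x :: real^'n)) - 2 * real CARD('n) * (LBINT x. ?K x)"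
  proof -
    have "integrable lborel (\<lambda>x :: real^'n. (norm x)\<^sup>2 * moll l x)" if "l > 0" for l
      using cc_integrable[OF cc_mult[OF test_fun_cc[OF test_fun_moll[OF that], of "[]"] N]] by (simp add: mult.commute)
    then show ?thesis using cc_integrable[OF cK] a by simp
  qed
  finally have eq: "0 = 4 * (LBINT x. (norm x)\<^sup>2 * moll a (x :: real^'n)) - 4 * (LBINT x. (norm x)\<^sup>2 * moll b (x :: real^'n)) - 2 * real CARD('n) * (LBINT x. ?K x)" .
  \<comment> \<open>The term with \<open>moll b\<close> may be dropped by its sign, which makes the
    bound independent of \<open>b\<close>; on the support of \<open>moll a\<close> the weight is at
    most \<open>1 / a\<close>.\<close>
  have "0 \<le> (LBINT x. (norm x)\<^sup>2 * moll b (x :: real^'n))"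
    by (rule Bochner_Integration.integral_nonneg) (simp add: moll_nonneg)
  with eq have "2 * real CARD('n) * (LBINT x. ?K x) \<le> 4 * (LBINT x. (norm x)\<^sup>2 * moll a (x :: real^'n))"
    by linarith
  also have "(LBINT x. (norm x)\<^sup>2 * moll a (x :: real^'n)) \<le> (LBINT x. 1 / a * moll a (x :: real^'n))"
  proof (rule integral_mono)
    show "integrable lborel (\<lambda>x :: real^'n. (norm x)\<^sup>2 * moll a x)"
      using cc_integrable[OF cc_mult[OF test_fun_cc[OF test_fun_moll[OF a(1)], of "[]"] N]] by (simp add: mult.commute)
    show "integrable lborel (\<lambda>x :: real^'n. 1 / a * moll a x)"
      using cc_integrable[OF test_fun_cc[OF test_fun_moll[OF a(1)], of "[]"]] by (intro integrable_mult_right) simp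
    fix x :: "real^'n"
    show "(norm x)\<^sup>2 * moll a x \<le> 1 / a * moll a x"
    proof (cases "norm x > 1 / sqrt a")
      case False
      then have "(norm x)\<^sup>2 \<le> (1 / sqrt a)\<^sup>2" by (intro power_mono) auto
      then show ?thesis using a moll_nonneg[of a x] by (intro mult_right_mono) (auto simp: power_divide)
    qed (simp add: moll_support[OF a(1)])
  qed
  finally show ?thesis using a by (simp add: field_simps)
qed

lemma integral_moll_pos: "0 < l \<Longrightarrow> 0 < (LBINT x. moll l (x :: real^'n::finite))"
proof -
  assume l: "0 < l"
  have c: "cc (moll l :: real^'n \<Rightarrow> real)" using test_fun_cc[OF test_fun_moll[OF l], of "[]"] by simp
  have p: "moll l (0 :: real^'n) > 0" using l by (simp add: moll_def bump_def gexp_pos)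
  have o: "open {x :: real^'n. moll l x \<noteq> 0}"
    using c by (intro open_Collect_neq) (auto simp: cc_def)
  have i: "integrable lborel (moll l :: real^'n \<Rightarrow> real)" by (rule cc_integrable[OF c])
  have "(LBINT x. moll l (x :: real^'n)) \<noteq> 0"
  proof
    assume "(LBINT x. moll l (x :: real^'n)) = 0"
    then have "AE x in lborel. moll l (x :: real^'n) = 0"
      using integral_nonneg_eq_0_iff_AE[OF i] by (simp add: moll_nonneg)
    then have "AE x in lebesgue. x \<notin> {x :: real^'n. moll l x \<noteq> 0}" by (auto intro: AE_completion)
    then have "negligible {x :: real^'n. moll l x \<noteq> 0}"
      using o by (simp add: negligible_iff_null_sets AE_iff_null_sets)
    then show False using open_not_negligible[OF o] p by (metis (mono_tags) empty_iff less_irrefl mem_Collect_eq)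
  qed
  moreover have "0 \<le> (LBINT x. moll l (x :: real^'n))"
    by (rule Bochner_Integration.integral_nonneg) (simp add: moll_nonneg)
  ultimately show "0 < (LBINT x. moll l (x :: real^'n))" by simp
qed

lemma test_fun_nmoll:
  assumes l: "0 < l"
  shows "test_fun (nmoll l :: real^'n::finite \<Rightarrow> real)"
proof -
  have "nmoll l = (\<lambda>x :: real^'n. (l powr (real CARD('n) / 2) / (LBINT y. moll 1 (y :: real^'n))) * bump 2 l x)"
    by (auto simp: nmoll_def moll_def)
  then have "bump_class (nmoll l :: real^'n \<Rightarrow> real)" by (simp only: bump_class.intros)
  then have "smooth_fun (nmoll l :: real^'n \<Rightarrow> real)" by (rule bump_class_smooth)
  moreover have "\<exists>R. \<forall>x :: real^'n. norm x > R \<longrightarrow> nmoll l x = 0"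
    using moll_support[OF l] unfolding nmoll_def by fastforce
  ultimately show "test_fun (nmoll l :: real^'n \<Rightarrow> real)" by (simp add: test_fun_def)
qed

lemma nmoll_cc: "0 < l \<Longrightarrow> cc (nmoll l)"
  using test_fun_cc[OF test_fun_nmoll, of l "[]"] by simp

lemma nmoll_nonneg: "0 \<le> nmoll l (x :: real^'n::finite)"
  using integral_moll_pos[of 1, where 'n='n] by (simp add: nmoll_def moll_nonneg)

lemma nmoll_support: "0 < l \<Longrightarrow> norm x > 1 / sqrt l \<Longrightarrow> nmoll l x = 0"
  by (simp add: nmoll_def moll_support)

lemma integral_nmoll:
  assumes "1 \<le> l"
  shows "(LBINT x. nmoll l (x :: real^'n::finite)) = 1"
  using integral_moll_const[of 1 l, where 'n='n] integral_moll_pos[of 1, where 'n='n] assms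
  by (simp add: nmoll_def)

section \<open>Weak solutions\<close>

text \<open>The weak form of \<open>- \<Delta> u = f\<close>.\<close>
definition wsol :: "(real^'n::finite \<Rightarrow> real) \<Rightarrow> (real^'n \<Rightarrow> real) \<Rightarrow> bool" where
  "wsol u f \<longleftrightarrow> sqint u \<and> f \<in> borel_measurable borel \<and> (\<forall>R. sqint (\<lambda>x. indicator (cball 0 R) x * f x)) \<and>
    (\<forall>\<phi>. test_fun \<phi> \<longrightarrow> (LBINT x. u x * laplacian \<phi> x) = - (LBINT x. f x * \<phi> x))"

lemma wsol_locint: assumes "wsol u f" shows "locint u" "locint f"
  using assms sqint_locint locint_local_sqint by (auto simp: wsol_def)

text \<open>The equation is tested with the reflected kernel. The first form meets the second
  derivatives of the smooth function \<open>conv u k\<close>; the second serves a kernel whose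
  Laplacian is known explicitly.\<close>

lemma laplacian_conv:
  assumes s: "wsol u f" and k: "test_fun k"
  shows "(\<Sum>i\<in>UNIV. conv u (pder [i, i] k) x) = - conv f k x"
    "conv u (laplacian k) x = - conv f k x"
proof -
  have "(\<Sum>i\<in>UNIV. conv u (pder [i, i] k) x) = (LBINT y. (\<Sum>i\<in>UNIV. u y * pder [i, i] k (x - y)))"
    unfolding conv_def
    by (rule Bochner_Integration.integral_sum[symmetric]) (rule conv_integrable[OF wsol_locint(1)[OF s] test_fun_cc[OF k]])
  also have "\<dots> = conv u (laplacian k) x"
    by (simp add: conv_def laplacian_def sum_distrib_left del: pder.simps)
  finally have eq: "(\<Sum>i\<in>UNIV. conv u (pder [i, i] k) x) = conv u (laplacian k) x" .
  have "(LBINT y. u y * laplacian (\<lambda>y. k (x - y)) y) = - (LBINT y. f y * k (x - y))"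
    using s test_fun_reflect[OF k] by (auto simp: wsol_def)
  then show "conv u (laplacian k) x = - conv f k x"
    by (simp add: conv_def laplacian_reflect[OF k])
  with eq show "(\<Sum>i\<in>UNIV. conv u (pder [i, i] k) x) = - conv f k x" by simp
qed

section \<open>Radial weights in the logarithmic variable\<close>

lemma log_radial_cc:
  fixes h :: "real \<Rightarrow> real"
  assumes h: "continuous_on UNIV h" and t: "0 < t1" and z: "\<And>t. t \<le> t1 \<Longrightarrow> h t = 0" "\<And>t. t \<ge> t2 \<Longrightarrow> h t = 0"
  shows "cc (\<lambda>x :: 'a::euclidean_space. h (ln ((norm x)\<^sup>2)))"
proof -
  let ?H = "\<lambda>x :: 'a. h (ln ((norm x)\<^sup>2))"
  have "isCont ?H x" for x
  proof (cases "x = 0")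
    case True
    have "eventually (\<lambda>y. y \<in> ball (0::'a) 1) (nhds 0)" by (intro eventually_nhds_in_open) auto
    then have "eventually (\<lambda>y. ?H y = 0) (nhds 0)"
    proof eventually_elim
      case (elim y)
      then have "(norm y)\<^sup>2 \<le> 1" using power_le_one[of "norm y" 2] by simp
      \<comment> \<open>At \<open>y = 0\<close> the default value \<open>ln 0 = 0\<close> also lies
        below \<open>t1\<close>, so the origin needs no separate convention.\<close>
      then have "ln ((norm y)\<^sup>2) \<le> t1" using t by (cases "y = 0") (auto intro: order_trans[of _ 0])
      then show ?case by (rule z)
    qed
    then show ?thesis unfolding True by (subst isCont_cong[where g="\<lambda>_. 0"]) auto
  next
    case False
    have "isCont (\<lambda>x :: 'a. ln ((norm x)\<^sup>2)) x" using False by (intro continuous_intros) auto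
    moreover have "isCont h (ln ((norm x)\<^sup>2))" using h by (simp add: continuous_on_eq_continuous_at)
    ultimately show ?thesis by (rule isCont_o2)
  qed
  moreover have "?H x = 0" if "norm x > exp (\<bar>t2\<bar>)" for x
  proof -
    have n: "norm x > 1" using that one_le_exp_iff[of "\<bar>t2\<bar>"] by linarith
    have "0 < norm x" using n by linarith
    from ln_less_cancel_iff[THEN iffD2, OF exp_gt_zero this that] have "\<bar>t2\<bar> < ln (norm x)" by (simp only: ln_exp)
    then have "t2 \<le> ln ((norm x)\<^sup>2)" using n by (simp add: ln_realpow)
    then show ?thesis by (rule z)
  qed
  ultimately show ?thesis unfolding cc_def by (auto intro: continuous_at_imp_continuous_on)
qed

text \<open>The factor 1 / |x|^2 is written as an exponential of the logarithm, so that the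
  derivative is again a coordinate times a function of ln |x|^2, to which
  \<open>log_radial_cc\<close> applies.\<close>

lemma log_radial_derivative:
  fixes y y' :: "real \<Rightarrow> real" and x :: "real^'n::finite"
  assumes D: "\<And>t. (y has_real_derivative y' t) (at t)" and t: "0 < t1" and z: "\<And>t. t \<le> t1 \<Longrightarrow> y t = 0" "\<And>t. t \<le> t1 \<Longrightarrow> y' t = 0"
  shows "((\<lambda>s. y (ln ((norm (x + s *\<^sub>R axis i 1))\<^sup>2))) has_real_derivative
    2 * x $ i * (y' (ln ((norm x)\<^sup>2)) * exp (- ln ((norm x)\<^sup>2)))) (at 0)"
proof (cases "x = 0")
  case True
  have "eventually (\<lambda>s. s \<in> {-1<..<1}) (nhds (0::real))" by (intro eventually_nhds_in_open) auto
  then have "eventually (\<lambda>s. y (ln ((norm (x + s *\<^sub>R axis i 1))\<^sup>2)) = 0) (nhds 0)"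
  proof eventually_elim
    case (elim s)
    then have "\<bar>s\<bar>\<^sup>2 \<le> 1" using power_le_one[of "\<bar>s\<bar>" 2] by auto
    then have "ln (\<bar>s\<bar>\<^sup>2) \<le> t1" using t by (cases "s = 0") (auto intro: order_trans[of _ 0])
    then show ?case using True z by simp
  qed
  then show ?thesis using True by (subst DERIV_cong_ev[OF refl _ refl, where g="\<lambda>_. 0"]) auto
next
  case False
  have p: "(norm (x + 0 *\<^sub>R axis i 1))\<^sup>2 > 0" using False by simp
  have "((\<lambda>s. ln ((norm (x + s *\<^sub>R axis i 1))\<^sup>2)) has_real_derivative 1 / (norm (x + 0 *\<^sub>R axis i 1))\<^sup>2 * (2 * x $ i)) (at 0)"
    using DERIV_chain2[OF DERIV_ln_divide[OF p] norm_power2_derivative] by simp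
  from DERIV_chain2[OF D this] show ?thesis
    by (rule DERIV_cong) (use False in \<open>simp add: exp_minus field_simps\<close>)
qed

lemma sum_coord_power2: "(\<Sum>i\<in>UNIV. (x $ i)\<^sup>2) = (norm (x :: real^'n::finite))\<^sup>2"
  by (simp add: norm_vec_def L2_set_def sum_nonneg)

text \<open>The divergence theorem is applied to Y^2 (|x|^2 w grad w + b w^2 x) with the smooth w =
  \<open>conv u k\<close>. The first part of this field comes from testing the equation with |x|^2
  Y^2 w, the second is Hardy's. Pointwise, its divergence plus the right-hand integrand exceeds the
  left-hand one by a square that absorbs |grad w|^2, so no gradient survives in the result.\<close>

lemma weighted_inequality_conv:
  fixes u f :: "real^'n::finite \<Rightarrow> real"
  assumes s: "wsol u f" and k: "test_fun k"
    and D: "\<And>t. (y has_real_derivative y' t) (at t)" and c: "continuous_on UNIV y'"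
    and t: "0 < t1" and z: "\<And>t. t \<le> t1 \<Longrightarrow> y t = 0" "\<And>t. t \<le> t1 \<Longrightarrow> y' t = 0"
      "\<And>t. t \<ge> t2 \<Longrightarrow> y t = 0" "\<And>t. t \<ge> t2 \<Longrightarrow> y' t = 0"
  defines "Y \<equiv> \<lambda>x :: real^'n. y (ln ((norm x)\<^sup>2))" and "Y' \<equiv> \<lambda>x :: real^'n. y' (ln ((norm x)\<^sup>2))"
    and "d \<equiv> real CARD('n)"
  shows "(LBINT x. (conv u k x)\<^sup>2 * (d * (d - 4) / 4 * (Y x)\<^sup>2 - 4 * Y x * Y' x - 4 * (Y' x)\<^sup>2))
    \<le> (LBINT x. (norm x)\<^sup>2 * (Y x)\<^sup>2 * conv u k x * conv f k x)"
proof -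
  define Z where "Z x = Y' x * exp (- ln ((norm x)\<^sup>2))" for x
  define w where "w = conv u k"
  define w1 where "w1 i = conv u (pder [i] k)" for i
  define w2 where "w2 i = conv u (pder [i, i] k)" for i
  define b where "b = (d - 2) / 2"
  have u: "locint u" by (rule wsol_locint(1)[OF s])
  have sm: "smooth_fun k" using k by (simp add: test_fun_def)
  have Dw: "((\<lambda>t. w (x + t *\<^sub>R axis i 1)) has_real_derivative w1 i x) (at 0)" for x i
    unfolding w_def w1_def using test_fun_cc[OF k, of "[]"]
    by (intro conv_derivative[OF u _ test_fun_cc[OF k]]) (use smooth_fun_derivative[OF sm, of "[]"] in \<open>auto simp del: pder.simps(2)\<close>)
  have Dw1: "((\<lambda>t. w1 i (x + t *\<^sub>R axis i 1)) has_real_derivative w2 i x) (at 0)" for x i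
    unfolding w1_def w2_def
    by (intro conv_derivative[OF u test_fun_cc[OF k] test_fun_cc[OF k]]) (use smooth_fun_derivative[OF sm, of "[i]"] in \<open>auto simp del: pder.simps(2)\<close>)
  have cw: "continuous_on UNIV w" "continuous_on UNIV (w1 i)" "continuous_on UNIV (w2 i)" for i
    unfolding w_def w1_def w2_def using conv_continuous[OF u test_fun_cc[OF k]] conv_continuous[OF u test_fun_cc[OF k, of "[]"]]
    by (auto simp del: pder.simps(2))
  have lap: "(\<Sum>i\<in>UNIV. w2 i x) = - conv f k x" for x
    unfolding w2_def by (rule laplacian_conv(1)[OF s k])
  have cy: "continuous_on UNIV y" by (intro continuous_at_imp_continuous_on ballI DERIV_isCont[OF D])
  have cY: "cc Y" "cc Y'" "cc Z"
    unfolding Y_def Y'_def Z_def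
    by (rule log_radial_cc[OF _ t, of _ t2]; use z cy c in \<open>auto intro!: continuous_intros\<close>)+
  have cYc: "continuous_on UNIV Y" "continuous_on UNIV Y'" "continuous_on UNIV Z" using cY by (auto simp: cc_def)
  \<comment> \<open>At the origin both sides vanish, since \<open>ln 0 = 0\<close> lies below
    \<open>t1\<close>.\<close>
  have sZ: "(norm x)\<^sup>2 * Z x = Y' x" for x
    using z(2)[of 0] t by (cases "x = 0") (auto simp: Z_def Y'_def exp_minus)
  have DY: "((\<lambda>t. Y (x + t *\<^sub>R axis i 1)) has_real_derivative 2 * x $ i * Z x) (at 0)" for x i
    unfolding Y_def Z_def Y'_def by (rule log_radial_derivative[OF D t z(1,2)])
  \<comment> \<open>One factor \<open>Y x\<close> is kept in front so that \<open>cc_mult\<close>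
    yields compact support.\<close>
  define H where "H i x = Y x * (Y x * ((norm x)\<^sup>2 * (w x * w1 i x) + b * (x $ i * (w x * w x))))" for i x
  define H' where "H' i x = Y x * (2 * x $ i * Y x * w x * w1 i x + 4 * x $ i * Z x * (norm x)\<^sup>2 * w x * w1 i x
      + (norm x)\<^sup>2 * Y x * (w1 i x)\<^sup>2 + (norm x)\<^sup>2 * Y x * w x * w2 i x
      + b * (Y x * (w x)\<^sup>2 + 4 * (x $ i)\<^sup>2 * Z x * (w x)\<^sup>2 + 2 * x $ i * Y x * w x * w1 i x))" for i x
  have cc: "cc (H i)" "cc (H' i)" for i
    unfolding H_def[abs_def] H'_def[abs_def] by (intro cc_mult[OF cY(1)] continuous_intros cw cYc)+
  have DH: "((\<lambda>t. H i (x + t *\<^sub>R axis i 1)) has_real_derivative H' i x) (at 0)" for i x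
    unfolding H_def
    by (rule DERIV_cong[OF DERIV_mult[OF DY DERIV_mult[OF DY DERIV_add[OF DERIV_mult[OF norm_power2_derivative DERIV_mult[OF Dw Dw1]]
        DERIV_cmult[OF DERIV_mult[OF coord_derivative DERIV_mult[OF Dw Dw]]]]]]])
      (simp add: H'_def power2_eq_square algebra_simps)
  have I0: "(LBINT x. H' i x) = 0" for i
    by (rule integral_derivative_eq_0[OF cc(1,2) _ DH]) simp
  define F where "F x = (\<Sum>i\<in>UNIV. H' i x)" for x
  have iF: "integrable lborel F" unfolding F_def[abs_def] by (intro Bochner_Integration.integrable_sum cc_integrable cc)
  have F0: "(LBINT x. F x) = 0"
    unfolding F_def by (subst Bochner_Integration.integral_sum) (auto intro: cc_integrable cc simp: I0)
  let ?A = "\<lambda>x. (w x)\<^sup>2 * (d * (d - 4) / 4 * (Y x)\<^sup>2 - 4 * Y x * Y' x - 4 * (Y' x)\<^sup>2)"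
  let ?B = "\<lambda>x. (norm x)\<^sup>2 * (Y x)\<^sup>2 * w x * conv f k x"
  have pw: "?A x \<le> F x + ?B x" for x
  proof -
    define e where "e = (\<Sum>i\<in>UNIV. x $ i * w1 i x)"
    define g where "g = (\<Sum>i\<in>UNIV. (w1 i x)\<^sup>2)"
    define C where "C = d / 2 * Y x + 2 * Y' x"
    have "F x = (\<Sum>i\<in>UNIV. (2 * (Y x)\<^sup>2 * w x + 4 * Z x * (norm x)\<^sup>2 * Y x * w x + 2 * b * (Y x)\<^sup>2 * w x) * (x $ i * w1 i x)
      + (norm x)\<^sup>2 * (Y x)\<^sup>2 * (w1 i x)\<^sup>2 + (norm x)\<^sup>2 * (Y x)\<^sup>2 * w x * w2 i x
      + b * (Y x)\<^sup>2 * (w x)\<^sup>2 + b * 4 * Z x * Y x * (w x)\<^sup>2 * (x $ i)\<^sup>2)"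
      unfolding F_def H'_def by (rule sum.cong) (auto simp: power2_eq_square algebra_simps)
    also have "\<dots> = (2 * (Y x)\<^sup>2 * w x + 4 * Z x * (norm x)\<^sup>2 * Y x * w x + 2 * b * (Y x)\<^sup>2 * w x) * e
      + (norm x)\<^sup>2 * (Y x)\<^sup>2 * g - ?B x + d * (b * (Y x)\<^sup>2 * (w x)\<^sup>2) + b * 4 * Z x * Y x * (w x)\<^sup>2 * (norm x)\<^sup>2"
      unfolding sum.distrib sum_distrib_left[symmetric] sum_coord_power2 lap by (simp add: e_def g_def d_def)
    also have "\<dots> = 2 * Y x * w x * e * C + (norm x)\<^sup>2 * (Y x)\<^sup>2 * g - ?B x + b * (d * (Y x)\<^sup>2 + 4 * Y' x * Y x) * (w x)\<^sup>2"
      unfolding sZ[of x, symmetric] C_def b_def by (simp add: power2_eq_square field_simps)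
    finally have Feq: "F x + ?B x = 2 * Y x * w x * e * C + (norm x)\<^sup>2 * (Y x)\<^sup>2 * g + b * (d * (Y x)\<^sup>2 + 4 * Y' x * Y x) * (w x)\<^sup>2"
      by simp
    \<comment> \<open>The square combines the IMS localisation of the weight \<open>|x| Y\<close> with Hardy's inequality, whose virtual
      ground state \<open>|x| powr (- (d - 2) / 2)\<close> is the source of \<open>b\<close> and \<open>C\<close>.\<close>
    have sq: "0 \<le> (norm x)\<^sup>2 * (Y x)\<^sup>2 * g + 2 * Y x * w x * e * C + (w x)\<^sup>2 * C\<^sup>2"
    proof (cases "x = 0")
      case False
      \<comment> \<open>An additional factor |x|^2 avoids division by |x|; it is cancelled at the
        end, hence the separate case of the origin.\<close>
      have "0 \<le> (\<Sum>i\<in>UNIV. ((norm x)\<^sup>2 * Y x * w1 i x + w x * x $ i * C)\<^sup>2)" by (intro sum_nonneg) simp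
      also have "\<dots> = (\<Sum>i\<in>UNIV. (norm x)\<^sup>2 * ((norm x)\<^sup>2 * (Y x)\<^sup>2) * (w1 i x)\<^sup>2 + (norm x)\<^sup>2 * (2 * Y x * w x * C) * (x $ i * w1 i x) + (w x)\<^sup>2 * C\<^sup>2 * (x $ i)\<^sup>2)"
        by (rule sum.cong) (auto simp: power2_eq_square algebra_simps)
      also have "\<dots> = (norm x)\<^sup>2 * ((norm x)\<^sup>2 * (Y x)\<^sup>2 * g + 2 * Y x * w x * e * C + (w x)\<^sup>2 * C\<^sup>2)"
        unfolding sum.distrib sum_distrib_left[symmetric] sum_coord_power2 by (simp add: e_def g_def algebra_simps)
      finally show ?thesis using False by (simp add: zero_le_mult_iff)
    next
      case True
      then have "Y x = 0" "Y' x = 0" using z t by (auto simp: Y_def Y'_def)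
      then show ?thesis by (simp add: C_def)
    qed
    \<comment> \<open>What remains of the zeroth-order terms after \<open>C\<^sup>2\<close> is
      subtracted: the coefficient of \<open>(Y x)\<^sup>2\<close> is d (d - 2) / 2 - d^2 / 4 = d (d
      - 4) / 4.\<close>
    have "?A x = b * (d * (Y x)\<^sup>2 + 4 * Y' x * Y x) * (w x)\<^sup>2 - (w x)\<^sup>2 * C\<^sup>2"
      unfolding C_def b_def by (simp add: power2_eq_square field_simps)
    then show ?thesis using Feq sq by linarith
  qed
  have iA: "integrable lborel ?A"
  proof -
    have "?A = (\<lambda>x. Y x * ((w x)\<^sup>2 * (d * (d - 4) / 4 * Y x - 4 * Y' x)) + Y' x * (- 4 * (w x)\<^sup>2 * Y' x))"
      by (auto simp: power2_eq_square algebra_simps)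
    moreover have "cc \<dots>" by (intro cc_add cc_mult[OF cY(1)] cc_mult[OF cY(2)] continuous_intros cw cYc)
    ultimately have "cc ?A" by (simp only:)
    then show ?thesis by (rule cc_integrable)
  qed
  have iB: "integrable lborel ?B"
  proof -
    have cf: "continuous_on UNIV (conv f k)"
      using conv_continuous[OF wsol_locint(2)[OF s]] test_fun_cc[OF k, of "[]"] by simp
    have "?B = (\<lambda>x. Y x * ((norm x)\<^sup>2 * Y x * w x * conv f k x))"
      by (auto simp: power2_eq_square algebra_simps)
    moreover have "cc \<dots>" by (intro cc_mult[OF cY(1)] continuous_intros cw cYc cf)
    ultimately have "cc ?B" by (simp only:)
    then show ?thesis by (rule cc_integrable)
  qed
  have "(LBINT x. ?A x) \<le> (LBINT x. F x + ?B x)"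
    by (rule integral_mono[OF iA _ pw]) (use iF iB in simp)
  also have "\<dots> = (LBINT x. ?B x)" using iF iB F0 by simp
  finally show ?thesis by (simp add: w_def)
qed

lemma conv_nmoll_tendsto:
  assumes v: "sqint (v :: real^'n::finite \<Rightarrow> real)"
  shows "(\<lambda>n. nsq (\<lambda>x. conv v (nmoll (real (Suc n))) x - v x)) \<longlonglongrightarrow> 0"
proof (rule conv_approx_identity[OF v])
  show "(\<lambda>n. 1 / sqrt (real (Suc n))) \<longlonglongrightarrow> 0"
    by (rule real_tendsto_divide_at_top[OF tendsto_const])
      (intro filterlim_compose[OF sqrt_at_top] filterlim_compose[OF filterlim_real_sequentially filterlim_Suc])
  show "cc (nmoll (real (Suc n)) :: real^'n \<Rightarrow> real)" for n by (rule nmoll_cc) simp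
  show "0 \<le> nmoll (real (Suc n)) (x :: real^'n)" for n x by (rule nmoll_nonneg)
  show "(LBINT x. nmoll (real (Suc n)) (x :: real^'n)) = 1" for n by (rule integral_nmoll) simp
  show "norm (x :: real^'n) > 1 / sqrt (real (Suc n)) \<Longrightarrow> nmoll (real (Suc n)) x = 0" for n x
    by (rule nmoll_support) simp
qed

text \<open>Since f is controlled only on balls, Young's inequality cannot be applied to it
  directly. A kernel supported in the unit ball sees only the values of f within distance 1, so f
  may be cut off first.\<close>

lemma conv_localize:
  assumes k: "\<And>z. norm z > 1 \<Longrightarrow> k z = 0" and x: "norm x \<le> R"
  shows "conv f k x = conv (\<lambda>y. indicator (cball 0 (R + 1)) y * f y) k x"
  unfolding conv_def
proof (rule Bochner_Integration.integral_cong)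
  fix y :: 'a
  show "f y * k (x - y) = indicator (cball 0 (R + 1)) y * f y * k (x - y)"
  proof (cases "y \<in> cball 0 (R + 1)")
    case False
    then have "norm (x - y) > 1" using x norm_triangle_sub[of y x] by (simp add: norm_minus_commute)
    then show ?thesis using k by simp
  qed simp
qed simp

lemma nmoll_support_1:
  assumes "1 \<le> l" "norm z > 1"
  shows "nmoll l z = 0"
proof (rule nmoll_support)
  show "0 < l" using assms by simp
  have "1 \<le> sqrt l" using assms by simp
  then have "1 / sqrt l \<le> 1" by simp
  then show "1 / sqrt l < norm z" using assms by linarith
qed

text \<open>The mollified inequality contains no gradient, so L^2 convergence of the mollifications
  suffices for the limit. The weight has compact support, and f is replaced by its restriction
  \<open>g\<close> to a ball of radius larger by 1, which makes no difference after
  mollification.\<close>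

lemma weighted_inequality:
  fixes u f :: "real^'n::finite \<Rightarrow> real"
  assumes s: "wsol u f"
    and D: "\<And>t. (y has_real_derivative y' t) (at t)" and c: "continuous_on UNIV y'"
    and t: "0 < t1" and z: "\<And>t. t \<le> t1 \<Longrightarrow> y t = 0" "\<And>t. t \<le> t1 \<Longrightarrow> y' t = 0"
      "\<And>t. t \<ge> t2 \<Longrightarrow> y t = 0" "\<And>t. t \<ge> t2 \<Longrightarrow> y' t = 0"
  defines "Y \<equiv> \<lambda>x :: real^'n. y (ln ((norm x)\<^sup>2))" and "Y' \<equiv> \<lambda>x :: real^'n. y' (ln ((norm x)\<^sup>2))"
    and "d \<equiv> real CARD('n)"
  shows "integrable lborel (\<lambda>x. (u x)\<^sup>2 * (d * (d - 4) / 4 * (Y x)\<^sup>2 - 4 * Y x * Y' x - 4 * (Y' x)\<^sup>2))"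
    "integrable lborel (\<lambda>x. (norm x)\<^sup>2 * (Y x)\<^sup>2 * u x * f x)"
    "(LBINT x. (u x)\<^sup>2 * (d * (d - 4) / 4 * (Y x)\<^sup>2 - 4 * Y x * Y' x - 4 * (Y' x)\<^sup>2))
    \<le> (LBINT x. (norm x)\<^sup>2 * (Y x)\<^sup>2 * u x * f x)"
proof -
  have u: "sqint u" using s by (simp add: wsol_def)
  have cy: "continuous_on UNIV y" by (intro continuous_at_imp_continuous_on ballI DERIV_isCont[OF D])
  have cY: "cc Y" "cc Y'"
    unfolding Y_def Y'_def
    by (rule log_radial_cc[OF _ t, of _ t2]; use z cy c in auto)+
  have cYc: "continuous_on UNIV Y" "continuous_on UNIV Y'" using cY by (auto simp: cc_def)
  define A where "A x = d * (d - 4) / 4 * (Y x)\<^sup>2 - 4 * Y x * Y' x - 4 * (Y' x)\<^sup>2" for x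
  define B where "B x = (norm x)\<^sup>2 * (Y x)\<^sup>2" for x
  have cA: "cc A"
  proof -
    have "A = (\<lambda>x. Y x * (d * (d - 4) / 4 * Y x - 4 * Y' x) + Y' x * (- 4 * Y' x))"
      by (auto simp: A_def power2_eq_square algebra_simps)
    moreover have "cc \<dots>" by (intro cc_add cc_mult[OF cY(1)] cc_mult[OF cY(2)] continuous_intros cYc)
    ultimately show ?thesis by (simp only:)
  qed
  have cB: "cc B"
  proof -
    have "B = (\<lambda>x. Y x * ((norm x)\<^sup>2 * Y x))"
      by (auto simp: B_def power2_eq_square algebra_simps)
    moreover have "cc \<dots>" by (intro cc_mult[OF cY(1)] continuous_intros cYc)
    ultimately show ?thesis by (simp only:)
  qed
  obtain MA where MA: "\<And>x. \<bar>A x\<bar> \<le> MA" using cc_bounded[OF cA] by blast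
  obtain MB where MB: "\<And>x. \<bar>B x\<bar> \<le> MB" using cc_bounded[OF cB] by blast
  obtain R where R: "\<And>x. norm x > R \<Longrightarrow> B x = 0" using cB by (auto simp: cc_def)
  define g where "g y = indicator (cball 0 (R + 1)) y * f y" for y
  have g: "sqint g" using s by (simp add: wsol_def g_def[abs_def])
  define k where "k n = (nmoll (real (Suc n)) :: real^'n \<Rightarrow> real)" for n
  have k: "test_fun (k n)" "cc (k n)" for n unfolding k_def by (auto intro: test_fun_nmoll nmoll_cc)
  have Bf: "B x * f x = B x * g x" for x using R[of x] by (cases "norm x > R") (auto simp: g_def)
  have Bconv: "B x * conv f (k n) x = B x * conv g (k n) x" for x n
  proof (cases "norm x > R")
    case False
    have "conv f (k n) x = conv g (k n) x"
      unfolding g_def[abs_def] by (rule conv_localize) (use False in \<open>auto simp: k_def nmoll_support_1\<close>)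
    then show ?thesis by simp
  qed (simp add: R)
  note mA = cc_measurable[OF cA] and mB = cc_measurable[OF cB]
  have wn: "sqint (conv u (k n))" "sqint (conv g (k n))" for n
    by (intro Young_sqint(1) u g k)+
  have lim: "(\<lambda>n. nsq (\<lambda>x. M x * conv v (k n) x - M x * v x)) \<longlonglongrightarrow> 0"
    if M: "M \<in> borel_measurable borel" "\<And>x. \<bar>M x\<bar> \<le> C" and v: "sqint v" for M v C
  proof (rule tendsto_sandwich[where f="\<lambda>_. 0"])
    show "eventually (\<lambda>n. nsq (\<lambda>x. M x * conv v (k n) x - M x * v x) \<le> C\<^sup>2 * nsq (\<lambda>x. conv v (k n) x - v x)) sequentially"
      using sqint_mult_bounded(2)[OF sqint_diff[OF Young_sqint(1)[OF v k(2)] v] M] by (simp add: right_diff_distrib)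
    show "(\<lambda>n. C\<^sup>2 * nsq (\<lambda>x. conv v (k n) x - v x)) \<longlonglongrightarrow> 0"
      unfolding k_def using tendsto_mult_left[OF conv_nmoll_tendsto[OF v], of "C\<^sup>2"] by simp
  qed (auto simp: nsq_nonneg)
  have Au: "sqint (\<lambda>x. A x * u x)" and Bg: "sqint (\<lambda>x. B x * g x)"
    using sqint_mult_bounded(1)[OF u mA MA] sqint_mult_bounded(1)[OF g mB MB] by auto
  have L1: "(\<lambda>n. LBINT x. conv u (k n) x * (A x * conv u (k n) x)) \<longlonglongrightarrow> (LBINT x. u x * (A x * u x))"
    by (rule tendsto_integral_mult[OF _ _ u Au _ lim[OF mA MA u]])
      (use wn sqint_mult_bounded(1)[OF wn(1) mA MA] conv_nmoll_tendsto[OF u] in \<open>auto simp: k_def\<close>)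
  have L2: "(\<lambda>n. LBINT x. conv u (k n) x * (B x * conv g (k n) x)) \<longlonglongrightarrow> (LBINT x. u x * (B x * g x))"
    by (rule tendsto_integral_mult[OF _ _ u Bg _ lim[OF mB MB g]])
      (use wn sqint_mult_bounded(1)[OF wn(2) mB MB] conv_nmoll_tendsto[OF u] in \<open>auto simp: k_def\<close>)
  have le: "(LBINT x. conv u (k n) x * (A x * conv u (k n) x)) \<le> (LBINT x. conv u (k n) x * (B x * conv g (k n) x))" for n
  proof -
    have "(LBINT x. (conv u (k n) x)\<^sup>2 * A x) \<le> (LBINT x. B x * conv u (k n) x * conv f (k n) x)"
      unfolding A_def B_def Y_def Y'_def d_def
      by (rule weighted_inequality_conv[OF s k(1) D c t z])
    also have "(\<lambda>x. B x * conv u (k n) x * conv f (k n) x) = (\<lambda>x. conv u (k n) x * (B x * conv g (k n) x))"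
      by (auto simp: mult_ac simp flip: Bconv)
    finally show ?thesis by (simp add: power2_eq_square mult_ac)
  qed
  have fin: "(LBINT x. u x * (A x * u x)) \<le> (LBINT x. u x * (B x * g x))"
    by (rule LIMSEQ_le[OF L1 L2]) (use le in auto)
  have e1: "(\<lambda>x. u x * (A x * u x)) = (\<lambda>x. (u x)\<^sup>2 * (d * (d - 4) / 4 * (Y x)\<^sup>2 - 4 * Y x * Y' x - 4 * (Y' x)\<^sup>2))"
    by (auto simp: A_def power2_eq_square mult_ac)
  have e2: "(\<lambda>x. u x * (B x * g x)) = (\<lambda>x. (norm x)\<^sup>2 * (Y x)\<^sup>2 * u x * f x)"
    unfolding Bf[symmetric] by (auto simp: B_def mult_ac)
  show "integrable lborel (\<lambda>x. (u x)\<^sup>2 * (d * (d - 4) / 4 * (Y x)\<^sup>2 - 4 * Y x * Y' x - 4 * (Y' x)\<^sup>2))"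
    using sqint_mult_integrable[OF u Au] unfolding e1 .
  show "integrable lborel (\<lambda>x. (norm x)\<^sup>2 * (Y x)\<^sup>2 * u x * f x)"
    using sqint_mult_integrable[OF u Bg] unfolding e2 .
  show "(LBINT x. (u x)\<^sup>2 * (d * (d - 4) / 4 * (Y x)\<^sup>2 - 4 * Y x * Y' x - 4 * (Y' x)\<^sup>2))
    \<le> (LBINT x. (norm x)\<^sup>2 * (Y x)\<^sup>2 * u x * f x)"
    using fin unfolding e1 e2 .
qed

section \<open>Distance of a weak solution from its mollifications\<close>

text \<open>For b \<ge> \<mu> the mollifications of u at scales b and \<mu> differ, by the equation,
  by the convolution of f with \<open>kern \<mu> b / (4 M)\<close>, whose L^1 norm is at most 1 / (2
  \<mu>) whatever b is. Letting b tend to infinity compares u itself with its mollification.\<close>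

lemma mollification_error:
  fixes u f :: "real^'n::finite \<Rightarrow> real"
  assumes s: "wsol u f" and m: "1 \<le> \<mu>"
  shows "nsq (\<lambda>x. indicator (cball 0 R) x * (u x - conv u (nmoll \<mu>) x))
    \<le> 2 / \<mu>\<^sup>2 * nsq (\<lambda>x. indicator (cball 0 (R + 1)) x * f x)"
proof -
  define M where "M = (LBINT y. moll 1 (y :: real^'n))"
  have M: "M > 0" unfolding M_def by (rule integral_moll_pos) simp
  define g where "g y = indicator (cball 0 (R + 1)) y * f y" for y
  have g: "sqint g" using s by (simp add: wsol_def g_def[abs_def])
  have u: "sqint u" using s by (simp add: wsol_def)
  have lu: "locint u" by (rule sqint_locint[OF u])
  have m0: "0 < \<mu>" using m by simp
  have bd: "nsq (\<lambda>x. indicator (cball 0 R) x * (conv u (nmoll b) x - conv u (nmoll \<mu>) x)) \<le> 1 / \<mu>\<^sup>2 * nsq g" if b: "\<mu> \<le> b" for b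
  proof -
    let ?K = "kern \<mu> b :: real^'n \<Rightarrow> real"
    have T: "test_fun ?K" by (rule test_fun_kern[OF m0])
    have cK: "cc ?K" using test_fun_cc[OF T, of "[]"] by simp
    have lap: "laplacian ?K z = - 4 * M * (nmoll b z - nmoll \<mu> z)" for z
      using M by (simp add: laplacian_kern[OF m0 b] nmoll_def M_def[symmetric] field_simps)
    have sup: "norm z > 1 \<Longrightarrow> ?K z = 0" for z
    proof (rule kern_support[OF m0])
      assume "norm z > 1"
      moreover have "1 / sqrt \<mu> \<le> 1" using m by simp
      ultimately show "1 / sqrt \<mu> < norm z" by linarith
    qed
    have eq: "conv u (nmoll b) x - conv u (nmoll \<mu>) x = 1 / (4 * M) * conv f ?K x" for x
    proof -
      have i: "integrable lborel (\<lambda>y. u y * nmoll b (x - y))" "integrable lborel (\<lambda>y. u y * nmoll \<mu> (x - y))"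
        using conv_integrable[OF lu nmoll_cc] m0 b by auto
      have "- conv f ?K x = (LBINT y. u y * (- 4 * M * (nmoll b (x - y) - nmoll \<mu> (x - y))))"
        using laplacian_conv(2)[OF s T, of x] unfolding conv_def lap by simp
      also have "\<dots> = (LBINT y. - 4 * M * (u y * nmoll b (x - y) - u y * nmoll \<mu> (x - y)))"
        by (rule Bochner_Integration.integral_cong) (auto simp: algebra_simps)
      also have "\<dots> = - 4 * M * (conv u (nmoll b) x - conv u (nmoll \<mu>) x)"
        using i by (simp add: conv_def)
      finally show ?thesis using M by (simp add: field_simps)
    qed
    have L: "0 \<le> (LBINT x. ?K x)" by (rule Bochner_Integration.integral_nonneg) (rule kern_nonneg)
    have L2: "(LBINT x. ?K x) \<le> 2 / \<mu> * M"
    proof -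
      have "(LBINT x. ?K x) \<le> 2 / (real CARD('n) * \<mu>) * M"
        using integral_kern_le[OF m0 b, where 'n='n] integral_moll_const[OF _ m, where 'n='n] by (simp add: M_def)
      also have "\<dots> \<le> 2 / \<mu> * M"
      proof (intro mult_right_mono divide_left_mono)
        have "1 \<le> real CARD('n)" by (simp add: Suc_leI)
        then show "\<mu> \<le> real CARD('n) * \<mu>" using m0 by simp
      qed (use m0 M in auto)
      finally show ?thesis .
    qed
    have sg: "sqint (\<lambda>x. 1 / (4 * M) * conv g ?K x)" by (intro sqint_cmult Young_sqint(1) g cK)
    have "nsq (\<lambda>x. indicator (cball 0 R) x * (conv u (nmoll b) x - conv u (nmoll \<mu>) x))
        = nsq (\<lambda>x. indicator (cball 0 R) x * (1 / (4 * M) * conv g ?K x))"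
    proof (rule arg_cong[where f=nsq], rule ext)
      fix x
      show "indicator (cball 0 R) x * (conv u (nmoll b) x - conv u (nmoll \<mu>) x) = indicator (cball 0 R) x * (1 / (4 * M) * conv g ?K x)"
      proof (cases "x \<in> cball 0 R")
        case True
        then have "conv f ?K x = conv g ?K x"
          unfolding g_def[abs_def] using conv_localize[of ?K x R f] sup by simp
        then show ?thesis by (simp add: eq)
      qed simp
    qed
    also have "\<dots> \<le> 1\<^sup>2 * nsq (\<lambda>x. 1 / (4 * M) * conv g ?K x)"
      by (rule sqint_mult_bounded(2)[OF sg]) (auto simp: indicator_def)
    also have "\<dots> = (1 / (4 * M))\<^sup>2 * nsq (conv g ?K)" by (simp only: nsq_cmult power_one mult_1)
    also have "\<dots> \<le> (1 / (4 * M))\<^sup>2 * ((LBINT x. \<bar>?K x\<bar>)\<^sup>2 * nsq g)"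
      by (intro mult_left_mono Young_sqint(2) g cK) simp
    also have "(LBINT x. \<bar>?K x\<bar>) = (LBINT x. ?K x)" by (simp add: kern_nonneg)
    also have "(1 / (4 * M))\<^sup>2 * ((LBINT x. ?K x)\<^sup>2 * nsq g) \<le> (1 / (4 * M))\<^sup>2 * ((2 / \<mu> * M)\<^sup>2 * nsq g)"
      using L L2 by (intro mult_left_mono mult_right_mono power_mono) (auto simp: nsq_nonneg)
    also have "\<dots> = 1 / 4 * (1 / \<mu>\<^sup>2 * nsq g)" using M m0 by (simp add: power2_eq_square field_simps)
    also have "\<dots> \<le> 1 / \<mu>\<^sup>2 * nsq g" using nsq_nonneg[of g] m0 by (simp add: field_simps)
    finally show ?thesis .
  qed
  let ?I = "indicator (cball 0 R) :: real^'n \<Rightarrow> real"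
  have su: "sqint (conv u (nmoll l))" if "l > 0" for l by (intro Young_sqint(1) u nmoll_cc that)
  have step: "nsq (\<lambda>x. ?I x * (u x - conv u (nmoll \<mu>) x)) \<le> 2 * nsq (\<lambda>x. conv u (nmoll (real (Suc n))) x - u x) + 2 * (1 / \<mu>\<^sup>2 * nsq g)"
    if n: "\<mu> \<le> real (Suc n)" for n
  proof -
    let ?w = "conv u (nmoll (real (Suc n)))" and ?v = "conv u (nmoll \<mu>)"
    have w: "sqint ?w" "sqint ?v" using su m0 by auto
    have "nsq (\<lambda>x. ?I x * (u x - ?v x)) = nsq (\<lambda>x. ?I x * (u x - ?w x) + ?I x * (?w x - ?v x))"
      by (simp add: algebra_simps)
    also have "\<dots> \<le> 2 * nsq (\<lambda>x. ?I x * (u x - ?w x)) + 2 * nsq (\<lambda>x. ?I x * (?w x - ?v x))"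
      by (intro nsq_add_le sqint_localize sqint_diff u w)
    also have "nsq (\<lambda>x. ?I x * (u x - ?w x)) \<le> 1\<^sup>2 * nsq (\<lambda>x. u x - ?w x)"
      by (rule sqint_mult_bounded(2)[OF sqint_diff[OF u w(1)]]) (auto simp: indicator_def)
    also have "nsq (\<lambda>x. u x - ?w x) = nsq (\<lambda>x. ?w x - u x)" by (rule nsq_minus_commute)
    also note bd[OF n]
    finally show ?thesis by simp
  qed
  have "(\<lambda>n. 2 * nsq (\<lambda>x. conv u (nmoll (real (Suc n))) x - u x) + 2 * (1 / \<mu>\<^sup>2 * nsq g)) \<longlonglongrightarrow> 2 * 0 + 2 * (1 / \<mu>\<^sup>2 * nsq g)"
    by (intro tendsto_intros conv_nmoll_tendsto u)
  moreover have "eventually (\<lambda>n. nsq (\<lambda>x. ?I x * (u x - conv u (nmoll \<mu>) x)) \<le> 2 * nsq (\<lambda>x. conv u (nmoll (real (Suc n))) x - u x) + 2 * (1 / \<mu>\<^sup>2 * nsq g)) sequentially"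
    using eventually_ge_at_top[of "nat \<lceil>\<mu>\<rceil>"] by eventually_elim (rule step, linarith)
  ultimately have "nsq (\<lambda>x. ?I x * (u x - conv u (nmoll \<mu>) x)) \<le> 2 * 0 + 2 * (1 / \<mu>\<^sup>2 * nsq g)"
    by (rule tendsto_lowerbound) simp
  then show ?thesis by (simp add: g_def[abs_def])
qed

section \<open>Tightness\<close>

text \<open>The squared positive part is C^1, which is the regularity asked of the weight; both ends
  of the cutoff are built from it.\<close>

lemma DERIV_max_power2: "((\<lambda>z::real. (max 0 z)\<^sup>2) has_real_derivative 2 * max 0 z) (at z)"
proof -
  consider "z > 0" | "z < 0" | "z = 0" by linarith
  then show ?thesis
  proof cases
    case 1
    have "eventually (\<lambda>z. (max 0 z)\<^sup>2 = z\<^sup>2) (nhds z)"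
      using eventually_nhds_in_open[of "{0<..}" z] 1 by (auto elim!: eventually_mono)
    then show ?thesis using 1 by (subst DERIV_cong_ev[OF refl _ refl]) (auto intro!: derivative_eq_intros)
  next
    case 2
    have "eventually (\<lambda>z::real. (max 0 z)\<^sup>2 = 0) (nhds z)"
      using eventually_nhds_in_open[of "{..<0}" z] 2 by (auto elim!: eventually_mono)
    then show ?thesis using 2 by (subst DERIV_cong_ev[OF refl _ refl, where g="\<lambda>_. 0"]) auto
  next
    case 3
    have "((\<lambda>h::real. (max 0 h)\<^sup>2 / h) \<longlongrightarrow> 0) (at 0)"
    proof (rule Lim_null_comparison)
      show "eventually (\<lambda>h::real. norm ((max 0 h)\<^sup>2 / h) \<le> \<bar>h\<bar>) (at 0)"
        by (rule eventuallyI) (auto simp: power2_eq_square max_def)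
      show "((\<lambda>h::real. \<bar>h\<bar>) \<longlongrightarrow> 0) (at 0)" by (auto intro!: tendsto_eq_intros)
    qed
    then show ?thesis using 3 by (simp add: DERIV_def)
  qed
qed

text \<open>The point is that \<open>c\<close>, \<open>C\<close> and \<open>t3\<close> do not depend
  on \<open>T\<close>: integration by parts needs compactly supported weights, and letting
  \<open>T\<close> grow afterwards keeps the growing lower bound. The weight is the squared positive
  part of \<open>t powr a - A\<close> times that of \<open>1 - t / T\<close>.\<close>

lemma cutoff_exists:
  fixes t1 e :: real
  assumes t1: "0 < t1" and e: "0 < e" "e \<le> 1"
  obtains c C t3 where "c > 0" "C \<ge> 0" "t3 \<ge> t1"
    "\<And>T. T \<ge> 1 \<Longrightarrow> \<exists>y y'. (\<forall>t. (y has_real_derivative y' t) (at t)) \<and> continuous_on UNIV y' \<and>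
      (\<forall>t\<le>t1. y t = 0 \<and> y' t = 0) \<and> (\<forall>t\<ge>T. y t = 0 \<and> y' t = 0) \<and>
      (\<forall>t\<ge>t1. c * (if t3 \<le> t \<and> t \<le> T / 2 then t powr (e / 2) else 0) - C
        \<le> 2 * (1 + e) / t * (y t)\<^sup>2 - 4 * y t * y' t - 4 * (y' t)\<^sup>2)"
proof -
  \<comment> \<open>\<open>y\<close> will grow like \<open>t powr (2 * a)\<close>: \<open>4 * a < 1 + e\<close> lets the first term absorb the second, and
    \<open>4 * a > 1\<close> leaves a positive power of \<open>t\<close>.\<close>
  define a where "a = (1 + e / 2) / 4"
  have a: "0 < a" "8 * a = 2 + e" "16 * a\<^sup>2 \<le> 9 / 4" "a \<le> 3 / 8" "4 * a = 1 + e / 2"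
  proof -
    show "a \<le> 3 / 8" using e by (simp add: a_def)
    then have "a\<^sup>2 \<le> (3 / 8)\<^sup>2" using e by (intro power_mono) (auto simp: a_def)
    then show "16 * a\<^sup>2 \<le> 9 / 4" by (simp add: power2_eq_square)
  qed (use e in \<open>auto simp: a_def\<close>)
  define A where "A = t1 powr a"
  have A: "A > 0" using t1 by (simp add: A_def)
  \<comment> \<open>Beyond \<open>t3\<close> one has \<open>A \<le> \<kappa> * t powr a\<close> and
    \<open>1 / t \<le> e / 12\<close>. Of the leading coefficient 2 + 2 e, the cross term then
    consumes at most 2 + 3 e / 2 and the quadratic term at most e / 4; e / 4 remains.\<close>
  define \<kappa> where "\<kappa> = e / 8"
  define t3 where "t3 = max t1 (max ((A / \<kappa>) powr (1 / a)) (12 / e))"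
  have t3: "t3 \<ge> t1" "t3 > 0" using t1 by (auto simp: t3_def)
  define X3 where "X3 = t3 powr a"
  \<comment> \<open>16 pays for the falling cutoff \<open>q\<close>; the rest bounds the possibly
    negative remainder between \<open>t1\<close> and \<open>t3\<close>, using
    \<open>2 + e \<le> 3\<close> and \<open>16 * a\<^sup>2 \<le> 9 / 4\<close>.\<close>
  define C where "C = 16 + (3 * X3 ^ 4 + 9 / 4 * X3 ^ 4 / t1) / t1"
  have C: "C \<ge> 0" using t1 by (simp add: C_def X3_def)
  define H where "H z = (max 0 z)\<^sup>2" for z :: real
  have DH: "(H has_real_derivative 2 * max 0 z) (at z)" for z unfolding H_def[abs_def] by (rule DERIV_max_power2)
  define w where "w t = (if t \<le> 0 then 0 else H (t powr a - A))" for t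
  define w' where "w' t = (if t \<le> t1 then 0 else 2 * (t powr a - A) * (a * t powr (a - 1)))" for t
  have mono: "t powr a \<le> A" if "0 < t" "t \<le> t1" for t
    using that a by (simp add: A_def powr_mono2)
  have mono': "A \<le> t powr a" if "t1 \<le> t" for t
    using that a t1 by (simp add: A_def powr_mono2)
  have w0: "w t = 0" "w' t = 0" if "t \<le> t1" for t
    using mono[of t] that by (auto simp: w_def w'_def H_def max_def)
  have Dw: "(w has_real_derivative w' t) (at t)" for t
  proof (cases "t < t1")
    case True
    have "eventually (\<lambda>t. w t = 0) (nhds t)"
      using eventually_nhds_in_open[of "{..<t1}" t] True w0 by (auto elim!: eventually_mono)
    then show ?thesis using True w0(2)[of t] by (subst DERIV_cong_ev[OF refl _ refl, where g="\<lambda>_. 0"]) auto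
  next
    case False
    then have t: "t > 0" "t \<ge> t1" using t1 by auto
    have "eventually (\<lambda>t. w t = H (t powr a - A)) (nhds t)"
      using eventually_nhds_in_open[of "{0<..}" t] t by (auto elim!: eventually_mono simp: w_def)
    moreover have "((\<lambda>t. H (t powr a - A)) has_real_derivative 2 * max 0 (t powr a - A) * (a * t powr (a - 1) - 0)) (at t)"
      by (intro DERIV_chain2[OF DH] DERIV_diff DERIV_const has_real_derivative_powr t)
    moreover have "2 * max 0 (t powr a - A) * (a * t powr (a - 1) - 0) = w' t"
      using mono'[OF t(2)] t by (cases "t = t1") (auto simp: w'_def A_def max_def)
    ultimately show ?thesis by (subst DERIV_cong_ev[OF refl _ refl]) auto
  qed
  have cw': "continuous_on UNIV w'"
  proof -
    have "continuous_on ({..t1} \<union> {t1..}) w'"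
      unfolding w'_def[abs_def]
    proof (rule continuous_on_If)
      show "continuous_on {t1..} (\<lambda>t. 2 * (t powr a - A) * (a * t powr (a - 1)))"
        by (intro continuous_intros) (use t1 in auto)
    qed (auto simp: A_def)
    moreover have "{..t1} \<union> {t1..} = (UNIV :: real set)" by auto
    ultimately show ?thesis by simp
  qed
  \<comment> \<open>The product of 1 / 16 from \<open>Q \<ge> 1 / 2\<close>, of e / 4 from the
    remaining coefficient and of 1 / 2 from \<open>P ^ 4 \<ge> X ^ 4 / 2\<close>.\<close>
  define c where "c = e / 128"
  have c: "c > 0" using e by (simp add: c_def)
  show thesis
  proof (rule that[OF c C t3(1)])
    fix T :: real assume T: "T \<ge> 1"
    define q where "q t = max 0 (1 - t / T)" for t
    define y where "y t = w t * (q t)\<^sup>2" for t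
    define y' where "y' t = w' t * (q t)\<^sup>2 + (2 * q t * (- 1 / T)) * w t" for t
    have Dq: "((\<lambda>t. (q t)\<^sup>2) has_real_derivative 2 * q t * (- 1 / T)) (at t)" for t
    proof -
      have "((\<lambda>t. H (1 - t / T)) has_real_derivative 2 * max 0 (1 - t / T) * (- 1 / T)) (at t)"
        by (rule DERIV_chain2[OF DH]) (use T in \<open>auto intro!: derivative_eq_intros\<close>)
      then show ?thesis by (simp add: H_def q_def)
    qed
    have D: "(y has_real_derivative y' t) (at t)" for t
      unfolding y_def[abs_def] y'_def by (rule DERIV_mult[OF Dw Dq])
    have cw: "continuous_on UNIV w" by (intro continuous_at_imp_continuous_on ballI DERIV_isCont[OF Dw])
    have cy: "continuous_on UNIV y'"
      unfolding y'_def[abs_def] q_def[abs_def] by (intro continuous_intros cw cw') (use T in auto)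
    have z1: "y t = 0 \<and> y' t = 0" if "t \<le> t1" for t using w0[OF that] by (simp add: y_def y'_def)
    have z2: "y t = 0 \<and> y' t = 0" if "t \<ge> T" for t
    proof -
      have "q t = 0" using that T by (simp add: q_def)
      then show ?thesis by (simp add: y_def y'_def)
    qed
    have main: "c * (if t3 \<le> t \<and> t \<le> T / 2 then t powr (e / 2) else 0) - C
        \<le> 2 * (1 + e) / t * (y t)\<^sup>2 - 4 * y t * y' t - 4 * (y' t)\<^sup>2" if t: "t \<ge> t1" for t
    proof -
      have tp: "t > 0" using t t1 by simp
      define X where "X = t powr a"
      define P where "P = X - A"
      define Q where "Q = q t"
      have P: "0 \<le> P" "P \<le> X" using mono'[OF t] A by (auto simp: P_def X_def)
      have X: "X > 0" using tp by (simp add: X_def)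
      have Q: "0 \<le> Q" "Q \<le> 1" using tp T by (auto simp: Q_def q_def)
      have wP: "w t = P\<^sup>2" using P tp by (simp add: w_def H_def P_def X_def)
      have w'P: "w' t = 2 * a * P * X / t"
      proof (cases "t = t1")
        case True then show ?thesis by (simp add: w'_def P_def X_def A_def)
      next
        case False
        have "t powr (a - 1) = X / t" using tp by (simp add: X_def powr_diff)
        then show ?thesis using False t by (simp add: w'_def P_def X_def)
      qed
      define \<alpha> where "\<alpha> = 2 * a * P * X / t * Q\<^sup>2"
      \<comment> \<open>\<beta> comes from the falling cutoff. It helps in - 4 y y', and in - 4 y'^2
        it costs at most 4 \<beta>^2 \<le> 16, because P^2 \<le> T powr (2 a) \<le> T on the
        support.\<close>
      define \<beta> where "\<beta> = 2 * Q * P\<^sup>2 / T"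
      have \<alpha>\<beta>: "0 \<le> \<alpha>" "0 \<le> \<beta>" using P Q X a tp T by (auto simp: \<alpha>_def \<beta>_def)
      have y: "y t = P\<^sup>2 * Q\<^sup>2" "y' t = \<alpha> - \<beta>"
        by (simp_all add: y_def y'_def wP w'P \<alpha>_def \<beta>_def Q_def[symmetric])
      \<comment> \<open>\<open>Q ^ 4 * Bk / t\<close> is the whole expression without \<beta>; the
        coefficient \<open>2 + e\<close> is \<open>8 * a\<close>.\<close>
      define Bk where "Bk = 2 * (1 + e) * P ^ 4 - (2 + e) * P ^ 3 * X - 16 * a\<^sup>2 * P\<^sup>2 * X\<^sup>2 / t"
      have pQ: "Q ^ 4 \<le> 1" "0 \<le> Q ^ 4" using Q by (auto intro: power_le_one)
      have b1: "\<beta>\<^sup>2 \<le> 4"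
      proof (cases "t \<le> T")
        case True
        have "P\<^sup>2 \<le> T"
        proof -
          have "P\<^sup>2 \<le> X\<^sup>2" using P by (intro power_mono) auto
          also have "X\<^sup>2 = t powr (2 * a)" using tp by (simp add: X_def powr_power mult.commute)
          also have "\<dots> \<le> T powr (2 * a)" using True tp a by (intro powr_mono2) auto
          also have "\<dots> \<le> T powr 1" using T a by (intro powr_mono) auto
          finally show ?thesis using T by simp
        qed
        then have "Q * P\<^sup>2 \<le> 1 * T" using Q by (intro mult_mono) auto
        then have "\<beta> \<le> 2" using T by (simp add: \<beta>_def field_simps)
        then show ?thesis using \<alpha>\<beta> power_mono[of \<beta> 2 2] by simp
      next
        case False
        then have "Q = 0" using T by (simp add: Q_def q_def)
        then show ?thesis by (simp add: \<beta>_def)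
      qed
      have "Q ^ 4 * Bk / t - 16 \<le> 2 * (1 + e) / t * (y t)\<^sup>2 - 4 * y t * y' t - 4 * (y' t)\<^sup>2"
      proof -
        have "(\<alpha> - \<beta>)\<^sup>2 \<le> \<alpha>\<^sup>2 + \<beta>\<^sup>2" using \<alpha>\<beta> by (simp add: power2_diff)
        moreover have "0 \<le> P\<^sup>2 * Q\<^sup>2 * \<beta>" using \<alpha>\<beta> by simp
        ultimately have "2 * (1 + e) / t * (P\<^sup>2 * Q\<^sup>2)\<^sup>2 - 4 * (P\<^sup>2 * Q\<^sup>2) * \<alpha> - 4 * \<alpha>\<^sup>2 - 16
          \<le> 2 * (1 + e) / t * (y t)\<^sup>2 - 4 * y t * y' t - 4 * (y' t)\<^sup>2"
          using b1 unfolding y by (simp add: algebra_simps)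
        moreover have "2 * (1 + e) / t * (P\<^sup>2 * Q\<^sup>2)\<^sup>2 - 4 * (P\<^sup>2 * Q\<^sup>2) * \<alpha> - 4 * \<alpha>\<^sup>2 = Q ^ 4 * Bk / t"
          unfolding Bk_def \<alpha>_def a(2)[symmetric] using tp by (simp add: field_simps power2_eq_square power3_eq_cube power4_eq_xxxx)
        ultimately show ?thesis by linarith
      qed
      moreover have "c * (if t3 \<le> t \<and> t \<le> T / 2 then t powr (e / 2) else 0) - C \<le> Q ^ 4 * Bk / t - 16"
      proof (cases "t3 \<le> t")
        case True
        have AX: "A \<le> \<kappa> * X"
        proof -
          have "A / \<kappa> = ((A / \<kappa>) powr (1 / a)) powr a" using A e a by (simp add: powr_powr \<kappa>_def)
          also have "\<dots> \<le> X" unfolding X_def using True a by (intro powr_mono2) (auto simp: t3_def)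
          finally show ?thesis using e by (simp add: \<kappa>_def field_simps)
        qed
        have PX: "(1 - \<kappa>) * X \<le> P" using AX by (simp add: P_def algebra_simps)
        have k: "7 / 8 \<le> 1 - \<kappa>" using e by (simp add: \<kappa>_def)
        have PX2: "7 / 8 * X \<le> P" using PX mult_right_mono[OF k, of X] X by linarith
        have 1: "(2 + e) * P ^ 3 * X \<le> (2 + 3 / 2 * e) * P ^ 4"
        proof -
          have "(2 + e) \<le> (2 + 3 / 2 * e) * (1 - \<kappa>)"
          proof -
            have "e * e \<le> e * 1" using e by (intro mult_left_mono) auto
            moreover have "(2 + 3 / 2 * e) * (1 - \<kappa>) = 2 + 5 / 4 * e - 3 / 16 * (e * e)"
              by (simp add: \<kappa>_def field_simps)
            ultimately show ?thesis using e by linarith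
          qed
          then have "(2 + e) * X \<le> (2 + 3 / 2 * e) * ((1 - \<kappa>) * X)" using X by (simp add: mult.assoc[symmetric])
          also have "\<dots> \<le> (2 + 3 / 2 * e) * P" using PX e by (intro mult_left_mono) auto
          finally have "((2 + e) * X) * P ^ 3 \<le> ((2 + 3 / 2 * e) * P) * P ^ 3" using P by (intro mult_right_mono) auto
          then show ?thesis by (simp add: power4_eq_xxxx power3_eq_cube mult_ac)
        qed
        have 2: "16 * a\<^sup>2 * P\<^sup>2 * X\<^sup>2 / t \<le> e / 4 * P ^ 4"
        proof -
          have "X \<le> 8 / 7 * P" using PX2 by simp
          then have "X\<^sup>2 \<le> (8 / 7 * P)\<^sup>2" using X by (intro power_mono) auto
          then have "49 * X\<^sup>2 \<le> 64 * P\<^sup>2" by (simp add: power_mult_distrib power2_eq_square)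
          then have x2: "X\<^sup>2 \<le> 4 / 3 * P\<^sup>2" using zero_le_power2[of P] by linarith
          have "12 / e \<le> t" using True by (simp add: t3_def)
          then have te: "1 / t \<le> e / 12" using e tp by (simp add: field_simps)
          have "16 * a\<^sup>2 * P\<^sup>2 * X\<^sup>2 / t = (16 * a\<^sup>2) * (P\<^sup>2 * X\<^sup>2) * (1 / t)" by simp
          also have "\<dots> \<le> 9 / 4 * (P\<^sup>2 * (4 / 3 * P\<^sup>2)) * (e / 12)"
            using a x2 te tp by (intro mult_mono) auto
          also have "\<dots> = e / 4 * P ^ 4" by (simp add: power2_eq_square power4_eq_xxxx)
          finally show ?thesis .
        qed
        have 3: "e / 4 * P ^ 4 \<le> Bk"
        proof -
          have "2 * (1 + e) * P ^ 4 = (2 + 3 / 2 * e) * P ^ 4 + e / 4 * P ^ 4 + e / 4 * P ^ 4"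
            by (simp add: algebra_simps)
          then show ?thesis unfolding Bk_def using 1 2 by linarith
        qed
        have Bk0: "0 \<le> Bk" by (rule order_trans[OF _ 3]) (use e P in simp)
        show ?thesis
        proof (cases "t \<le> T / 2")
          case t2: True
          have q2: "1 / 2 \<le> Q" using t2 T by (auto simp: Q_def q_def field_simps)
          have "(1 / 2) ^ 4 \<le> Q ^ 4" using q2 by (intro power_mono) auto
          then have q4: "1 / 16 \<le> Q ^ 4" by (simp add: power4_eq_xxxx)
          have "(7 / 8 * X) ^ 4 \<le> P ^ 4" using PX2 X by (intro power_mono) auto
          moreover have "1 / 2 * X ^ 4 \<le> (7 / 8 * X) ^ 4"
            unfolding power_mult_distrib using X by (intro mult_right_mono) (auto simp: power4_eq_xxxx)
          ultimately have x4: "1 / 2 * X ^ 4 \<le> P ^ 4" by linarith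
          have X4: "X ^ 4 = t powr (1 + e / 2)" using tp a(5) by (simp add: X_def powr_power mult.commute)
          have "c * t powr (e / 2) = 1 / 16 * (e / 4 * (1 / 2 * X ^ 4)) / t"
            using tp by (simp add: X4 powr_add c_def)
          also have "\<dots> \<le> Q ^ 4 * Bk / t"
          proof (intro divide_right_mono mult_mono)
            have "e / 4 * (1 / 2 * X ^ 4) \<le> e / 4 * P ^ 4" using x4 e by (intro mult_left_mono) auto
            then show "e / 4 * (1 / 2 * X ^ 4) \<le> Bk" using 3 by linarith
          qed (use q4 tp e X in auto)
          finally have "c * t powr (e / 2) \<le> Q ^ 4 * Bk / t" .
          moreover have "C \<ge> 16" using t1 by (simp add: C_def X3_def)
          ultimately show ?thesis using True t2 by simp
        next
          case False
          have "0 \<le> Q ^ 4 * Bk / t" using Bk0 pQ tp by simp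
          moreover have "C \<ge> 16" using t1 by (simp add: C_def X3_def)
          ultimately show ?thesis using False by simp
        qed
      next
        case False
        have XX: "X \<le> X3" unfolding X_def X3_def using False tp a by (intro powr_mono2) auto
        have "- Bk \<le> 3 * X3 ^ 4 + 9 / 4 * X3 ^ 4 / t1"
        proof -
          have "(2 + e) * P ^ 3 * X \<le> 3 * X3 ^ 3 * X3"
            using e P X XX by (intro mult_mono power_mono) auto
          moreover have "16 * a\<^sup>2 * P\<^sup>2 * X\<^sup>2 / t \<le> 9 / 4 * X3\<^sup>2 * X3\<^sup>2 / t1"
            using a(3) P X XX t t1 tp by (intro frac_le mult_mono power_mono) auto
          moreover have "0 \<le> 2 * (1 + e) * P ^ 4" using e P by simp
          ultimately show ?thesis unfolding Bk_def by (simp add: power4_eq_xxxx power3_eq_cube power2_eq_square)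
        qed
        then have "- (Q ^ 4 * Bk) \<le> 1 * (3 * X3 ^ 4 + 9 / 4 * X3 ^ 4 / t1)"
        proof (cases "Bk \<le> 0")
          case True
          assume b: "- Bk \<le> 3 * X3 ^ 4 + 9 / 4 * X3 ^ 4 / t1"
          have "Q ^ 4 * (- Bk) \<le> 1 * (3 * X3 ^ 4 + 9 / 4 * X3 ^ 4 / t1)"
            using True pQ b by (intro mult_mono) auto
          then show ?thesis by simp
        next
          case False
          then have n: "- (Q ^ 4 * Bk) \<le> 0" using pQ by simp
          have p: "0 \<le> 1 * (3 * X3 ^ 4 + 9 / 4 * X3 ^ 4 / t1)" using t1 by simp
          show ?thesis by (rule order_trans[OF n p])
        qed
        then have "- (Q ^ 4 * Bk) / t \<le> (3 * X3 ^ 4 + 9 / 4 * X3 ^ 4 / t1) / t1"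
          using t1 t by (intro frac_le) auto
        then show ?thesis using False by (simp add: C_def)
      qed
      ultimately show ?thesis by linarith
    qed
    show "\<exists>y y'. (\<forall>t. (y has_real_derivative y' t) (at t)) \<and> continuous_on UNIV y' \<and>
      (\<forall>t\<le>t1. y t = 0 \<and> y' t = 0) \<and> (\<forall>t\<ge>T. y t = 0 \<and> y' t = 0) \<and>
      (\<forall>t\<ge>t1. c * (if t3 \<le> t \<and> t \<le> T / 2 then t powr (e / 2) else 0) - C
        \<le> 2 * (1 + e) / t * (y t)\<^sup>2 - 4 * y t * y' t - 4 * (y' t)\<^sup>2)"
      using D cy z1 z2 main by (intro exI[of _ y] exI[of _ y']) blast
  qed
qed

text \<open>The radius depends on the lower bound for V and on \<eta>, not on the eigenpair, and
  this uniformity is what compactness needs. The weight begins at |x| = \<open>R\<^sub>0\<close>,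
  where W is absent.\<close>

lemma tightness:
  fixes V :: "real^'n::finite \<Rightarrow> real" and \<epsilon> \<eta> R\<^sub>0 :: real
  assumes V: "AE x in lborel. norm x \<ge> R\<^sub>0 \<longrightarrow>
           V x \<ge> real CARD('n) * (4 - real CARD('n)) / (4 * (norm x)\<^sup>2)
                 + (1 + \<epsilon>) / ((norm x)\<^sup>2 * ln (norm x))
                 + (3 + \<epsilon>) / (4 * (norm x)\<^sup>2 * (ln (norm x))\<^sup>2)"
    and \<epsilon>: "\<epsilon> > 0" and R0: "R\<^sub>0 > 1" and \<eta>: "\<eta> > 0"
  shows "\<exists>R. \<forall>u f W E. wsol u f \<longrightarrow> (AE x in lborel. f x = (W x + E - V x) * u x) \<longrightarrow> E \<le> 0 \<longrightarrow>
    (\<forall>x. norm x \<ge> R\<^sub>0 \<longrightarrow> W x = 0) \<longrightarrow> nsq (\<lambda>x. indicator (- cball 0 R) x * u x) \<le> \<eta> * nsq u"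
proof -
  \<comment> \<open>\<open>cutoff_exists\<close> works with exponents up to 1; lowering \<epsilon>
    only weakens the lower bound on V.\<close>
  define e where "e = min \<epsilon> 1"
  have e: "0 < e" "e \<le> 1" "e \<le> \<epsilon>" using \<epsilon> by (auto simp: e_def)
  define t1 where "t1 = ln (R\<^sub>0\<^sup>2)"
  have t1: "0 < t1" using R0 one_less_power[of "R\<^sub>0" 2] by (simp add: t1_def)
  obtain c C t3 where c: "c > 0" and C: "C \<ge> 0" and t3: "t3 \<ge> t1"
    and cut: "\<And>T. T \<ge> 1 \<Longrightarrow> \<exists>y y'. (\<forall>t. (y has_real_derivative y' t) (at t)) \<and> continuous_on UNIV y' \<and>
      (\<forall>t\<le>t1. y t = 0 \<and> y' t = 0) \<and> (\<forall>t\<ge>T. y t = 0 \<and> y' t = 0) \<and>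
      (\<forall>t\<ge>t1. c * (if t3 \<le> t \<and> t \<le> T / 2 then t powr (e / 2) else 0) - C
        \<le> 2 * (1 + e) / t * (y t)\<^sup>2 - 4 * y t * y' t - 4 * (y' t)\<^sup>2)"
    using cutoff_exists[OF t1 e(1,2)] by blast
  \<comment> \<open>Chosen so that \<open>C * nsq u\<close> is at most
    \<open>L * (\<eta> / 2 * nsq u)\<close>; the summand 1 keeps \<open>L\<close> positive when
    \<open>C = 0\<close>.\<close>
  define L where "L = (C + 1) * 2 / \<eta>"
  have L: "L > 0" using C \<eta> by (simp add: L_def)
  define \<tau> where "\<tau> = max t3 ((L / c) powr (2 / e))"
  have \<tau>: "\<tau> > 0" "\<tau> \<ge> t3" using t1 t3 by (auto simp: \<tau>_def)
  have L\<tau>: "L \<le> c * t powr (e / 2)" if "t \<ge> \<tau>" for t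
  proof -
    have "L / c = ((L / c) powr (2 / e)) powr (e / 2)" using L c e by (simp add: powr_powr)
    also have "\<dots> \<le> t powr (e / 2)" using that e by (intro powr_mono2) (auto simp: \<tau>_def)
    finally show ?thesis using c by (simp add: field_simps)
  qed
  define R where "R = exp \<tau>"
  have R: "R > 1" using \<tau> by (simp add: R_def)
  have lnR: "ln ((norm x)\<^sup>2) \<ge> \<tau>" if "norm x > R" for x :: "real^'n"
  proof -
    have p: "0 < norm x" using that R by linarith
    have "ln (exp \<tau>) < ln (norm x)" using that p by (subst ln_less_cancel_iff) (auto simp: R_def)
    then have "\<tau> < ln (norm x)" by simp
    then show ?thesis using p \<tau> by (simp add: ln_realpow)
  qed
  have "nsq (\<lambda>x. indicator (- cball 0 R) x * u x) \<le> \<eta> * nsq u"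
    if s: "wsol u f" and f: "AE x in lborel. f x = (W x + E - V x) * u x" and E: "E \<le> 0"
      and W: "\<forall>x. norm x \<ge> R\<^sub>0 \<longrightarrow> W x = 0" for u f W E
  proof -
    have u: "sqint u" using s by (simp add: wsol_def)
    have part: "nsq (\<lambda>x. indicator (cball 0 S - cball 0 R) x * u x) \<le> \<eta> / 2 * nsq u" if S: "S > 0" for S
    proof -
      \<comment> \<open>\<open>T / 2\<close> reaches \<open>ln (S\<^sup>2)\<close>, so the whole
        shell between \<open>R\<close> and \<open>S\<close> lies where the cutoff gives its full
        lower bound.\<close>
      define T where "T = max 1 (2 * ln (S\<^sup>2))"
      have "T \<ge> 1" by (simp add: T_def)
      from cut[OF this] obtain y y' where D: "\<And>t. (y has_real_derivative y' t) (at t)" and cy: "continuous_on UNIV y'"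
        and z: "\<And>t. t \<le> t1 \<Longrightarrow> y t = 0" "\<And>t. t \<le> t1 \<Longrightarrow> y' t = 0" "\<And>t. t \<ge> T \<Longrightarrow> y t = 0" "\<And>t. t \<ge> T \<Longrightarrow> y' t = 0"
        and lb: "\<And>t. t \<ge> t1 \<Longrightarrow> c * (if t3 \<le> t \<and> t \<le> T / 2 then t powr (e / 2) else 0) - C
        \<le> 2 * (1 + e) / t * (y t)\<^sup>2 - 4 * y t * y' t - 4 * (y' t)\<^sup>2"
        by metis
      define Y where "Y x = y (ln ((norm x)\<^sup>2))" for x :: "real^'n"
      define Y' where "Y' x = y' (ln ((norm x)\<^sup>2))" for x :: "real^'n"
      define d where "d = real CARD('n)"
      let ?A = "\<lambda>x. (u x)\<^sup>2 * (d * (d - 4) / 4 * (Y x)\<^sup>2 - 4 * Y x * Y' x - 4 * (Y' x)\<^sup>2)"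
      let ?B = "\<lambda>x. (norm x)\<^sup>2 * (Y x)\<^sup>2 * u x * f x"
      have AB: "integrable lborel ?A" "integrable lborel ?B" "(LBINT x. ?A x) \<le> (LBINT x. ?B x)"
        using weighted_inequality[OF s D cy t1 z] unfolding Y_def Y'_def d_def by blast+
      let ?I = "indicator (cball 0 S - cball 0 R) :: real^'n \<Rightarrow> real"
      let ?G = "\<lambda>x. L * (?I x * u x)\<^sup>2 - C * (u x)\<^sup>2"
      have sI: "sqint (\<lambda>x. ?I x * u x)"
        by (rule sqint_mult_bounded(1)[OF u, where M=1]) (auto simp: indicator_def)
      have iG: "integrable lborel ?G"
        using sqint_integrable[OF sI] sqint_integrable[OF u] by simp
      have "AE x in lborel. ?G x \<le> ?A x - ?B x"
        using V f
      proof eventually_elim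
        case (elim x)
        define t where "t = ln ((norm x)\<^sup>2)"
        have G: "?G x = (u x)\<^sup>2 * (L * ?I x - C)"
          by (simp add: indicator_def algebra_simps)
        have Ib: "L * ?I x \<le> c * (if t3 \<le> t \<and> t \<le> T / 2 then t powr (e / 2) else 0)"
        proof (cases "x \<in> cball 0 S - cball 0 R")
          case True
          then have xR: "norm x > R" and xS: "norm x \<le> S" by auto
          have "\<tau> \<le> t" using lnR[OF xR] by (simp add: t_def)
          moreover have "t \<le> T / 2"
          proof -
            have "0 < norm x" using xR R by linarith
            then have "ln ((norm x)\<^sup>2) \<le> ln (S\<^sup>2)" using xS S by (subst ln_le_cancel_iff) (auto intro: power_mono)
            then show ?thesis by (simp add: t_def T_def)
          qed
          ultimately show ?thesis using True L\<tau>[of t] \<tau> by simp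
        qed (use c in auto)
        show ?case
        proof (cases "t < t1")
          case True
          then have "Y x = 0" "Y' x = 0" using z by (auto simp: Y_def Y'_def t_def)
          moreover have "L * ?I x \<le> 0" using Ib True t3 by simp
          then have "(u x)\<^sup>2 * (L * ?I x - C) \<le> 0" using C by (intro mult_nonneg_nonpos) auto
          ultimately show ?thesis unfolding G by simp
        next
          case False
          then have tp: "t > 0" "t \<ge> t1" using t1 by auto
          have x0: "x \<noteq> 0" using tp by (auto simp: t_def)
          have np: "(norm x)\<^sup>2 > 0" using x0 by simp
          have "R\<^sub>0\<^sup>2 \<le> (norm x)\<^sup>2"
            using tp(2) np R0 unfolding t_def t1_def by (subst (asm) ln_le_cancel_iff) auto
          then have xR0: "norm x \<ge> R\<^sub>0" using R0 by (simp add: power2_le_iff_abs_le)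
          have n1: "norm x > 1" using xR0 R0 by simp
          have lnn: "ln (norm x) = t / 2" using n1 by (simp add: t_def ln_realpow)
          have Vb: "d * (4 - d) / 4 + 2 * (1 + e) / t \<le> (norm x)\<^sup>2 * V x"
          proof -
            have "V x \<ge> d * (4 - d) / (4 * (norm x)\<^sup>2) + (1 + \<epsilon>) / ((norm x)\<^sup>2 * (t / 2)) + (3 + \<epsilon>) / (4 * (norm x)\<^sup>2 * (t / 2)\<^sup>2)"
              using elim(1) xR0 by (simp add: d_def lnn)
            moreover have "0 \<le> (3 + \<epsilon>) / (4 * (norm x)\<^sup>2 * (t / 2)\<^sup>2)" using \<epsilon> by simp
            ultimately have "d * (4 - d) / (4 * (norm x)\<^sup>2) + (1 + \<epsilon>) / ((norm x)\<^sup>2 * (t / 2)) \<le> V x" by linarith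
            then have "(norm x)\<^sup>2 * (d * (4 - d) / (4 * (norm x)\<^sup>2) + (1 + \<epsilon>) / ((norm x)\<^sup>2 * (t / 2))) \<le> (norm x)\<^sup>2 * V x"
              by (intro mult_left_mono) auto
            also have "(norm x)\<^sup>2 * (d * (4 - d) / (4 * (norm x)\<^sup>2) + (1 + \<epsilon>) / ((norm x)\<^sup>2 * (t / 2))) = d * (4 - d) / 4 + 2 * (1 + \<epsilon>) / t"
              using np tp x0 by (simp add: field_simps)
            finally have "d * (4 - d) / 4 + 2 * (1 + \<epsilon>) / t \<le> (norm x)\<^sup>2 * V x" .
            moreover have "2 * (1 + e) / t \<le> 2 * (1 + \<epsilon>) / t" using e tp by (intro divide_right_mono) auto
            ultimately show ?thesis by linarith
          qed
          \<comment> \<open>W vanishes here and \<open>E \<le> 0\<close> contributes a nonpositive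
            term, so only the lower bound on V is left.\<close>
          have B: "?B x \<le> - ((u x)\<^sup>2 * ((Y x)\<^sup>2 * (d * (4 - d) / 4 + 2 * (1 + e) / t)))"
          proof -
            have "?B x = (norm x)\<^sup>2 * (Y x)\<^sup>2 * (u x)\<^sup>2 * E - (u x)\<^sup>2 * ((Y x)\<^sup>2 * ((norm x)\<^sup>2 * V x))"
              using W xR0 by (simp add: elim(2) power2_eq_square algebra_simps)
            moreover have "(norm x)\<^sup>2 * (Y x)\<^sup>2 * (u x)\<^sup>2 * E \<le> 0" using E by (intro mult_nonneg_nonpos) auto
            moreover have "(u x)\<^sup>2 * ((Y x)\<^sup>2 * (d * (4 - d) / 4 + 2 * (1 + e) / t)) \<le> (u x)\<^sup>2 * ((Y x)\<^sup>2 * ((norm x)\<^sup>2 * V x))"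
              using Vb by (intro mult_left_mono) auto
            ultimately show ?thesis by linarith
          qed
          have "?G x \<le> (u x)\<^sup>2 * (2 * (1 + e) / t * (Y x)\<^sup>2 - 4 * Y x * Y' x - 4 * (Y' x)\<^sup>2)"
            unfolding G using lb[OF tp(2)] Ib by (intro mult_left_mono) (auto simp: Y_def Y'_def t_def)
          also have "\<dots> = ?A x + (u x)\<^sup>2 * ((Y x)\<^sup>2 * (d * (4 - d) / 4 + 2 * (1 + e) / t))"
            by (simp add: algebra_simps diff_divide_distrib add_divide_distrib)
          also have "\<dots> \<le> ?A x - ?B x"
          proof -
            have "a + r \<le> a - b" if "b \<le> - r" for a b r :: real using that by linarith
            from this[OF B] show ?thesis .
          qed
          finally show ?thesis .
        qed
      qed
      then have "(LBINT x. ?G x) \<le> (LBINT x. ?A x - ?B x)"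
        by (intro integral_mono_AE iG Bochner_Integration.integrable_diff AB)
      also have "\<dots> \<le> 0" using AB by simp
      finally have "(LBINT x. ?G x) \<le> 0" .
      then have "L * nsq (\<lambda>x. ?I x * u x) \<le> C * nsq u"
        using sqint_integrable[OF sI] sqint_integrable[OF u] by (simp add: nsq_def)
      also have "\<dots> \<le> (C + 1) * nsq u" using nsq_nonneg[of u] by (intro mult_right_mono) auto
      also have "\<dots> = L * (\<eta> / 2 * nsq u)" using \<eta> by (simp add: L_def)
      finally show ?thesis using L by (simp only: mult_le_cancel_left_pos)
    qed
    \<comment> \<open>The shells exhaust the complement of the ball; the \<open>\<eta> / 2\<close>
      obtained on each of them pays for the factor 2 in \<open>nsq_add_le\<close>.\<close>
    let ?J = "\<lambda>n. indicator (cball 0 (real (Suc n)) - cball 0 R) :: real^'n \<Rightarrow> real"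
    let ?K = "indicator (- cball 0 R) :: real^'n \<Rightarrow> real"
    have sJ: "sqint (\<lambda>x. ?J n x * u x)" for n
      by (rule sqint_mult_bounded(1)[OF u, where M=1]) (auto simp: indicator_def)
    have sK: "sqint (\<lambda>x. ?K x * u x)"
      by (rule sqint_mult_bounded(1)[OF u, where M=1]) (auto simp: indicator_def)
    have lim: "(\<lambda>n. nsq (\<lambda>x. ?K x * u x - ?J n x * u x)) \<longlonglongrightarrow> 0"
    proof (rule nsq_tendsto_0[OF _ u, where C=1])
      show "(\<lambda>x. ?K x * u x - ?J n x * u x) \<in> borel_measurable borel" for n
        using sqint_measurable[OF sK] sqint_measurable[OF sJ] by measurable
      show "(?K x * u x - ?J n x * u x)\<^sup>2 \<le> 1 * (u x)\<^sup>2" for n x by (auto simp: indicator_def)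
      show "AE x in lborel. (\<lambda>n. ?K x * u x - ?J n x * u x) \<longlonglongrightarrow> 0"
      proof (rule AE_I2)
        fix x :: "real^'n"
        have "eventually (\<lambda>n. ?K x * u x - ?J n x * u x = 0) sequentially"
          using eventually_ge_at_top[of "nat \<lceil>norm x\<rceil>"]
        proof eventually_elim
          case (elim n)
          then have "norm x \<le> real (Suc n)" by linarith
          then show ?case by (auto simp: indicator_def)
        qed
        then show "(\<lambda>n. ?K x * u x - ?J n x * u x) \<longlonglongrightarrow> 0" by (rule tendsto_eventually)
      qed
    qed
    have le: "nsq (\<lambda>x. ?K x * u x) \<le> 2 * nsq (\<lambda>x. ?K x * u x - ?J n x * u x) + 2 * (\<eta> / 2 * nsq u)" for n
    proof -
      have "nsq (\<lambda>x. ?K x * u x) = nsq (\<lambda>x. (?K x * u x - ?J n x * u x) + ?J n x * u x)" by simp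
      also have "\<dots> \<le> 2 * nsq (\<lambda>x. ?K x * u x - ?J n x * u x) + 2 * nsq (\<lambda>x. ?J n x * u x)"
        by (rule nsq_add_le[OF sqint_diff[OF sK sJ] sJ])
      also have "nsq (\<lambda>x. ?J n x * u x) \<le> \<eta> / 2 * nsq u" by (rule part) simp
      finally show ?thesis by simp
    qed
    have "(\<lambda>n. 2 * nsq (\<lambda>x. ?K x * u x - ?J n x * u x) + 2 * (\<eta> / 2 * nsq u)) \<longlonglongrightarrow> 2 * 0 + 2 * (\<eta> / 2 * nsq u)"
      by (intro tendsto_intros lim)
    then have "nsq (\<lambda>x. ?K x * u x) \<le> 2 * 0 + 2 * (\<eta> / 2 * nsq u)"
      by (rule LIMSEQ_le_const) (use le in blast)
    then show ?thesis by simp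
  qed
  then show ?thesis by blast
qed

section \<open>Compactness\<close>

lemma nsq_nn_integral:
  assumes "sqint v"
  shows "(\<integral>\<^sup>+x. ennreal ((v x)\<^sup>2) \<partial>lborel) = ennreal (nsq v)"
  unfolding nsq_def by (rule nn_integral_eq_integral) (use assms in \<open>auto simp: sqint_def\<close>)

text \<open>Riesz-Fischer for geometrically fast sequences. Weighting the squared increments with
  \<open>2 ^ k\<close> leaves the summable \<open>(1 / 2) ^ k\<close>, so almost everywhere the
  increments are O(2^(-k/2)) and the sequence converges. Fatou's lemma then turns the Cauchy
  estimate into a bound on the distance to the limit.\<close>

lemma sqint_complete:
  fixes w :: "nat \<Rightarrow> 'a::euclidean_space \<Rightarrow> real"
  assumes w: "\<And>n. sqint (w n)" and C: "\<And>m n. m \<ge> n \<Longrightarrow> nsq (\<lambda>x. w m x - w n x) \<le> (1 / 4) ^ n"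
  shows "\<exists>u. sqint u \<and> (\<lambda>n. nsq (\<lambda>x. w n x - u x)) \<longlonglongrightarrow> 0"
proof -
  have [measurable]: "w n \<in> borel_measurable borel" for n by (rule sqint_measurable[OF w])
  let ?d = "\<lambda>k x. w (Suc k) x - w k x"
  have sd: "sqint (?d k)" for k by (intro sqint_diff w)
  have "(\<integral>\<^sup>+x. (\<Sum>k. ennreal (2 ^ k * (?d k x)\<^sup>2)) \<partial>lborel) = (\<Sum>k. \<integral>\<^sup>+x. ennreal (2 ^ k * (?d k x)\<^sup>2) \<partial>lborel)"
    by (rule nn_integral_suminf) measurable
  also have "\<dots> = (\<Sum>k. ennreal (2 ^ k * nsq (?d k)))"
    by (simp add: ennreal_mult nn_integral_cmult nsq_nn_integral[OF sd] nsq_nonneg)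
  also have "\<dots> \<le> (\<Sum>k. ennreal ((1 / 2) ^ k))"
  proof (intro suminf_le ennreal_leI summableI)
    fix k
    have "2 ^ k * nsq (?d k) \<le> 2 ^ k * (1 / 4) ^ k" by (intro mult_left_mono C) auto
    also have "\<dots> = (1 / 2) ^ k" by (simp add: power_mult_distrib[symmetric])
    finally show "2 ^ k * nsq (?d k) \<le> (1 / 2) ^ k" .
  qed
  also have "(\<Sum>k. ennreal ((1 / 2) ^ k)) = ennreal (\<Sum>k. (1 / 2) ^ k)"
    by (rule suminf_ennreal2) (auto intro!: summable_geometric)
  also have "\<dots> < \<infinity>" by simp
  finally have fin: "(\<integral>\<^sup>+x. (\<Sum>k. ennreal (2 ^ k * (?d k x)\<^sup>2)) \<partial>lborel) \<noteq> \<infinity>" by simp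
  have "AE x in lborel. (\<Sum>k. ennreal (2 ^ k * (?d k x)\<^sup>2)) \<noteq> \<infinity>"
    by (rule nn_integral_PInf_AE[OF _ fin]) measurable
  then have conv: "AE x in lborel. convergent (\<lambda>n. w n x)"
  proof eventually_elim
    case (elim x)
    have "summable (\<lambda>k. 2 ^ k * (?d k x)\<^sup>2)"
      by (rule summable_suminf_not_top) (use elim in auto)
    then have "(\<lambda>k. 2 ^ k * (?d k x)\<^sup>2) \<longlonglongrightarrow> 0" by (rule summable_LIMSEQ_zero)
    then have "Bseq (\<lambda>k. 2 ^ k * (?d k x)\<^sup>2)" by (intro convergent_imp_Bseq) (auto simp: convergent_def)
    then obtain B where B: "B > 0" "\<And>k. norm (2 ^ k * (?d k x)\<^sup>2) \<le> B" by (auto simp: Bseq_def)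
    have "summable (\<lambda>k. ?d k x)"
    proof (rule summable_comparison_test)
      show "\<exists>N. \<forall>k\<ge>N. norm (?d k x) \<le> sqrt B * sqrt (1 / 2) ^ k"
      proof (intro exI allI impI)
        fix k
        have "(?d k x)\<^sup>2 \<le> B * (1 / 2) ^ k" using B(2)[of k] by (simp add: field_simps)
        then have "sqrt ((?d k x)\<^sup>2) \<le> sqrt (B * (1 / 2) ^ k)" by (rule real_sqrt_le_mono)
        then show "norm (?d k x) \<le> sqrt B * sqrt (1 / 2) ^ k"
          by (simp only: real_sqrt_abs real_norm_def real_sqrt_mult[of B] real_sqrt_power[of "1 / 2"])
      qed
      show "summable (\<lambda>k. sqrt B * sqrt (1 / 2) ^ k)"
        by (intro summable_mult summable_geometric) (simp add: real_less_lsqrt)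
    qed
    then have "convergent (\<lambda>n. \<Sum>k<n. ?d k x)" by (simp add: summable_iff_convergent)
    then have "convergent (\<lambda>n. w n x - w 0 x)" by (simp only: sum_lessThan_telescope[of "\<lambda>n. w n x"])
    from convergent_add[OF this convergent_const[of "w 0 x"]] show ?case by simp
  qed
  define u where "u x = lim (\<lambda>n. w n x)" for x
  have [measurable]: "u \<in> borel_measurable borel" unfolding u_def[abs_def] by measurable
  have lim: "AE x in lborel. (\<lambda>n. w n x) \<longlonglongrightarrow> u x"
    using conv by eventually_elim (simp add: u_def convergent_LIMSEQ_iff)
  have bd: "(\<integral>\<^sup>+x. ennreal ((w n x - u x)\<^sup>2) \<partial>lborel) \<le> ennreal ((1 / 4) ^ n)" for n
  proof -
    have "(\<integral>\<^sup>+x. ennreal ((w n x - u x)\<^sup>2) \<partial>lborel) = (\<integral>\<^sup>+x. liminf (\<lambda>m. ennreal ((w n x - w m x)\<^sup>2)) \<partial>lborel)"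
    proof (rule nn_integral_cong_AE)
      show "AE x in lborel. ennreal ((w n x - u x)\<^sup>2) = liminf (\<lambda>m. ennreal ((w n x - w m x)\<^sup>2))"
        using lim
      proof eventually_elim
        case (elim x)
        have "(\<lambda>m. ennreal ((w n x - w m x)\<^sup>2)) \<longlonglongrightarrow> ennreal ((w n x - u x)\<^sup>2)"
          by (intro tendsto_ennrealI tendsto_intros elim)
        from lim_imp_Liminf[OF _ this] show ?case by simp
      qed
    qed
    also have "\<dots> \<le> liminf (\<lambda>m. \<integral>\<^sup>+x. ennreal ((w n x - w m x)\<^sup>2) \<partial>lborel)"
      by (rule nn_integral_liminf) measurable
    also have "\<dots> = liminf (\<lambda>m. ennreal (nsq (\<lambda>x. w n x - w m x)))"
      by (simp add: nsq_nn_integral[OF sqint_diff[OF w w]])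
    also have "\<dots> \<le> limsup (\<lambda>m. ennreal (nsq (\<lambda>x. w n x - w m x)))" by (rule Liminf_le_Limsup) simp
    also have "\<dots> \<le> ennreal ((1 / 4) ^ n)"
    proof (rule Limsup_bounded)
      show "eventually (\<lambda>m. ennreal (nsq (\<lambda>x. w n x - w m x)) \<le> ennreal ((1 / 4) ^ n)) sequentially"
        using eventually_ge_at_top[of n]
        by eventually_elim (auto intro!: ennreal_leI C simp: nsq_minus_commute[of "w n"])
    qed
    finally show ?thesis .
  qed
  have sn: "sqint (\<lambda>x. w n x - u x)" for n
  proof -
    have "integrable lborel (\<lambda>x. (w n x - u x)\<^sup>2)"
    proof (rule integrableI_bounded)
      have "(\<integral>\<^sup>+x. ennreal ((w n x - u x)\<^sup>2) \<partial>lborel) < \<infinity>"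
        using order_le_less_trans[OF bd[of n] ennreal_less_top] unfolding infinity_ennreal_def .
      then show "(\<integral>\<^sup>+x. ennreal (norm ((w n x - u x)\<^sup>2)) \<partial>lborel) < \<infinity>"
        by (simp only: real_norm_def abs_power2)
      show "(\<lambda>x. (w n x - u x)\<^sup>2) \<in> borel_measurable lborel"
        by (intro borel_measurable_power borel_measurable_diff) auto
    qed
    then show ?thesis by (simp add: sqint_def)
  qed
  have su: "sqint u" using sqint_diff[OF w[of 0] sn[of 0]] by simp
  have "nsq (\<lambda>x. w n x - u x) \<le> (1 / 4) ^ n" for n
    using bd[of n] unfolding nsq_nn_integral[OF sn[of n]] by (subst (asm) ennreal_le_iff) auto
  then have le: "norm (nsq (\<lambda>x. w n x - u x)) \<le> (1 / 4) ^ n" for n by (simp add: nsq_nonneg)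
  have "(\<lambda>n. nsq (\<lambda>x. w n x - u x)) \<longlonglongrightarrow> 0"
    by (rule Lim_null_comparison[OF always_eventually[OF allI[OF le]]]) (rule LIMSEQ_realpow_zero; simp)
  with su show ?thesis by blast
qed

text \<open>A bound on the L^2 norms makes the convolutions uniformly bounded and equicontinuous on
  a ball, so Arzela-Ascoli applies. The conclusion asks for mutual closeness up to \<eta> rather
  than convergence, which is the form a diagonal extraction consumes.\<close>

lemma conv_compact:
  fixes u :: "nat \<Rightarrow> 'a::euclidean_space \<Rightarrow> real"
  assumes u: "\<And>n. sqint (u n)" "\<And>n. nsq (u n) \<le> 1" and k: "cc k" and \<eta>: "\<eta> > 0"
  shows "\<exists>r. strict_mono (r :: nat \<Rightarrow> nat) \<and> (\<forall>i j. nsq (\<lambda>x. indicator (cball 0 R) x * (conv (u (r i)) k x - conv (u (r j)) k x)) \<le> \<eta>)"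
proof -
  obtain R' where R': "\<And>x. norm x > R' \<Longrightarrow> k x = 0" using k by (auto simp: cc_def)
  obtain K where K: "K > 0" "\<And>x. \<bar>k x\<bar> \<le> K" using cc_bounded[OF k] by blast
  define S where "S = R + R'"
  define N where "N = nsq (indicator (cball (0::'a) S) :: 'a \<Rightarrow> real)"
  have I: "(LBINT y. indicator (cball 0 S) y * \<bar>u n y\<bar>) \<le> sqrt N" for n
  proof -
    have s: "sqint (\<lambda>x. \<bar>u n x\<bar>)" using u(1)[of n] by (auto simp: sqint_def)
    have "nsq (\<lambda>x. \<bar>u n x\<bar>) \<le> 1" using u(2)[of n] by (simp add: nsq_def)
    have "(LBINT y. indicator (cball 0 S) y * \<bar>u n y\<bar>) \<le> sqrt N * sqrt (nsq (\<lambda>x. \<bar>u n x\<bar>))"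
      using abs_integral_mult_le[OF sqint_indicator_cball[of S] s] unfolding N_def by linarith
    also have "\<dots> \<le> sqrt N * 1"
      using \<open>nsq (\<lambda>x. \<bar>u n x\<bar>) \<le> 1\<close> by (intro mult_left_mono) (auto simp: N_def nsq_nonneg)
    finally show ?thesis by simp
  qed
  have N: "N \<ge> 0" by (simp add: N_def nsq_nonneg)
  have lu: "locint (u n)" for n by (rule sqint_locint[OF u(1)])
  obtain g r where g: "strict_mono (r :: nat \<Rightarrow> nat)"
    and unif: "\<And>e. 0 < e \<Longrightarrow> \<exists>M. \<forall>n x. n \<ge> M \<and> x \<in> cball 0 R \<longrightarrow> norm (conv (u (r n)) k x - g x) < e"
  proof (rule Arzela_Ascoli[of "cball 0 R" "\<lambda>n. conv (u n) k" "K * sqrt N"])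
    show "compact (cball (0::'a) R)" by simp
    fix n and x :: 'a assume x: "x \<in> cball 0 R"
    have b: "\<bar>k (x - y)\<bar> \<le> K * indicator (cball 0 S) y" for y
    proof (cases "y \<in> cball 0 S")
      case False
      then have "norm (x - y) > R'" using x norm_triangle_sub[of y x] by (simp add: norm_minus_commute S_def)
      then show ?thesis using R' K by simp
    qed (use K in simp)
    have "\<bar>conv (u n) k x\<bar> \<le> K * (LBINT y. indicator (cball 0 S) y * \<bar>u n y\<bar>)"
      unfolding conv_def by (rule locint_mult_bound(2)[OF lu cc_comp_measurable[OF k] b])
    also have "\<dots> \<le> K * sqrt N" using K I by (intro mult_left_mono) auto
    finally show "norm (conv (u n) k x) \<le> K * sqrt N" by simp
  next
    fix x :: 'a and e :: real assume x: "x \<in> cball 0 R" and e: "0 < e"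
    define e' where "e' = e / (sqrt N + 1)"
    have e': "e' > 0" "e' * sqrt N < e"
    proof -
      have "sqrt N + 1 > 0" using N by (simp add: add_nonneg_pos)
      then show "e' > 0" "e' * sqrt N < e" using e by (auto simp: e'_def field_simps)
    qed
    show "\<exists>d. 0 < d \<and> (\<forall>n y. y \<in> cball 0 R \<and> norm (x - y) < d \<longrightarrow> norm (conv (u n) k x - conv (u n) k y) < e)"
    proof (rule conv_equicontinuous[where R=R, OF k R' e'(1)])
      fix d assume d: "d > 0" "\<And>x x' v. locint v \<Longrightarrow> norm x \<le> R \<Longrightarrow> norm x' \<le> R \<Longrightarrow> norm (x - x') < d \<Longrightarrow>
        \<bar>conv v k x - conv v k x'\<bar> \<le> e' * (LBINT y. indicator (cball 0 (R + R')) y * \<bar>v y\<bar>)"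
      have "norm (conv (u n) k x - conv (u n) k y) < e" if "y \<in> cball 0 R" "norm (x - y) < d" for n y
      proof -
        have "\<bar>conv (u n) k x - conv (u n) k y\<bar> \<le> e' * (LBINT y. indicator (cball 0 S) y * \<bar>u n y\<bar>)"
          unfolding S_def using x that by (intro d(2) lu) auto
        also have "\<dots> \<le> e' * sqrt N" using e' I by (intro mult_left_mono) auto
        finally show ?thesis using e' by simp
      qed
      then show ?thesis using d(1) by blast
    qed auto
  qed auto
  define N' where "N' = nsq (indicator (cball (0::'a) R) :: 'a \<Rightarrow> real)"
  have N': "N' \<ge> 0" by (simp add: N'_def nsq_nonneg)
  define \<delta> where "\<delta> = sqrt (\<eta> / (N' + 1)) / 2"
  have \<delta>: "\<delta> > 0" "(2 * \<delta>)\<^sup>2 * N' \<le> \<eta>"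
  proof -
    have p: "N' + 1 > 0" using N' by simp
    then show "\<delta> > 0" using \<eta> by (simp add: \<delta>_def)
    have "(2 * \<delta>)\<^sup>2 = \<eta> / (N' + 1)" using p \<eta> by (simp add: \<delta>_def)
    then have "(2 * \<delta>)\<^sup>2 * (N' + 1) = \<eta>" using p by simp
    moreover have "(2 * \<delta>)\<^sup>2 * N' \<le> (2 * \<delta>)\<^sup>2 * (N' + 1)" by (intro mult_left_mono) auto
    ultimately show "(2 * \<delta>)\<^sup>2 * N' \<le> \<eta>" by simp
  qed
  obtain M where M: "\<And>n x. n \<ge> M \<Longrightarrow> x \<in> cball 0 R \<Longrightarrow> norm (conv (u (r n)) k x - g x) < \<delta>"
    using unif[OF \<delta>(1)] by blast
  show ?thesis
  \<comment> \<open>Dropping the first \<open>M\<close> members makes the estimate hold for all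
    pairs.\<close>
  proof (intro exI[of _ "\<lambda>i. r (i + M)"] conjI allI)
    show "strict_mono (\<lambda>i. r (i + M))" using g by (simp add: strict_mono_def)
    fix i j
    let ?h = "\<lambda>x. indicator (cball 0 R) x * (conv (u (r (i + M))) k x - conv (u (r (j + M))) k x)"
    have m: "?h \<in> borel_measurable borel"
      using conv_measurable[OF lu k, of "r (i + M)"] conv_measurable[OF lu k, of "r (j + M)"]
      by (intro borel_measurable_times borel_measurable_diff borel_measurable_indicator) auto
    have "(?h x)\<^sup>2 \<le> (2 * \<delta>)\<^sup>2 * (indicator (cball 0 R) x)\<^sup>2" for x
    proof (cases "x \<in> cball 0 R")
      case True
      have "\<bar>?h x\<bar> \<le> 2 * \<delta>" using M[of "i + M" x] M[of "j + M" x] True by (simp add: abs_less_iff abs_le_iff)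
      from power_mono[OF this, of 2] show ?thesis using True by simp
    qed simp
    from sqint_bound(2)[OF sqint_indicator_cball m this] show "nsq ?h \<le> \<eta>" using \<delta> by (simp add: N'_def)
  qed
qed

text \<open>Total boundedness: inside a large ball u is close to its mollification, the
  mollifications are precompact there, and outside the ball almost nothing is left. A diagonal
  sequence over the tolerances \<open>(1 / 4) ^ n\<close> then has a limit by completeness.\<close>

lemma compactness:
  fixes u f :: "nat \<Rightarrow> real^'n::finite \<Rightarrow> real"
  assumes s: "\<And>n. wsol (u n) (f n)" and n: "\<And>n. nsq (u n) \<le> 1"
    and f: "\<And>R. \<exists>B. \<forall>n. nsq (\<lambda>x. indicator (cball 0 R) x * f n x) \<le> B"
    and t: "\<And>\<eta>. \<eta> > 0 \<Longrightarrow> \<exists>R. \<forall>n. nsq (\<lambda>x. indicator (- cball 0 R) x * u n x) \<le> \<eta>"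
  shows "\<exists>r v. strict_mono (r :: nat \<Rightarrow> nat) \<and> sqint v \<and> (\<lambda>n. nsq (\<lambda>x. u (r n) x - v x)) \<longlonglongrightarrow> 0"
proof -
  have su: "sqint (u n)" for n using s[of n] by (simp add: wsol_def)
  have ex: "\<exists>r. strict_mono (r :: nat \<Rightarrow> nat) \<and> (\<forall>i j. nsq (\<lambda>x. u (q (r i)) x - u (q (r j)) x) \<le> \<eta>)"
    if \<eta>: "\<eta> > 0" for q :: "nat \<Rightarrow> nat" and \<eta>
  proof -
    \<comment> \<open>The difference of two tails then costs 2 / 64 + 2 / 64 = 1 / 16 of \<eta>,
      like each of the other three pieces; two levels of \<open>nsq_add_le\<close> multiply the four
      pieces by 4.\<close>
    obtain R where R: "\<And>n. nsq (\<lambda>x. indicator (- cball 0 R) x * u n x) \<le> \<eta> / 64" using t[of "\<eta> / 64"] \<eta> by auto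
    obtain B where B: "\<And>n. nsq (\<lambda>x. indicator (cball 0 (R + 1)) x * f n x) \<le> B" using f[of "R + 1"] by blast
    \<comment> \<open>Makes the bound of \<open>mollification_error\<close> at most
      \<open>\<eta> / 16\<close>; since \<open>\<mu> \<ge> 1\<close>, it is enough to control \<mu>
      instead of its square.\<close>
    define \<mu> where "\<mu> = max 1 (32 * B / \<eta>)"
    have \<mu>: "\<mu> \<ge> 1" by (simp add: \<mu>_def)
    have \<mu>B: "2 / \<mu>\<^sup>2 * B \<le> \<eta> / 16"
    proof -
      have "32 * B \<le> \<mu> * \<eta>" using \<eta> by (simp add: \<mu>_def max_def field_simps)
      also have "\<dots> \<le> \<mu>\<^sup>2 * \<eta>" using \<mu> \<eta> by (intro mult_right_mono self_le_power) auto
      finally show ?thesis using \<mu> by (simp add: field_simps)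
    qed
    let ?k = "nmoll \<mu> :: real^'n \<Rightarrow> real"
    have k: "cc ?k" using \<mu> by (intro nmoll_cc) simp
    obtain r where r: "strict_mono (r :: nat \<Rightarrow> nat)" "\<And>i j. nsq (\<lambda>x. indicator (cball 0 R) x * (conv (u (q (r i))) ?k x - conv (u (q (r j))) ?k x)) \<le> \<eta> / 16"
      using conv_compact[of "\<lambda>n. u (q n)" ?k "\<eta> / 16" R] su n k \<eta> by auto
    have "nsq (\<lambda>x. u (q (r i)) x - u (q (r j)) x) \<le> \<eta>" for i j
    proof -
      let ?I = "indicator (cball 0 R) :: real^'n \<Rightarrow> real"
      let ?J = "indicator (- cball 0 R) :: real^'n \<Rightarrow> real"
      let ?a = "u (q (r i))" and ?b = "u (q (r j))"
      let ?A = "conv ?a ?k" and ?B = "conv ?b ?k"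
      have sJ: "sqint (\<lambda>x. ?J x * v x)" if "sqint v" for v
        by (rule sqint_mult_bounded(1)[OF that, where M=1]) (auto simp: indicator_def)
      have sA: "sqint ?A" "sqint ?B" by (intro Young_sqint(1) su k)+
      have e1: "nsq (\<lambda>x. ?I x * (?a x - ?A x)) \<le> \<eta> / 16" "nsq (\<lambda>x. ?I x * (?b x - ?B x)) \<le> \<eta> / 16"
        using mollification_error[OF s[of "q (r i)"] \<mu>, of R] mollification_error[OF s[of "q (r j)"] \<mu>, of R]
          mult_left_mono[OF B, of "2 / \<mu>\<^sup>2" "q (r i)"] mult_left_mono[OF B, of "2 / \<mu>\<^sup>2" "q (r j)"] \<mu>B by auto
      have e1': "nsq (\<lambda>x. ?I x * (?B x - ?b x)) \<le> \<eta> / 16"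
        using e1(2) by (simp add: nsq_def power_mult_distrib power2_commute[of "?B _"])
      have e2: "nsq (\<lambda>x. ?J x * ?a x - ?J x * ?b x) \<le> \<eta> / 16"
      proof -
        have "nsq (\<lambda>x. ?J x * ?a x - ?J x * ?b x) \<le> 2 * nsq (\<lambda>x. ?J x * ?a x - 0) + 2 * nsq (\<lambda>x. 0 - ?J x * ?b x)"
          by (rule nsq_triangle[OF sJ[OF su] _ sJ[OF su]]) (simp add: sqint_def)
        also have "nsq (\<lambda>x. 0 - ?J x * ?b x) = nsq (\<lambda>x. ?J x * ?b x)" by (simp add: nsq_def)
        finally show ?thesis using R[of "q (r i)"] R[of "q (r j)"] by simp
      qed
      \<comment> \<open>Inside the ball the two mollifications are inserted; outside it the tails
        are compared directly.\<close>
      have "nsq (\<lambda>x. ?a x - ?b x) = nsq (\<lambda>x. (?I x * (?a x - ?A x) + ?I x * (?A x - ?B x)) + (?I x * (?B x - ?b x) + (?J x * ?a x - ?J x * ?b x)))"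
        by (rule arg_cong[where f=nsq]) (auto simp: indicator_def)
      also have "\<dots> \<le> 2 * nsq (\<lambda>x. ?I x * (?a x - ?A x) + ?I x * (?A x - ?B x)) + 2 * nsq (\<lambda>x. ?I x * (?B x - ?b x) + (?J x * ?a x - ?J x * ?b x))"
        by (intro nsq_add_le sqint_add sqint_localize sqint_diff su sA sJ)
      finally have f: "nsq (\<lambda>x. ?a x - ?b x) \<le> 2 * nsq (\<lambda>x. ?I x * (?a x - ?A x) + ?I x * (?A x - ?B x)) + 2 * nsq (\<lambda>x. ?I x * (?B x - ?b x) + (?J x * ?a x - ?J x * ?b x))" .
      have "nsq (\<lambda>x. ?I x * (?a x - ?A x) + ?I x * (?A x - ?B x)) \<le> 2 * nsq (\<lambda>x. ?I x * (?a x - ?A x)) + 2 * nsq (\<lambda>x. ?I x * (?A x - ?B x))"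
        by (intro nsq_add_le sqint_localize sqint_diff su sA)
      moreover have "nsq (\<lambda>x. ?I x * (?B x - ?b x) + (?J x * ?a x - ?J x * ?b x)) \<le> 2 * nsq (\<lambda>x. ?I x * (?B x - ?b x)) + 2 * nsq (\<lambda>x. ?J x * ?a x - ?J x * ?b x)"
        by (intro nsq_add_le sqint_localize sqint_diff su sA sJ)
      ultimately show ?thesis using f e1 e1' e2 r(2)[of i j] by linarith
    qed
    with r(1) show ?thesis by blast
  qed
  define P where "P n q \<longleftrightarrow> (\<forall>i j. nsq (\<lambda>x. u (q i) x - u (q j) x) \<le> (1 / 4) ^ n)" for n and q :: "nat \<Rightarrow> nat"
  interpret subseqs P
  proof
    fix n and q :: "nat \<Rightarrow> nat"
    show "\<exists>r'. strict_mono r' \<and> P n (q \<circ> r')" using ex[of "(1 / 4) ^ n" q] by (simp add: P_def)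
  qed
  have P: "P n (diagseq \<circ> (+) (Suc n))" for n
    by (rule diagseq_holds) (simp add: P_def)
  \<comment> \<open>The diagonal sequence has the n-th property only from index n + 1 on, hence the
    shift.\<close>
  define w where "w n = u (diagseq (Suc n))" for n
  have "nsq (\<lambda>x. w m x - w n x) \<le> (1 / 4) ^ n" if "m \<ge> n" for m n
    using P[of n] that unfolding P_def w_def
    by (elim allE[of _ "m - n"] allE[of _ 0]) simp
  then obtain v where "sqint v" "(\<lambda>n. nsq (\<lambda>x. w n x - v x)) \<longlonglongrightarrow> 0"
    using sqint_complete[of w] su unfolding w_def by blast
  moreover have "strict_mono (\<lambda>n. diagseq (Suc n))" using subseq_diagseq by (simp add: strict_mono_def)
  ultimately show ?thesis unfolding w_def by blast
qed

section \<open>Eigenfunctions\<close>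

lemma borel_version:
  fixes h :: "'a::euclidean_space \<Rightarrow> real"
  assumes "h \<in> borel_measurable lebesgue"
  obtains h' where "h' \<in> borel_measurable borel" "AE x in lborel. h x = h' x"
  using completion_ex_borel_measurable_real[OF assms] by auto

lemma lebesgue_integral_borel_version:
  fixes h h' :: "'a::euclidean_space \<Rightarrow> real"
  assumes "h \<in> borel_measurable lebesgue" "h' \<in> borel_measurable borel" "AE x in lborel. h x = h' x"
  shows "integral\<^sup>L lebesgue h = integral\<^sup>L lborel h'" "integrable lebesgue h \<longleftrightarrow> integrable lborel h'"
proof -
  have m: "h' \<in> borel_measurable lebesgue" using assms(2) by (auto intro: measurable_completion)
  have "integral\<^sup>L lebesgue h = integral\<^sup>L lebesgue h'"
    by (intro integral_cong_AE assms m AE_completion)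
  then show "integral\<^sup>L lebesgue h = integral\<^sup>L lborel h'" using assms(2) by (simp add: integral_completion)
  have "integrable lebesgue h \<longleftrightarrow> integrable lebesgue h'"
    by (intro integrable_cong_AE assms m AE_completion)
  then show "integrable lebesgue h \<longleftrightarrow> integrable lborel h'" using assms(2) by (simp add: integrable_completion)
qed

text \<open>Bounds that hold almost everywhere become bounds at every point of a ball, so that
  \<open>V'\<close> acts there as a bounded multiplier in \<open>sqint_local_mult\<close>.\<close>

lemma L_inf_loc_borel_version:
  fixes V :: "real^'n::finite \<Rightarrow> real"
  assumes "L_inf_loc V"
  obtains V' where "V' \<in> borel_measurable borel" "AE x in lborel. V x = V' x"
    "\<And>R. \<exists>M. \<forall>x. norm x \<le> R \<longrightarrow> \<bar>V' x\<bar> \<le> M"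
proof -
  have V: "V \<in> borel_measurable lebesgue" and b: "\<And>K. compact K \<Longrightarrow> \<exists>M. AE x in lebesgue. x \<in> K \<longrightarrow> \<bar>V x\<bar> \<le> M"
    using assms by (auto simp: L_inf_loc_def)
  obtain V0 where V0[measurable]: "V0 \<in> borel_measurable borel" and eq: "AE x in lborel. V x = V0 x"
    by (rule borel_version[OF V])
  have "\<exists>M. AE x in lborel. x \<in> cball 0 (real k) \<longrightarrow> \<bar>V x\<bar> \<le> M" for k :: nat
    using b[OF compact_cball, of 0 "real k"] by (simp add: AE_completion_iff)
  then obtain M where M: "\<And>k::nat. AE x in lborel. x \<in> cball 0 (real k) \<longrightarrow> \<bar>V x\<bar> \<le> M k" by metis
  \<comment> \<open>Rounding the norm up selects among countably many bounds, so the exceptional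
    sets have a null union and \<open>V'\<close> stays Borel.\<close>
  define c where "c x = nat \<lceil>norm x\<rceil>" for x :: "real^'n"
  have [measurable]: "c \<in> measurable borel (count_space UNIV)" unfolding c_def[abs_def] by measurable
  have [measurable]: "(\<lambda>x. M (c x)) \<in> borel_measurable borel" by measurable
  define V' where "V' x = (if \<bar>V0 x\<bar> \<le> M (c x) then V0 x else 0)" for x
  show thesis
  proof (rule that)
    show "V' \<in> borel_measurable borel" unfolding V'_def[abs_def] by measurable
    have "AE x in lborel. \<forall>k. x \<in> cball 0 (real k) \<longrightarrow> \<bar>V x\<bar> \<le> M k" using M by (simp add: AE_all_countable)
    then show "AE x in lborel. V x = V' x"
      using eq
    proof eventually_elim
      case (elim x)
      have "norm x \<le> real (c x)" unfolding c_def by linarith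
      then have "\<bar>V x\<bar> \<le> M (c x)" using elim(1) by simp
      then show ?case using elim(2) by (simp add: V'_def)
    qed
    fix R
    \<comment> \<open>\<open>M\<close> need not be monotone in the radius; the sum dominates each of
      its values.\<close>
    have "\<bar>V' x\<bar> \<le> (\<Sum>j\<le>nat \<lceil>R\<rceil>. \<bar>M j\<bar>)" if "norm x \<le> R" for x
    proof -
      have "c x \<le> nat \<lceil>R\<rceil>" unfolding c_def by (intro nat_mono ceiling_mono that)
      then have "\<bar>M (c x)\<bar> \<le> (\<Sum>j\<le>nat \<lceil>R\<rceil>. \<bar>M j\<bar>)" by (intro member_le_sum) auto
      moreover have "\<bar>V' x\<bar> \<le> \<bar>M (c x)\<bar>" by (auto simp: V'_def)
      ultimately show ?thesis by linarith
    qed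
    then show "\<exists>M. \<forall>x. norm x \<le> R \<longrightarrow> \<bar>V' x\<bar> \<le> M" by blast
  qed
qed

lemma laplacian_cc: "test_fun \<phi> \<Longrightarrow> cc (laplacian \<phi>)"
proof -
  assume \<phi>: "test_fun \<phi>"
  have "cc (\<lambda>x. \<Sum>i\<in>A. pder [i, i] \<phi> x)" if "finite A" for A
    using that
  proof (induction A)
    case empty show ?case by (simp add: cc_def)
  next
    case (insert i A)
    then show ?case using cc_add[OF test_fun_cc[OF \<phi>, of "[i, i]"]] by (simp del: pder.simps)
  qed
  then show "cc (laplacian \<phi>)" unfolding laplacian_def[abs_def] by simp
qed

lemma sqint_local_mult:
  fixes V' u :: "real^'n::finite \<Rightarrow> real"
  assumes V: "V' \<in> borel_measurable borel" "\<And>x. norm x \<le> R \<Longrightarrow> \<bar>V' x\<bar> \<le> M" and u: "sqint u"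
  shows "sqint (\<lambda>x. indicator (cball 0 R) x * (V' x * u x))"
    "nsq (\<lambda>x. indicator (cball 0 R) x * (V' x * u x)) \<le> M\<^sup>2 * nsq u"
proof -
  have b: "\<bar>indicator (cball 0 R) x * V' x\<bar> \<le> \<bar>M\<bar>" for x
    using V(2)[of x] by (auto simp: indicator_def)
  have m: "(\<lambda>x. indicator (cball 0 R) x * V' x) \<in> borel_measurable borel"
    by (intro borel_measurable_times borel_measurable_indicator V) auto
  from sqint_mult_bounded[OF u m b] show "sqint (\<lambda>x. indicator (cball 0 R) x * (V' x * u x))"
    "nsq (\<lambda>x. indicator (cball 0 R) x * (V' x * u x)) \<le> M\<^sup>2 * nsq u"
    by (simp_all add: mult.assoc)
qed

text \<open>V may be unbounded at infinity, so V u need not be square-integrable. Attached to the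
  test function instead, the potential gives a square-integrable factor, and pairings with it pass
  to L^2 limits.\<close>

lemma sqint_test_potential:
  fixes V' :: "real^'n::finite \<Rightarrow> real"
  assumes V: "V' \<in> borel_measurable borel" "\<And>R. \<exists>M. \<forall>x. norm x \<le> R \<longrightarrow> \<bar>V' x\<bar> \<le> M" and \<phi>: "test_fun \<phi>"
  shows "sqint (\<lambda>x. V' x * \<phi> x)" "sqint (\<lambda>x. V' x * \<phi> x - laplacian \<phi> x)"
proof -
  have c: "cc \<phi>" using test_fun_cc[OF \<phi>, of "[]"] by simp
  obtain R where R: "\<And>x. norm x > R \<Longrightarrow> \<phi> x = 0" using c by (auto simp: cc_def)
  obtain M where M: "\<forall>x. norm x \<le> R \<longrightarrow> \<bar>V' x\<bar> \<le> M" using V(2) by blast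
  have "(\<lambda>x. V' x * \<phi> x) = (\<lambda>x. indicator (cball 0 R) x * (V' x * \<phi> x))"
    using R by (fastforce simp: indicator_def)
  then show s: "sqint (\<lambda>x. V' x * \<phi> x)"
    using sqint_local_mult(1)[OF V(1) _ cc_sqint[OF c], of R M] M by simp
  show "sqint (\<lambda>x. V' x * \<phi> x - laplacian \<phi> x)"
    by (intro sqint_diff s cc_sqint laplacian_cc \<phi>)
qed

section \<open>Shallow wells and their eigenfunctions\<close>

text \<open>Since \<open>R\<^sub>0 > 1\<close>, the unit ball stays clear of the region where the
  lower bound on V is used.\<close>

definition well :: "nat \<Rightarrow> real^'n::finite \<Rightarrow> real" where
  "well n x = indicator (cball 0 1) x / real (Suc n)"

lemma well_bounds: "0 \<le> well n x" "well n x \<le> 1 / real (Suc n)" "norm x > 1 \<Longrightarrow> well n x = 0"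
  by (auto simp: well_def indicator_def)

lemma well_measurable: "well n \<in> borel_measurable borel"
  unfolding well_def[abs_def] by (intro borel_measurable_divide borel_measurable_indicator) auto

lemma well_measurable_lebesgue: "well n \<in> borel_measurable lebesgue"
  by (rule measurable_completion) (simp add: well_measurable)

lemma admissible_well: "admissible_W (well n :: real^'n::finite \<Rightarrow> real)"
proof -
  have "\<not> (AE x in lebesgue. well n (x :: real^'n) = 0)"
  proof
    assume "AE x in lebesgue. well n (x :: real^'n) = 0"
    then have "AE x in lebesgue. x \<notin> ball (0 :: real^'n) 1"
      by eventually_elim (auto simp: well_def indicator_def)
    then have "negligible (ball (0 :: real^'n) 1)"
      by (simp add: negligible_iff_null_sets AE_iff_null_sets)
    then show False using open_not_negligible[of "ball (0 :: real^'n) 1"] by simp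
  qed
  then show ?thesis
    unfolding admissible_W_def using well_bounds well_measurable_lebesgue by blast
qed

text \<open>An eigenfunction of \<open>H - W\<close> has a nonzero real or imaginary part, which is a real eigenfunction;
  nonnegativity of \<open>H\<close> forces the eigenvalue to be at least \<open>- sup W\<close>.\<close>
lemma real_eigenfunction:
  fixes V V' :: "real^'n::finite \<Rightarrow> real"
  assumes c: "critical V" and Vm: "V \<in> borel_measurable lebesgue"
    and V: "V' \<in> borel_measurable borel" "AE x in lborel. V x = V' x"
      "\<And>R. \<exists>M. \<forall>x. norm x \<le> R \<longrightarrow> \<bar>V' x\<bar> \<le> M"
  shows "\<exists>u E. - 1 / real (Suc n) \<le> E \<and> E \<le> 0 \<and> nsq u = 1 \<and> wsol u (\<lambda>x. (well n x + E - V' x) * u x)"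
proof -
  have "has_neg_eigenvalue_minus V (well n)"
    using c admissible_well unfolding critical_def by blast
  then obtain E psi g where E: "E < 0" and s: "schrod V psi g" and nz: "\<not> (AE x in lebesgue. psi x = 0)"
    and g: "AE x in lebesgue. g x - complex_of_real (well n x) * psi x = complex_of_real E * psi x"
    unfolding has_neg_eigenvalue_minus_def by blast
  have psi: "psi \<in> borel_measurable lebesgue" "integrable lebesgue (\<lambda>x. (cmod (psi x))\<^sup>2)"
    and gm: "g \<in> borel_measurable lebesgue" and gi: "integrable lebesgue (\<lambda>x. (cmod (g x))\<^sup>2)"
    using s by (auto simp: schrod_def L2_def)
  have wm: "(well n :: real^'n \<Rightarrow> real) \<in> borel_measurable lebesgue" by (rule well_measurable_lebesgue)
  have g': "AE x in lebesgue. g x = complex_of_real (well n x + E) * psi x"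
    using g by eventually_elim (simp add: algebra_simps)
  have El: "- 1 / real (Suc n) \<le> E"
  proof -
    define I where "I = (\<integral>x. (cmod (psi x))\<^sup>2 \<partial>lebesgue)"
    have "I \<noteq> 0"
      unfolding I_def using nz integral_nonneg_eq_0_iff_AE[OF psi(2)] by simp
    moreover have "I \<ge> 0" by (simp add: I_def)
    ultimately have I: "I > 0" by simp
    have "ip psi g = (\<integral>x. complex_of_real ((well n x + E) * (cmod (psi x))\<^sup>2) \<partial>lebesgue)"
      unfolding ip_def
    proof (rule integral_cong_AE)
      show "AE x in lebesgue. cnj (psi x) * g x = complex_of_real ((well n x + E) * (cmod (psi x))\<^sup>2)"
        using g'
      proof eventually_elim
        case (elim x)
        have "cnj (psi x) * psi x = complex_of_real ((cmod (psi x))\<^sup>2)"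
          using complex_norm_square[of "psi x"] by (simp add: mult.commute)
        then show ?case unfolding elim by (simp add: mult.assoc mult.left_commute)
      qed
      have "(\<lambda>x. cnj (psi x)) \<in> borel_measurable lebesgue"
        by (rule measurable_compose[OF psi(1)])
          (auto intro!: borel_measurable_continuous_onI continuous_intros)
      then show "(\<lambda>x. cnj (psi x) * g x) \<in> borel_measurable lebesgue"
        using gm by (rule borel_measurable_times)
      show "(\<lambda>x. complex_of_real ((well n x + E) * (cmod (psi x))\<^sup>2)) \<in> borel_measurable lebesgue"
        by (rule measurable_compose[where f="\<lambda>x. (well n x + E) * (cmod (psi x))\<^sup>2" and g=complex_of_real and N=borel])
          (auto intro!: borel_measurable_times borel_measurable_add[OF wm borel_measurable_const]
            borel_measurable_power[OF measurable_compose[OF psi(1) borel_measurable_norm]])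
    qed
    also have "\<dots> = complex_of_real (\<integral>x. (well n x + E) * (cmod (psi x))\<^sup>2 \<partial>lebesgue)"
      by (rule integral_complex_of_real)
    finally have ipe: "ip psi g = complex_of_real (\<integral>x. (well n x + E) * (cmod (psi x))\<^sup>2 \<partial>lebesgue)" .
    have "0 \<le> Re (ip psi g)"
      using c s unfolding critical_def schrod_nonneg_def by blast
    then have "0 \<le> (\<integral>x. (well n x + E) * (cmod (psi x))\<^sup>2 \<partial>lebesgue)"
      by (simp only: ipe Re_complex_of_real)
    also have "\<dots> \<le> (\<integral>x. (1 / real (Suc n) + E) * (cmod (psi x))\<^sup>2 \<partial>lebesgue)"
    proof (rule integral_mono)
      show "integrable lebesgue (\<lambda>x. (well n x + E) * (cmod (psi x))\<^sup>2)"
      proof (rule Bochner_Integration.integrable_bound[where f="\<lambda>x. (1 + \<bar>E\<bar>) * (cmod (psi x))\<^sup>2"])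
        show "AE x in lebesgue. norm ((well n x + E) * (cmod (psi x))\<^sup>2) \<le> norm ((1 + \<bar>E\<bar>) * (cmod (psi x))\<^sup>2)"
        proof (rule AE_I2)
          fix x :: "real^'n"
          have "1 / real (Suc n) \<le> 1" by simp
          then have "\<bar>well n x + E\<bar> \<le> \<bar>1 + \<bar>E\<bar>\<bar>" using well_bounds(1,2)[of n x] by linarith
          then show "norm ((well n x + E) * (cmod (psi x))\<^sup>2) \<le> norm ((1 + \<bar>E\<bar>) * (cmod (psi x))\<^sup>2)"
            by (simp add: abs_mult mult_right_mono)
        qed
      qed (use psi wm in auto)
    qed (use psi well_bounds in \<open>auto intro!: mult_right_mono\<close>)
    also have "\<dots> = (1 / real (Suc n) + E) * I" by (simp add: I_def)
    finally have "0 \<le> 1 / real (Suc n) + E" using I by (simp add: zero_le_mult_iff)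
    then show ?thesis by simp
  qed
  \<comment> \<open>\<open>p\<close> stands for Re or Im. Being bounded, real-linear and compatible
    with real factors, it commutes with the integrals and with multiplication by V and W.\<close>
  have part: "\<exists>u E. - 1 / real (Suc n) \<le> E \<and> E \<le> 0 \<and> nsq u = 1 \<and> wsol u (\<lambda>x. (well n x + E - V' x) * u x)"
    if p: "bounded_linear p" "\<And>z r. p (z * complex_of_real r) = p z * r" "\<And>z. \<bar>p z\<bar> \<le> cmod z"
      "\<not> (AE x in lebesgue. p (psi x) = 0)" for p :: "complex \<Rightarrow> real"
  proof -
    have pm: "p \<in> borel_measurable borel"
      by (rule borel_measurable_continuous_onI[OF linear_continuous_on[OF p(1)]])
    have ppm: "(\<lambda>x. p (psi x)) \<in> borel_measurable lebesgue" using psi pm by measurable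
    obtain u where u: "u \<in> borel_measurable borel" and pu: "AE x in lborel. p (psi x) = u x"
      by (rule borel_version[OF ppm])
    have su: "sqint u"
    proof -
      have "integrable lebesgue (\<lambda>x. (p (psi x))\<^sup>2)"
      proof (rule Bochner_Integration.integrable_bound[OF psi(2)])
        show "AE x in lebesgue. norm ((p (psi x))\<^sup>2) \<le> norm ((cmod (psi x))\<^sup>2)"
          using p(3) by (auto simp: abs_le_square_iff[symmetric])
      qed (use ppm in measurable)
      then have "integrable lborel (\<lambda>x. (u x)\<^sup>2)"
        using pu by (subst lebesgue_integral_borel_version(2)[symmetric, where h="\<lambda>x. (p (psi x))\<^sup>2"]) (use ppm u in auto)
      then show ?thesis using u by (simp add: sqint_def)
    qed
    have nu: "nsq u > 0"
    proof -
      have "nsq u \<noteq> 0"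
      proof
        assume "nsq u = 0"
        then have "AE x in lborel. (u x)\<^sup>2 = 0"
          using integral_nonneg_eq_0_iff_AE[OF sqint_integrable[OF su]] by (simp add: nsq_def)
        then have "AE x in lborel. p (psi x) = 0" using pu by eventually_elim simp
        then show False using p(4) AE_completion by blast
      qed
      then show ?thesis using nsq_nonneg[of u] by linarith
    qed
    have Wu: "sqint (\<lambda>x. (well n x + E) * u x)"
    proof (rule sqint_mult_bounded(1)[OF su, where M="1 + \<bar>E\<bar>"])
      show "(\<lambda>x. well n x + E) \<in> borel_measurable borel" using well_measurable by measurable
      fix x :: "real^'n"
      have "1 / real (Suc n) \<le> 1" by simp
      then show "\<bar>well n x + E\<bar> \<le> 1 + \<bar>E\<bar>" using well_bounds(1,2)[of n x] by linarith
    qed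
    define f where "f x = (well n x + E - V' x) * u x" for x
    have fm: "f \<in> borel_measurable borel" unfolding f_def[abs_def] using V u well_measurable by measurable
    have fl: "sqint (\<lambda>x. indicator (cball 0 R) x * f x)" for R
    proof -
      obtain M where M: "\<forall>x. norm x \<le> R \<longrightarrow> \<bar>V' x\<bar> \<le> M" using V(3) by blast
      have "sqint (\<lambda>x. indicator (cball 0 R) x * ((well n x + E) * u x) - indicator (cball 0 R) x * (V' x * u x))"
        by (intro sqint_diff sqint_localize[OF Wu] sqint_local_mult(1)[OF V(1) _ su, of R M]) (use M in auto)
      then show ?thesis by (simp add: f_def algebra_simps)
    qed
    have weq: "(LBINT x. u x * laplacian \<phi> x) = - (LBINT x. f x * \<phi> x)" if \<phi>: "test_fun \<phi>" for \<phi>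
    proof -
      have cp: "cc \<phi>" using test_fun_cc[OF \<phi>, of "[]"] by simp
      have sp: "sqint \<phi>" "sqint (laplacian \<phi>)" using cc_sqint[OF cp] cc_sqint[OF laplacian_cc[OF \<phi>]] by auto
      define h where "h x = V x * \<phi> x - laplacian \<phi> x" for x
      define h' where "h' x = V' x * \<phi> x - laplacian \<phi> x" for x
      have sV: "sqint (\<lambda>x. V' x * \<phi> x)" "sqint h'" using sqint_test_potential[OF V(1,3) \<phi>] by (simp_all add: h'_def[abs_def])
      have \<phi>m: "\<phi> \<in> borel_measurable lebesgue" "laplacian \<phi> \<in> borel_measurable lebesgue"
        using sqint_measurable[OF sp(1)] sqint_measurable[OF sp(2)] by (auto intro: measurable_completion)
      have hm: "h \<in> borel_measurable lebesgue" unfolding h_def[abs_def] using Vm \<phi>m by measurable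
      have hh: "AE x in lborel. h x = h' x" using V(2) by eventually_elim (simp add: h_def h'_def)
      have ih: "integrable lebesgue (\<lambda>x. (h x)\<^sup>2)"
        using hh sqint_integrable[OF sV(2)] sqint_measurable[OF sV(2)] hm
        by (subst lebesgue_integral_borel_version(2)[where h'="\<lambda>x. (h' x)\<^sup>2"]) auto
      have i\<phi>: "integrable lebesgue (\<lambda>x. (\<phi> x)\<^sup>2)"
        using sqint_integrable[OF sp(1)] sqint_measurable[OF sp(1)] by (simp add: integrable_completion)
      have ci: "integrable lebesgue (\<lambda>x. a x * complex_of_real (b x))"
        if "a \<in> borel_measurable lebesgue" "integrable lebesgue (\<lambda>x. (cmod (a x))\<^sup>2)"
          "b \<in> borel_measurable lebesgue" "integrable lebesgue (\<lambda>x. (b x)\<^sup>2)" for a and b :: "real^'n \<Rightarrow> real"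
      proof (rule Bochner_Integration.integrable_bound[where f="\<lambda>x. (cmod (a x))\<^sup>2 + (b x)\<^sup>2"])
        show "AE x in lebesgue. norm (a x * complex_of_real (b x)) \<le> norm ((cmod (a x))\<^sup>2 + (b x)\<^sup>2)"
        proof (rule AE_I2)
          fix x
          have "2 * (cmod (a x) * \<bar>b x\<bar>) \<le> (cmod (a x))\<^sup>2 + (b x)\<^sup>2"
            using sum_squares_bound[of "cmod (a x)" "\<bar>b x\<bar>"] by simp
          moreover have "0 \<le> cmod (a x) * \<bar>b x\<bar>" by simp
          ultimately have "cmod (a x) * \<bar>b x\<bar> \<le> (cmod (a x))\<^sup>2 + (b x)\<^sup>2" by linarith
          then show "norm (a x * complex_of_real (b x)) \<le> norm ((cmod (a x))\<^sup>2 + (b x)\<^sup>2)"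
            by (simp add: norm_mult)
        qed
      qed (use that in auto)
      have "p (\<integral>x. psi x * complex_of_real (h x) \<partial>lebesgue) = p (\<integral>x. g x * complex_of_real (\<phi> x) \<partial>lebesgue)"
        using s \<phi> by (simp add: schrod_def h_def)
      moreover have "p (\<integral>x. psi x * complex_of_real (h x) \<partial>lebesgue) = (\<integral>x. p (psi x) * h x \<partial>lebesgue)"
        using integral_bounded_linear[OF p(1) ci[OF psi hm ih]] by (simp add: p(2))
      moreover have "(\<integral>x. p (psi x) * h x \<partial>lebesgue) = (LBINT x. u x * h' x)"
      proof (rule lebesgue_integral_borel_version(1))
        show "AE x in lborel. p (psi x) * h x = u x * h' x" using pu hh by eventually_elim simp
      qed (use ppm hm u sqint_measurable[OF sV(2)] in auto)
      moreover have "p (\<integral>x. g x * complex_of_real (\<phi> x) \<partial>lebesgue) = (\<integral>x. p (g x) * \<phi> x \<partial>lebesgue)"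
        using integral_bounded_linear[OF p(1) ci[OF gm gi \<phi>m(1) i\<phi>]] by (simp add: p(2))
      moreover have "(\<integral>x. p (g x) * \<phi> x \<partial>lebesgue) = (LBINT x. ((well n x + E) * u x) * \<phi> x)"
      proof (rule lebesgue_integral_borel_version(1))
        have "(\<lambda>x. p (g x)) \<in> borel_measurable lebesgue" using gm pm by measurable
        then show "(\<lambda>x. p (g x) * \<phi> x) \<in> borel_measurable lebesgue" using \<phi>m(1) by measurable
        show "(\<lambda>x. ((well n x + E) * u x) * \<phi> x) \<in> borel_measurable borel"
          using sqint_measurable[OF Wu] sqint_measurable[OF sp(1)] by measurable
        have "AE x in lborel. g x = complex_of_real (well n x + E) * psi x" using g' by (simp add: AE_completion_iff)
        then show "AE x in lborel. p (g x) * \<phi> x = ((well n x + E) * u x) * \<phi> x"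
          using pu by eventually_elim (simp add: p(2) mult.commute[of "complex_of_real _"] mult.commute[of "_ + E"] del: of_real_add)
      qed
      ultimately have eq: "(LBINT x. u x * h' x) = (LBINT x. ((well n x + E) * u x) * \<phi> x)" by simp
      have i: "integrable lborel (\<lambda>x. u x * (V' x * \<phi> x))" "integrable lborel (\<lambda>x. u x * laplacian \<phi> x)"
        "integrable lborel (\<lambda>x. ((well n x + E) * u x) * \<phi> x)"
        by (intro sqint_mult_integrable su sV sp Wu)+
      have "(LBINT x. u x * h' x) = (LBINT x. u x * (V' x * \<phi> x) - u x * laplacian \<phi> x)"
        by (simp add: h'_def right_diff_distrib)
      also have "\<dots> = (LBINT x. u x * (V' x * \<phi> x)) - (LBINT x. u x * laplacian \<phi> x)" using i by simp
      finally have e1: "(LBINT x. u x * laplacian \<phi> x) = (LBINT x. u x * (V' x * \<phi> x)) - (LBINT x. ((well n x + E) * u x) * \<phi> x)"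
        using eq by simp
      have "(LBINT x. f x * \<phi> x) = (LBINT x. ((well n x + E) * u x) * \<phi> x - u x * (V' x * \<phi> x))"
        by (rule Bochner_Integration.integral_cong) (auto simp: f_def algebra_simps)
      also have "\<dots> = (LBINT x. ((well n x + E) * u x) * \<phi> x) - (LBINT x. u x * (V' x * \<phi> x))"
        using i by simp
      finally show ?thesis using e1 by simp
    qed
    define a where "a = 1 / sqrt (nsq u)"
    define v where "v x = a * u x" for x
    have a2: "a\<^sup>2 * nsq u = 1" using nu by (simp add: a_def power_divide)
    have "wsol v (\<lambda>x. (well n x + E - V' x) * v x)"
    proof -
      have fv: "(\<lambda>x. (well n x + E - V' x) * v x) = (\<lambda>x. a * f x)" by (auto simp: v_def f_def)
      have "sqint v" unfolding v_def[abs_def] by (rule sqint_cmult[OF su])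
      moreover have "(\<lambda>x. a * f x) \<in> borel_measurable borel" using fm by measurable
      moreover have "sqint (\<lambda>x. indicator (cball 0 R) x * (a * f x))" for R
        using sqint_cmult[OF fl[of R], of a] by (simp add: mult_ac)
      moreover have "(LBINT x. v x * laplacian \<phi> x) = - (LBINT x. (a * f x) * \<phi> x)" if "test_fun \<phi>" for \<phi>
        using weq[OF that] by (simp add: v_def mult.assoc)
      ultimately show ?thesis unfolding wsol_def fv by blast
    qed
    moreover have "nsq v = 1" unfolding v_def[abs_def] nsq_cmult by (rule a2)
    ultimately show ?thesis using E El by (intro exI[of _ v] exI[of _ E]) auto
  qed
  show ?thesis
  proof (cases "AE x in lebesgue. Re (psi x) = 0")
    case True
    have "\<not> (AE x in lebesgue. Im (psi x) = 0)"
    proof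
      assume "AE x in lebesgue. Im (psi x) = 0"
      with True have "AE x in lebesgue. psi x = 0" by eventually_elim (simp add: complex_eq_iff)
      with nz show False by blast
    qed
    then show ?thesis by (intro part[of Im]) (auto simp: bounded_linear_Im abs_Im_le_cmod)
  next
    case False
    then show ?thesis by (intro part[of Re]) (auto simp: bounded_linear_Re abs_Re_le_cmod)
  qed
qed

section \<open>The zero-energy ground state as a strong limit\<close>

theorem theorem3:
  fixes V :: "real^'n::finite \<Rightarrow> real"
  assumes "L_inf_loc V"
    and "schrod_self_adjoint V"
    and "critical V"
    and "\<epsilon> > 0" and "R\<^sub>0 > 1"
    and "\<forall>x. norm x \<ge> R\<^sub>0 \<longrightarrow>
           V x \<ge> real CARD('n) * (4 - real CARD('n)) / (4 * (norm x)\<^sup>2)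
                 + (1 + \<epsilon>) / ((norm x)\<^sup>2 * ln (norm x))
                 + (3 + \<epsilon>) / (4 * (norm x)\<^sup>2 * (ln (norm x))\<^sup>2)"
  shows "\<exists>psi. schrod V psi (\<lambda>_. 0) \<and> \<not> (AE x in lebesgue. psi x = 0)"
proof -
  have Vm: "V \<in> borel_measurable lebesgue" using assms(1) by (simp add: L_inf_loc_def)
  obtain V' where V: "V' \<in> borel_measurable borel" "AE x in lborel. V x = V' x"
      "\<And>R. \<exists>M. \<forall>x. norm x \<le> R \<longrightarrow> \<bar>V' x\<bar> \<le> M"
    using L_inf_loc_borel_version[OF assms(1)] by blast
  define Q where "Q n u E \<longleftrightarrow> - 1 / real (Suc n) \<le> E \<and> E \<le> 0 \<and> nsq u = 1 \<and> wsol u (\<lambda>x. (well n x + E - V' x) * u x)"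
    for n u E
  have "\<forall>n. \<exists>u E. Q n u E"
    unfolding Q_def by (intro allI real_eigenfunction[OF assms(3) Vm V])
  then obtain u E where "\<And>n. Q n (u n) (E n)" by metis
  then have E: "\<And>n. - 1 / real (Suc n) \<le> E n" "\<And>n. E n \<le> 0" and nu: "\<And>n. nsq (u n) = 1"
    and s: "\<And>n. wsol (u n) (\<lambda>x. (well n x + E n - V' x) * u n x)" unfolding Q_def by blast+
  define f where "f n x = (well n x + E n - V' x) * u n x" for n x
  have su: "sqint (u n)" for n using s[of n] by (simp add: wsol_def)
  \<comment> \<open>\<open>well n\<close> and \<open>E n\<close> have opposite signs and size at
    most 1 / (n + 1), hence so is their sum. This makes the perturbation of the weak equation vanish
    in the limit.\<close>
  have WE: "\<bar>well n x + E n\<bar> \<le> 1 / real (Suc n)" for n and x :: "real^'n"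
    using E[of n] well_bounds(1,2)[of n x] by (auto simp: abs_le_iff)
  have WE1: "\<bar>well n x + E n\<bar> \<le> 1" for n and x :: "real^'n"
    by (rule order_trans[OF WE]) simp
  have WEm: "(\<lambda>x. well n x + E n) \<in> borel_measurable borel" for n using well_measurable by measurable
  have AEV: "AE x in lborel. norm x \<ge> R\<^sub>0 \<longrightarrow>
           V' x \<ge> real CARD('n) * (4 - real CARD('n)) / (4 * (norm x)\<^sup>2)
                 + (1 + \<epsilon>) / ((norm x)\<^sup>2 * ln (norm x))
                 + (3 + \<epsilon>) / (4 * (norm x)\<^sup>2 * (ln (norm x))\<^sup>2)"
    using V(2) by eventually_elim (use assms(6) in auto)
  have "\<exists>r v. strict_mono (r :: nat \<Rightarrow> nat) \<and> sqint v \<and> (\<lambda>n. nsq (\<lambda>x. u (r n) x - v x)) \<longlonglongrightarrow> 0"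
  proof (rule compactness)
    show "wsol (u n) (f n)" for n using s[of n] by (simp add: f_def[abs_def])
    show "nsq (u n) \<le> 1" for n by (simp add: nu)
    fix R
    obtain M where M: "\<forall>x. norm x \<le> R \<longrightarrow> \<bar>V' x\<bar> \<le> M" using V(3) by blast
    have "nsq (\<lambda>x. indicator (cball 0 R) x * f n x) \<le> (1 + \<bar>M\<bar>)\<^sup>2" for n
    proof -
      have "nsq (\<lambda>x. indicator (cball 0 R) x * ((well n x + E n - V' x) * u n x)) \<le> (1 + \<bar>M\<bar>)\<^sup>2 * nsq (u n)"
      proof (rule sqint_local_mult(2)[OF _ _ su])
        show "(\<lambda>x. well n x + E n - V' x) \<in> borel_measurable borel" using WEm[of n] V(1) by measurable
        show "\<bar>well n x + E n - V' x\<bar> \<le> 1 + \<bar>M\<bar>" if "norm x \<le> R" for x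
          using WE1[of n x] M[rule_format, OF that] by linarith
      qed
      then show ?thesis by (simp add: f_def nu)
    qed
    then show "\<exists>B. \<forall>n. nsq (\<lambda>x. indicator (cball 0 R) x * f n x) \<le> B" by blast
  next
    fix \<eta> :: real assume "\<eta> > 0"
    from tightness[OF AEV assms(4,5) this] obtain R where
      R: "\<And>u f W E. wsol u f \<Longrightarrow> (AE x in lborel. f x = (W x + E - V' x) * u x) \<Longrightarrow> E \<le> 0 \<Longrightarrow>
        (\<forall>x. norm x \<ge> R\<^sub>0 \<longrightarrow> W x = 0) \<Longrightarrow> nsq (\<lambda>x. indicator (- cball 0 R) x * u x) \<le> \<eta> * nsq u"
      by blast
    have "nsq (\<lambda>x. indicator (- cball 0 R) x * u n x) \<le> \<eta>" for n
    proof -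
      have "nsq (\<lambda>x. indicator (- cball 0 R) x * u n x) \<le> \<eta> * nsq (u n)"
      proof (rule R[OF s[of n]])
        show "AE x in lborel. (well n x + E n - V' x) * u n x = (well n x + E n - V' x) * u n x" by simp
        show "E n \<le> 0" by (rule E)
        show "\<forall>x :: real^'n. norm x \<ge> R\<^sub>0 \<longrightarrow> well n x = 0"
        proof (intro allI impI)
          fix x :: "real^'n" assume "norm x \<ge> R\<^sub>0"
          then show "well n x = 0" using assms(5) by (intro well_bounds(3)) simp
        qed
      qed
      then show ?thesis by (simp add: nu)
    qed
    then show "\<exists>R. \<forall>n. nsq (\<lambda>x. indicator (- cball 0 R) x * u n x) \<le> \<eta>" by blast
  qed
  then obtain r v where r: "strict_mono (r :: nat \<Rightarrow> nat)" and v: "sqint v"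
    and lim: "(\<lambda>n. nsq (\<lambda>x. u (r n) x - v x)) \<longlonglongrightarrow> 0" by blast
  \<comment> \<open>Here strong convergence is essential: if \<open>v\<close> were null,
    \<open>nsq (u (r n)) = 1\<close> would be bounded by twice a null sequence.\<close>
  have nv: "nsq v \<noteq> 0"
  proof
    assume z: "nsq v = 0"
    have ge: "1 \<le> 2 * nsq (\<lambda>x. u (r n) x - v x)" for n
      using nsq_add_le[OF sqint_diff[OF su v] v, of "r n"] by (simp add: nu z)
    have "(\<lambda>n. 2 * nsq (\<lambda>x. u (r n) x - v x)) \<longlonglongrightarrow> 2 * 0" by (intro tendsto_intros lim)
    then have "(1::real) \<le> 2 * 0" by (rule LIMSEQ_le_const) (use ge in blast)
    then show False by simp
  qed
  \<comment> \<open>With the potential on the test function the left side converges along the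
    subsequence; by Cauchy-Schwarz the right side is at most the size of \<open>well n + E n\<close>
    times the norm of \<phi>.\<close>
  have weq: "(LBINT x. v x * (V' x * \<phi> x - laplacian \<phi> x)) = 0" if \<phi>: "test_fun \<phi>" for \<phi>
  proof -
    have sp: "sqint \<phi>" "sqint (laplacian \<phi>)"
      using cc_sqint[OF test_fun_cc[OF \<phi>, of "[]"]] cc_sqint[OF laplacian_cc[OF \<phi>]] by auto
    note sh = sqint_test_potential[OF V(1,3) \<phi>]
    have eq: "(LBINT x. u n x * (V' x * \<phi> x - laplacian \<phi> x)) = (LBINT x. ((well n x + E n) * u n x) * \<phi> x)" for n
    proof -
      have Wu: "sqint (\<lambda>x. (well n x + E n) * u n x)" by (rule sqint_mult_bounded(1)[OF su WEm WE1])
      have i: "integrable lborel (\<lambda>x. u n x * (V' x * \<phi> x))" "integrable lborel (\<lambda>x. u n x * laplacian \<phi> x)"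
        "integrable lborel (\<lambda>x. ((well n x + E n) * u n x) * \<phi> x)"
        by (intro sqint_mult_integrable su sh sp Wu)+
      have "(LBINT x. u n x * (V' x * \<phi> x - laplacian \<phi> x)) = (LBINT x. u n x * (V' x * \<phi> x)) - (LBINT x. u n x * laplacian \<phi> x)"
        using i by (simp add: right_diff_distrib)
      also have "(LBINT x. u n x * laplacian \<phi> x) = - (LBINT x. ((well n x + E n - V' x) * u n x) * \<phi> x)"
        using s[of n] \<phi> by (simp add: wsol_def)
      also have "(LBINT x. ((well n x + E n - V' x) * u n x) * \<phi> x) = (LBINT x. ((well n x + E n) * u n x) * \<phi> x - u n x * (V' x * \<phi> x))"
        by (rule Bochner_Integration.integral_cong) (auto simp: algebra_simps)
      also have "\<dots> = (LBINT x. ((well n x + E n) * u n x) * \<phi> x) - (LBINT x. u n x * (V' x * \<phi> x))"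
        using i by simp
      finally show ?thesis by simp
    qed
    have bd: "norm (LBINT x. u n x * (V' x * \<phi> x - laplacian \<phi> x)) \<le> 1 / real (Suc n) * sqrt (nsq \<phi>)" for n
    proof -
      note Wu = sqint_mult_bounded[OF su WEm WE, of n n]
      have "sqrt (nsq (\<lambda>x. (well n x + E n) * u n x)) \<le> 1 / real (Suc n)"
        by (rule real_le_lsqrt) (use Wu(2) in \<open>simp_all add: nu\<close>)
      then have "sqrt (nsq (\<lambda>x. (well n x + E n) * u n x)) * sqrt (nsq \<phi>) \<le> 1 / real (Suc n) * sqrt (nsq \<phi>)"
        by (intro mult_right_mono) (auto simp: nsq_nonneg)
      then show ?thesis unfolding eq using abs_integral_mult_le[OF Wu(1) sp(1)] by simp
    qed
    have "(\<lambda>n. LBINT x. u (r n) x * (V' x * \<phi> x - laplacian \<phi> x)) \<longlonglongrightarrow> (LBINT x. v x * (V' x * \<phi> x - laplacian \<phi> x))"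
      by (rule tendsto_integral_mult[OF su sh(2) v sh(2) lim]) (simp add: nsq_def)
    moreover have "(\<lambda>n. LBINT x. u (r n) x * (V' x * \<phi> x - laplacian \<phi> x)) \<longlonglongrightarrow> 0"
    proof (rule Lim_null_comparison)
      show "eventually (\<lambda>n. norm (LBINT x. u (r n) x * (V' x * \<phi> x - laplacian \<phi> x)) \<le> 1 / real (Suc (r n)) * sqrt (nsq \<phi>)) sequentially"
        using bd by simp
      have "(\<lambda>n. 1 / real (Suc n) * sqrt (nsq \<phi>)) \<longlonglongrightarrow> 0 * sqrt (nsq \<phi>)"
        using LIMSEQ_inverse_real_of_nat by (intro tendsto_mult_right) (simp add: inverse_eq_divide)
      then have "(\<lambda>n. 1 / real (Suc n) * sqrt (nsq \<phi>)) \<longlonglongrightarrow> 0" by simp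
      from LIMSEQ_subseq_LIMSEQ[OF this r]
      show "(\<lambda>n. 1 / real (Suc (r n)) * sqrt (nsq \<phi>)) \<longlonglongrightarrow> 0" by (simp add: o_def)
    qed
    ultimately show ?thesis by (rule LIMSEQ_unique)
  qed
  define psi where "psi x = complex_of_real (v x)" for x
  have vm: "v \<in> borel_measurable lebesgue" using sqint_measurable[OF v] by (auto intro: measurable_completion)
  have "L2 psi"
  proof -
    have "integrable lebesgue (\<lambda>x. (v x)\<^sup>2)"
      using sqint_integrable[OF v] sqint_measurable[OF v] by (simp add: integrable_completion)
    moreover have "psi \<in> borel_measurable lebesgue"
      unfolding psi_def[abs_def]
      by (rule measurable_compose[OF vm]) (auto intro!: borel_measurable_continuous_onI continuous_intros)
    ultimately show ?thesis by (simp add: L2_def psi_def)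
  qed
  moreover have "L2 (\<lambda>_ :: real^'n. 0)" by (simp add: L2_def)
  moreover have "(\<integral>x. psi x * complex_of_real (V x * \<phi> x - laplacian \<phi> x) \<partial>lebesgue) = 0" if \<phi>: "test_fun \<phi>" for \<phi>
  proof -
    note sh = sqint_test_potential[OF V(1,3) \<phi>]
    have \<phi>m: "\<phi> \<in> borel_measurable lebesgue" "laplacian \<phi> \<in> borel_measurable lebesgue"
      using cc_measurable[OF test_fun_cc[OF \<phi>, of "[]"]] cc_measurable[OF laplacian_cc[OF \<phi>]] by (auto intro: measurable_completion)
    have "(\<integral>x. psi x * complex_of_real (V x * \<phi> x - laplacian \<phi> x) \<partial>lebesgue) = (\<integral>x. complex_of_real (v x * (V x * \<phi> x - laplacian \<phi> x)) \<partial>lebesgue)"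
      by (simp add: psi_def)
    also have "\<dots> = complex_of_real (\<integral>x. v x * (V x * \<phi> x - laplacian \<phi> x) \<partial>lebesgue)"
      by (rule integral_complex_of_real)
    also have "(\<integral>x. v x * (V x * \<phi> x - laplacian \<phi> x) \<partial>lebesgue) = (LBINT x. v x * (V' x * \<phi> x - laplacian \<phi> x))"
    proof (rule lebesgue_integral_borel_version(1))
      show "(\<lambda>x. v x * (V x * \<phi> x - laplacian \<phi> x)) \<in> borel_measurable lebesgue" using vm Vm \<phi>m by measurable
      show "(\<lambda>x. v x * (V' x * \<phi> x - laplacian \<phi> x)) \<in> borel_measurable borel"
        using sqint_measurable[OF v] sqint_measurable[OF sh(2)] by measurable
      show "AE x in lborel. v x * (V x * \<phi> x - laplacian \<phi> x) = v x * (V' x * \<phi> x - laplacian \<phi> x)"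
        using V(2) by eventually_elim simp
    qed
    finally show ?thesis using weq[OF \<phi>] by simp
  qed
  ultimately have "schrod V psi (\<lambda>_. 0)" by (simp add: schrod_def)
  moreover have "\<not> (AE x in lebesgue. psi x = 0)"
  proof
    assume "AE x in lebesgue. psi x = 0"
    then have "AE x in lborel. (v x)\<^sup>2 = 0" by (simp add: AE_completion_iff psi_def)
    then have "nsq v = 0" using integral_nonneg_eq_0_iff_AE[OF sqint_integrable[OF v]] by (simp add: nsq_def)
    with nv show False by blast
  qed
  ultimately show ?thesis by blast
qed

end
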